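(* Let $K$ be a perfect field of characteristic $p>0$ and let $F$ be an algebraic function field of transcendence degree $1$ over $K$. If $K$ is relatively algebraically closed in $F$, then the quotient module $F/K$ is a free $K[\varphi]$-module.
   Context: An algebraic function field $F|K$ is a finitely generated field extension of $K$. $K[\varphi]$ is the ring of additive polynomials over $K$: its elements are the finite sums $\sum_{i=0}^m c_i\varphi^i$ with $c_i\in K$ (corresponding to the additive polynomials $\sum_{i=0}^m c_iX^{p^i}$, with multiplication corresponding to composition), so it is the skew polynomial ring in $\varphi$ over $K$ with multiplication rule $\varphi c=c^p\varphi$ for $c\in K$. Every extension field $F$ of $K$ is a left $K[\varphi]$-module, where $c\in K$ acts by multiplication and $\varphi$ acts as the Frobenius $a\mapsto a^p$. $K$ is a $K[\varphi]$-submodule of $F$, and $F/K$ denotes the quotient left $K[\varphi]$-module. *)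

theory Defs
  imports "HOL-Algebra.Algebra"
begin

section \<open>Field extensions\<close>

text \<open>Extensions \<open>F|K\<close> are given by a field record \<open>F\<close> and a subfield \<open>K\<close> of it (a subset of
  \<open>carrier F\<close>); \<open>K\<close> as a field in its own right is \<open>F\<lparr>carrier := K\<rparr>\<close>.\<close>

definition ring_char :: "('a, 'm) ring_scheme \<Rightarrow> nat" where
  "ring_char R =
     (if \<exists>n::nat. n > 0 \<and> add_pow R n \<one>\<^bsub>R\<^esub> = \<zero>\<^bsub>R\<^esub>
      then LEAST n::nat. n > 0 \<and> add_pow R n \<one>\<^bsub>R\<^esub> = \<zero>\<^bsub>R\<^esub>
      else 0)"

definition perfect_field :: "('a, 'm) ring_scheme \<Rightarrow> bool" where
  "perfect_field R \<longleftrightarrow> field R \<and>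
     (ring_char R = 0 \<or> (\<forall>a\<in>carrier R. \<exists>b\<in>carrier R. b [^]\<^bsub>R\<^esub> ring_char R = a))"

definition function_field :: "('a, 'm) ring_scheme \<Rightarrow> 'a set \<Rightarrow> bool" where
  "function_field F K \<longleftrightarrow> field F \<and> subfield K F \<and>
     (\<exists>S. finite S \<and> S \<subseteq> carrier F \<and> generate_field F (K \<union> S) = carrier F)"

definition relatively_algebraically_closed :: "('a, 'm) ring_scheme \<Rightarrow> 'a set \<Rightarrow> bool" where
  "relatively_algebraically_closed F K \<longleftrightarrow>
     (\<forall>x\<in>carrier F. ring.algebraic F K x \<longrightarrow> x \<in> K)"

text \<open>The value of a polynomial in variables indexed by elements of \<open>F\<close>, each variable being
  replaced by its index. As in \<^theory>\<open>HOL-Algebra.Indexed_Polynomials\<close>, a polynomial maps each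
  monomial (a multiset of variables) to its coefficient.\<close>

definition indexed_value :: "('a, 'm) ring_scheme \<Rightarrow> ('a multiset \<Rightarrow> 'a) \<Rightarrow> 'a" where
  "indexed_value F P =
     (\<Oplus>\<^bsub>F\<^esub>m\<in>{m. P m \<noteq> \<zero>\<^bsub>F\<^esub>}. P m \<otimes>\<^bsub>F\<^esub> (\<Otimes>\<^bsub>F\<^esub>x\<in>set_mset m. x [^]\<^bsub>F\<^esub> count m x))"

definition algebraically_independent :: "('a, 'm) ring_scheme \<Rightarrow> 'a set \<Rightarrow> 'a set \<Rightarrow> bool" where
  "algebraically_independent F K S \<longleftrightarrow>
     (\<forall>P \<in> ring.indexed_pset F S K.
        indexed_value F P = \<zero>\<^bsub>F\<^esub> \<longrightarrow> P = ring.indexed_const F \<zero>\<^bsub>F\<^esub>)"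

definition transcendence_basis :: "('a, 'm) ring_scheme \<Rightarrow> 'a set \<Rightarrow> 'a set \<Rightarrow> bool" where
  "transcendence_basis F K S \<longleftrightarrow> S \<subseteq> carrier F \<and> algebraically_independent F K S \<and>
     (\<forall>x\<in>carrier F. ring.algebraic F (generate_field F (K \<union> S)) x)"

definition has_transcendence_degree :: "('a, 'm) ring_scheme \<Rightarrow> 'a set \<Rightarrow> nat \<Rightarrow> bool" where
  "has_transcendence_degree F K n \<longleftrightarrow> (\<exists>S. transcendence_basis F K S \<and> finite S \<and> card S = n)"


section \<open>Left modules\<close>

text \<open>The locale \<^locale>\<open>module\<close> requires a commutative ring of scalars; here the scalars may be
  noncommutative.\<close>

locale left_module = R?: ring R + M?: abelian_group M
    for R :: "('r, 'm) ring_scheme" (structure) and M :: "('r, 'a, 'n) module_scheme" (structure) +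
  assumes smult_closed:
      "\<lbrakk> r \<in> carrier R; x \<in> carrier M \<rbrakk> \<Longrightarrow> r \<odot>\<^bsub>M\<^esub> x \<in> carrier M"
    and smult_l_distr:
      "\<lbrakk> r \<in> carrier R; s \<in> carrier R; x \<in> carrier M \<rbrakk> \<Longrightarrow>
       (r \<oplus>\<^bsub>R\<^esub> s) \<odot>\<^bsub>M\<^esub> x = r \<odot>\<^bsub>M\<^esub> x \<oplus>\<^bsub>M\<^esub> s \<odot>\<^bsub>M\<^esub> x"
    and smult_r_distr:
      "\<lbrakk> r \<in> carrier R; x \<in> carrier M; y \<in> carrier M \<rbrakk> \<Longrightarrow>
       r \<odot>\<^bsub>M\<^esub> (x \<oplus>\<^bsub>M\<^esub> y) = r \<odot>\<^bsub>M\<^esub> x \<oplus>\<^bsub>M\<^esub> r \<odot>\<^bsub>M\<^esub> y"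
    and smult_assoc1:
      "\<lbrakk> r \<in> carrier R; s \<in> carrier R; x \<in> carrier M \<rbrakk> \<Longrightarrow>
       (r \<otimes>\<^bsub>R\<^esub> s) \<odot>\<^bsub>M\<^esub> x = r \<odot>\<^bsub>M\<^esub> (s \<odot>\<^bsub>M\<^esub> x)"
    and smult_one:
      "x \<in> carrier M \<Longrightarrow> \<one>\<^bsub>R\<^esub> \<odot>\<^bsub>M\<^esub> x = x"

definition module_basis ::
    "('r, 'm) ring_scheme \<Rightarrow> ('r, 'a, 'n) module_scheme \<Rightarrow> 'a set \<Rightarrow> bool" where
  "module_basis R M B \<longleftrightarrow> B \<subseteq> carrier M \<and>
     (\<forall>A r. finite A \<and> A \<subseteq> B \<and> r \<in> A \<rightarrow> carrier R \<and> (\<Oplus>\<^bsub>M\<^esub>b\<in>A. r b \<odot>\<^bsub>M\<^esub> b) = \<zero>\<^bsub>M\<^esub>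
        \<longrightarrow> (\<forall>b\<in>A. r b = \<zero>\<^bsub>R\<^esub>)) \<and>
     (\<forall>x\<in>carrier M. \<exists>A r. finite A \<and> A \<subseteq> B \<and> r \<in> A \<rightarrow> carrier R \<and>
        x = (\<Oplus>\<^bsub>M\<^esub>b\<in>A. r b \<odot>\<^bsub>M\<^esub> b))"

definition free_left_module ::
    "('r, 'm) ring_scheme \<Rightarrow> ('r, 'a, 'n) module_scheme \<Rightarrow> bool" where
  "free_left_module R M \<longleftrightarrow> left_module R M \<and> (\<exists>B. module_basis R M B)"

text \<open>The fields \<open>mult\<close> and \<open>one\<close>, which the record type inherits from rings, play no role
  for modules.\<close>

definition quotient_module ::
    "('r, 'a, 'n) module_scheme \<Rightarrow> 'a set \<Rightarrow> ('r, 'a set) module" where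
  "quotient_module M N =
     \<lparr>carrier = a_rcosets\<^bsub>M\<^esub> N, monoid.mult = undefined, one = undefined,
      ring.zero = N, add = set_add M,
      smult = (\<lambda>r C. \<Union>x\<in>C. N +>\<^bsub>M\<^esub> (r \<odot>\<^bsub>M\<^esub> x))\<rparr>"


section \<open>The ring of additive polynomials and its action\<close>

text \<open>The sum of the \<open>c\<^sub>i \<phi>\<^sup>i\<close> is represented by its coefficient function, which has finite support.
  The product is determined by \<open>(a \<phi>\<^sup>i) (b \<phi>\<^sup>j) = a b\<^bsup>p^i\<^esup> \<phi>\<^bsup>i+j\<^esup>\<close>, an iteration of
  \<open>\<phi> c = c\<^sup>p \<phi>\<close>.\<close>

definition additive_poly_ring :: "('a, 'm) ring_scheme \<Rightarrow> nat \<Rightarrow> (nat \<Rightarrow> 'a) ring" where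
  "additive_poly_ring K p =
     \<lparr>carrier = up K,
      monoid.mult = (\<lambda>f g n. \<Oplus>\<^bsub>K\<^esub>i\<in>{..n}. f i \<otimes>\<^bsub>K\<^esub> (g (n - i) [^]\<^bsub>K\<^esub> (p ^ i))),
      one = (\<lambda>n. if n = 0 then \<one>\<^bsub>K\<^esub> else \<zero>\<^bsub>K\<^esub>),
      ring.zero = (\<lambda>n. \<zero>\<^bsub>K\<^esub>),
      add = (\<lambda>f g n. f n \<oplus>\<^bsub>K\<^esub> g n)\<rparr>"

text \<open>\<open>F\<close> as a left module, \<open>\<phi>\<close> acting as \<open>a \<mapsto> a\<^sup>p\<close>.\<close>

definition frobenius_module :: "('a, 'm) ring_scheme \<Rightarrow> nat \<Rightarrow> (nat \<Rightarrow> 'a, 'a) module" where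
  "frobenius_module F p =
     \<lparr>carrier = carrier F, monoid.mult = (\<otimes>\<^bsub>F\<^esub>), one = \<one>\<^bsub>F\<^esub>, ring.zero = \<zero>\<^bsub>F\<^esub>, add = (\<oplus>\<^bsub>F\<^esub>),
      smult = (\<lambda>f a. \<Oplus>\<^bsub>F\<^esub>i\<in>{i. f i \<noteq> \<zero>\<^bsub>F\<^esub>}. f i \<otimes>\<^bsub>F\<^esub> (a [^]\<^bsub>F\<^esub> (p ^ i)))\<rparr>"

end

theory Submission
  imports Defs
begin

text \<open>Since \<open>K\<close> is perfect, a set whose image in \<open>F/F\<^sup>p\<close> is linearly independent over \<open>K\<close> is independent
  over \<open>K[\<phi>]\<close> modulo \<open>K\<close>, so the point is to choose a lift of a basis of \<open>F/F\<^sup>p\<close> that also generates.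
  This succeeds if \<open>F\<close> is the union of a well-ordered chain of \<open>K\<close>-subspaces \<open>W\<^sub>i\<close> such that \<open>x\<^sup>p \<in> W\<^sub>i\<close>
  forces \<open>x \<in> K\<close> or \<open>x \<in> W\<^sub>j\<close> for some \<open>j < i\<close>: choose the basis greedily along the chain.

  To obtain the chain, well-order \<open>F\<close> and let \<open>A\<^sub>z\<close> be the intersection of the valuation rings
  containing \<open>K\<close> and all \<open>y < z\<close>. If \<open>z \<notin> A\<^sub>z\<close>, put \<open>t = 1/z\<close>; between \<open>A\<^sub>z\<close> and its successor we insert the
  subspaces of those \<open>x\<close> for which \<open>x\<^bsup>q\<^esup> t\<^bsup>p^k\<^esup>\<close>, \<open>k = 0, 1, \<dots>\<close>, has no pole at the valuation rings
  containing \<open>K\<close>, \<open>t\<close> and all \<open>y < z\<close>. Here \<open>q\<close> is a power of \<open>p\<close>, which makes these sets additive subgroups, and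
  taking \<open>p\<close>-th roots lowers \<open>k\<close> by one. If \<open>q\<close> exceeds the degree of \<open>F\<close> over \<open>K(t)\<close>, then the step
  \<open>k = 0\<close> is \<open>A\<^sub>z\<close> itself: if \<open>x\<close> had a pole where \<open>t = 0\<close>, but \<open>x\<^bsup>q\<^esup> t\<close> had none, too many powers of \<open>x\<close> would be
  independent over \<open>K(t)\<close>. The chain starts at \<open>K\<close> because \<open>K\<close> is algebraically closed in \<open>F\<close>.\<close>

text \<open>Torsion-freeness is not enough: \<open>F/K\<close> has infinite rank, and torsion-free
  modules such as the perfect closure of \<open>F\<close> modulo \<open>K\<close> are not free.
  There every element is a p-th power, so the greedy basis is empty and generates nothing beyond
  \<open>K\<close>. Independence thus costs little and generation carries the weight: repeated
  extraction of p-th roots must be shown to stop. What stops it is the discreteness of pole orders,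
  which comes from the finite degree of \<open>F\<close> over each \<open>K(t)\<close> with
  \<open>t\<close> transcendental.

  The rings \<open>A_z\<close> alone are not a suitable chain, because they are closed under p-th
  roots: \<open>x^p\<close> in a new ring only gives \<open>x\<close> in the same ring. The inserted
  subspaces supply the missing measure. For a valuation \<open>v\<close> positive at
  \<open>t\<close>, the condition reads \<open>v(x) >= -(p^k/q) v(t)\<close>. Passing from
  \<open>x^p\<close> to \<open>x\<close> divides the permitted pole order exactly by
  \<open>p\<close>, and the fraction is so small at \<open>k = 0\<close> that no pole is left.
  Arbitrary valuation rings suffice for this; no divisors, residue degrees or Riemann-Roch spaces
  enter.\<close>

context field
begin

section \<open>Inverses, powers and subrings\<close>

lemma inv_closed: "x \<in> carrier R \<Longrightarrow> x \<noteq> \<zero> \<Longrightarrow> inv x \<in> carrier R"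
  by (simp add: field_Units)

lemma inv_mult_self: "x \<in> carrier R \<Longrightarrow> x \<noteq> \<zero> \<Longrightarrow> inv x \<otimes> x = \<one>"
  by (simp add: field_Units)

lemma self_mult_inv: "x \<in> carrier R \<Longrightarrow> x \<noteq> \<zero> \<Longrightarrow> x \<otimes> inv x = \<one>"
  by (simp add: field_Units)

lemma inv_nonzero: "x \<in> carrier R \<Longrightarrow> x \<noteq> \<zero> \<Longrightarrow> inv x \<noteq> \<zero>"
  using self_mult_inv[of x] by auto

lemma inv_inv_field: "x \<in> carrier R \<Longrightarrow> x \<noteq> \<zero> \<Longrightarrow> inv (inv x) = x"
  using field_Units by simp

lemma pow_mult_inv_pow:
  assumes "x \<in> carrier R" "x \<noteq> \<zero>" "m \<le> n"
  shows "x [^] (n::nat) \<otimes> inv x [^] (m::nat) = x [^] (n - m)"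
proof -
  have "x [^] n = x [^] (n - m) \<otimes> x [^] m"
    using assms by (simp add: nat_pow_mult)
  moreover have "x [^] m \<otimes> inv x [^] m = \<one>"
    using nat_pow_distrib[of x "inv x" m] assms inv_closed self_mult_inv by (simp add: nat_pow_one)
  ultimately show ?thesis
    using assms inv_closed by (simp add: m_assoc)
qed

lemma nat_pow_in_subring: "subring A R \<Longrightarrow> x \<in> A \<Longrightarrow> x [^] (n::nat) \<in> A"
  by (induction n) (auto simp: subringE(3,6))

lemma finsum_in_subring:
  assumes "subring A R" "\<And>i. i \<in> I \<Longrightarrow> f i \<in> A"
  shows "finsum R f I \<in> A"
proof (cases "finite I")
  case True
  then show ?thesis
    using assms(2)
  proof (induction I rule: finite_induct)
    case (insert i I)
    then have "f \<in> I \<rightarrow> carrier R" "f i \<in> carrier R"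
      using subringE(1)[OF assms(1)] by auto
    then show ?case
      using insert subringE(7)[OF assms(1)] by simp
  qed (simp add: subringE(2)[OF assms(1)])
qed (simp add: subringE(2)[OF assms(1)])

lemma subring_Union_chain:
  assumes "C \<noteq> {}" "\<And>A. A \<in> C \<Longrightarrow> subring A R" "\<And>A B. A \<in> C \<Longrightarrow> B \<in> C \<Longrightarrow> A \<subseteq> B \<or> B \<subseteq> A"
  shows "subring (\<Union>C) R"
proof -
  have dir: "\<exists>A\<in>C. x \<in> A \<and> y \<in> A" if "x \<in> \<Union>C" "y \<in> \<Union>C" for x y
    using that assms(3) by blast
  show ?thesis
  proof (rule subringI)
    show "\<Union>C \<subseteq> carrier R"
      using assms(2)[THEN subringE(1)] by auto
    show "\<one> \<in> \<Union>C"
      using assms(1) assms(2)[THEN subringE(3)] by auto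
    show "\<ominus> x \<in> \<Union>C" if "x \<in> \<Union>C" for x
      using that assms(2)[THEN subringE(5)] by auto
    show "x \<otimes> y \<in> \<Union>C" if "x \<in> \<Union>C" "y \<in> \<Union>C" for x y
      using dir[OF that] assms(2)[THEN subringE(6)] by auto
    show "x \<oplus> y \<in> \<Union>C" if "x \<in> \<Union>C" "y \<in> \<Union>C" for x y
      using dir[OF that] assms(2)[THEN subringE(7)] by auto
  qed
qed


subsection \<open>Valuation rings\<close>

text \<open>These are the rings of arbitrary Krull valuations of the field; \<open>carrier R\<close>
  itself is one, and neither rank nor discreteness is prescribed.\<close>

definition valuation_ring :: "'a set \<Rightarrow> bool" where
  "valuation_ring V \<longleftrightarrow> subring V R \<and> (\<forall>x\<in>carrier R - V. inv x \<in> V)"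

lemma valuation_ringD:
  assumes "valuation_ring V"
  shows "subring V R" "x \<in> carrier R \<Longrightarrow> x \<notin> V \<Longrightarrow> inv x \<in> V"
  using assms by (auto simp: valuation_ring_def)

text \<open>Values at \<open>z\<close> of polynomials of bounded degree. Working with values lets an
  element have several representations, so that the least possible \<open>n\<close> can be lowered
  by rewriting.\<close>

primrec polys_upto :: "'a set \<Rightarrow> 'a \<Rightarrow> nat \<Rightarrow> 'a set" where
  "polys_upto V z 0 = V"
| "polys_upto V z (Suc n) = {q \<oplus> c \<otimes> z [^] Suc n |q c. q \<in> polys_upto V z n \<and> c \<in> V}"

context
  fixes V z
  assumes V: "subring V R" and z: "z \<in> carrier R"
begin

lemma polys_upto_carrier: "polys_upto V z n \<subseteq> carrier R"
  by (induction n) (use subringE(1)[OF V] z in auto)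

lemma polys_upto_mono: "m \<le> n \<Longrightarrow> polys_upto V z m \<subseteq> polys_upto V z n"
proof (induction n)
  case (Suc n)
  have "polys_upto V z n \<subseteq> polys_upto V z (Suc n)"
  proof
    fix q assume q: "q \<in> polys_upto V z n"
    then have "q = q \<oplus> \<zero> \<otimes> z [^] Suc n"
      using polys_upto_carrier[of n] z by (auto simp del: nat_pow_Suc)
    then show "q \<in> polys_upto V z (Suc n)"
      using q subringE(2)[OF V] unfolding polys_upto.simps by blast
  qed
  then show ?case
    using Suc by (cases "m = Suc n") auto
qed simp

lemma polys_upto_add: "x \<in> polys_upto V z n \<Longrightarrow> y \<in> polys_upto V z n \<Longrightarrow> x \<oplus> y \<in> polys_upto V z n"
proof (induction n arbitrary: x y)
  case (Suc n)
  then obtain q c q' c' where x: "x = q \<oplus> c \<otimes> z [^] Suc n" "q \<in> polys_upto V z n" "c \<in> V"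
    and y: "y = q' \<oplus> c' \<otimes> z [^] Suc n" "q' \<in> polys_upto V z n" "c' \<in> V"
    by auto
  have "q \<in> carrier R" "q' \<in> carrier R" "c \<in> carrier R" "c' \<in> carrier R" "z [^] Suc n \<in> carrier R"
    using x y polys_upto_carrier[of n] subringE(1)[OF V] z by auto
  then have "x \<oplus> y = (q \<oplus> q') \<oplus> (c \<oplus> c') \<otimes> z [^] Suc n"
    unfolding x y by (simp add: l_distr a_ac del: nat_pow_Suc)
  moreover have "q \<oplus> q' \<in> polys_upto V z n" "c \<oplus> c' \<in> V"
    using Suc.IH x y subringE(7)[OF V] by auto
  ultimately show ?case
    unfolding polys_upto.simps by blast
qed (simp add: subringE(7)[OF V])

lemma polys_upto_smult: "x \<in> polys_upto V z n \<Longrightarrow> c \<in> V \<Longrightarrow> c \<otimes> x \<in> polys_upto V z n"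
proof (induction n arbitrary: x)
  case (Suc n)
  then obtain q d where x: "x = q \<oplus> d \<otimes> z [^] Suc n" "q \<in> polys_upto V z n" "d \<in> V"
    by auto
  have "q \<in> carrier R" "c \<in> carrier R" "d \<in> carrier R" "z [^] Suc n \<in> carrier R"
    using x Suc polys_upto_carrier[of n] subringE(1)[OF V] z by auto
  then have "c \<otimes> x = (c \<otimes> q) \<oplus> (c \<otimes> d) \<otimes> z [^] Suc n"
    unfolding x by (simp add: r_distr m_assoc del: nat_pow_Suc)
  moreover have "c \<otimes> q \<in> polys_upto V z n" "c \<otimes> d \<in> V"
    using Suc x subringE(6)[OF V] by auto
  ultimately show ?case
    unfolding polys_upto.simps by blast
qed (simp add: subringE(6)[OF V])

lemma monom_in_polys_upto:
  assumes "c \<in> V" "k \<le> n"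
  shows "c \<otimes> z [^] k \<in> polys_upto V z n"
proof -
  have c: "c \<in> carrier R"
    using assms subringE(1)[OF V] by auto
  have "c \<otimes> z [^] k \<in> polys_upto V z k"
  proof (cases k)
    case 0
    then show ?thesis using assms c by simp
  next
    case (Suc k')
    have "\<zero> \<in> polys_upto V z k'"
      using polys_upto_mono[of 0 k'] subringE(2)[OF V] by auto
    moreover have "c \<otimes> z [^] k = \<zero> \<oplus> c \<otimes> z [^] k"
      using c z by simp
    ultimately show ?thesis
      using assms(1) unfolding Suc polys_upto.simps by blast
  qed
  then show ?thesis
    using polys_upto_mono assms(2) by blast
qed

lemma polys_upto_shift: "x \<in> polys_upto V z n \<Longrightarrow> x \<otimes> z \<in> polys_upto V z (Suc n)"
proof (induction n arbitrary: x)
  case 0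
  then show ?case
    using monom_in_polys_upto[of x 1 1] subringE(1)[OF V] z by simp
next
  case (Suc n)
  then obtain q c where x: "x = q \<oplus> c \<otimes> z [^] Suc n" "q \<in> polys_upto V z n" "c \<in> V"
    by auto
  have "q \<in> carrier R" "c \<in> carrier R" "z [^] Suc n \<in> carrier R"
    using x polys_upto_carrier[of n] subringE(1)[OF V] z by auto
  then have "x \<otimes> z = q \<otimes> z \<oplus> c \<otimes> z [^] Suc (Suc n)"
    unfolding x using z by (simp add: l_distr m_assoc)
  then show ?case
    using Suc.IH[OF x(2)] x(3) unfolding polys_upto.simps(2)[of V z "Suc n"] by blast
qed

lemma simple_extension_polys_upto: "x \<in> simple_extension V z \<Longrightarrow> \<exists>n. x \<in> polys_upto V z n"
proof (induction rule: simple_extension.induct)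
  case zero
  then show ?case using subringE(2)[OF V] by (auto intro!: exI[of _ 0])
next
  case (lin x c)
  then obtain n where "x \<in> polys_upto V z n"
    by auto
  then have "x \<otimes> z \<in> polys_upto V z (Suc n)" "c \<in> polys_upto V z (Suc n)"
    using polys_upto_shift polys_upto_mono[of 0 "Suc n"] lin by auto
  then show ?case
    using polys_upto_add by blast
qed

text \<open>The recursion exposes the leading term; this exposes the constant one. The descent for
  valuation rings rewrites the leading term of one polynomial with the help of the constant term of
  another, so both ends are needed.\<close>

lemma polys_upto_bottom:
  "x \<in> polys_upto V z (Suc n) \<Longrightarrow> \<exists>d\<in>V. \<exists>q\<in>polys_upto V z n. x = d \<oplus> z \<otimes> q"
proof (induction n arbitrary: x)
  case 0
  then obtain q c where "x = q \<oplus> c \<otimes> z" "q \<in> V" "c \<in> V"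
    using z by auto
  moreover have "c \<in> carrier R"
    using calculation subringE(1)[OF V] by auto
  ultimately show ?case
    using z m_comm[of c z] by auto
next
  case (Suc n)
  then obtain x' c where x: "x = x' \<oplus> c \<otimes> z [^] Suc (Suc n)" "x' \<in> polys_upto V z (Suc n)" "c \<in> V"
    by auto
  then obtain d q where d: "d \<in> V" "q \<in> polys_upto V z n" "x' = d \<oplus> z \<otimes> q"
    using Suc.IH by blast
  have "d \<in> carrier R" "q \<in> carrier R" "c \<in> carrier R"
    using x d polys_upto_carrier[of n] subringE(1)[OF V] by auto
  moreover have "z [^] Suc (Suc n) = z \<otimes> z [^] Suc n"
    using z nat_pow_Suc2 by blast
  ultimately have "x = d \<oplus> z \<otimes> (q \<oplus> c \<otimes> z [^] Suc n)"
    unfolding x d using z by (simp add: r_distr a_assoc m_lcomm del: nat_pow_Suc)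
  moreover have "q \<oplus> c \<otimes> z [^] Suc n \<in> polys_upto V z (Suc n)"
    using d x by auto
  ultimately show ?case
    using d(1) by blast
qed

end

text \<open>Multiplying by \<open>z^n\<close> reverses the polynomial: \<open>z^-k\<close> becomes
  \<open>z^(n-k)\<close>, whose exponent is nonnegative because
  \<open>k \<le> m \<le> n\<close>.\<close>

lemma polys_upto_inv:
  assumes V: "subring V R" and z: "z \<in> carrier R" "z \<noteq> \<zero>"
  shows "m \<le> n \<Longrightarrow> x \<in> polys_upto V (inv z) m \<Longrightarrow> z [^] n \<otimes> x \<in> polys_upto V z n"
proof (induction m arbitrary: x)
  case 0
  then show ?case
    using monom_in_polys_upto[OF V z(1), of x n n] subringE(1)[OF V] z by (auto simp: m_comm)
next
  case (Suc m)
  then obtain q c where x: "x = q \<oplus> c \<otimes> inv z [^] Suc m" "q \<in> polys_upto V (inv z) m" "c \<in> V"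
    by auto
  have cl: "q \<in> carrier R" "c \<in> carrier R" "inv z \<in> carrier R"
    using x polys_upto_carrier[OF V inv_closed[OF z], of m] subringE(1)[OF V] inv_closed[OF z] by auto
  have "z [^] n \<otimes> x = z [^] n \<otimes> q \<oplus> c \<otimes> (z [^] n \<otimes> inv z [^] Suc m)"
    unfolding x using cl z by (simp add: r_distr m_lcomm del: nat_pow_Suc)
  also have "z [^] n \<otimes> inv z [^] Suc m = z [^] (n - Suc m)"
    using pow_mult_inv_pow[OF z Suc.prems(1)] .
  finally show ?case
    using polys_upto_add[OF V z(1)] Suc.IH[OF _ x(2)] Suc.prems(1)
      monom_in_polys_upto[OF V z(1) x(3), of "n - Suc m" n] by auto
qed

text \<open>Zorn's lemma yields a subring \<open>V\<close> maximal among those containing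
  \<open>A\<close> and missing \<open>b\<close>, and Chevalley's argument shows that it is a
  valuation ring. Maximality enters only as \<open>ext\<close>: whatever is adjoined to
  \<open>V\<close>, \<open>b\<close> becomes a polynomial in it. The element \<open>inv b\<close>,
  kept in the ring from the start, takes the role that the maximal ideal has in the usual
  proof.\<close>

lemma valuation_ring_avoiding:
  assumes A: "subring A R" and b: "b \<in> carrier R" "b \<noteq> \<zero>" "inv b \<in> A" "b \<notin> A"
  obtains V where "valuation_ring V" "A \<subseteq> V" "b \<notin> V"
proof -
  let ?S = "{B. subring B R \<and> A \<subseteq> B \<and> b \<notin> B}"
  have "\<exists>M\<in>?S. \<forall>B\<in>?S. M \<subseteq> B \<longrightarrow> B = M"
  proof (rule subset_Zorn_nonempty)
    show "?S \<noteq> {}" using A b by auto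
  next
    fix C assume "C \<noteq> {}" "subset.chain ?S C"
    then show "\<Union>C \<in> ?S"
      using subring_Union_chain[of C] by (auto simp: subset_chain_def) 
  qed
  then obtain V where "V \<in> ?S" and maximal: "\<forall>B\<in>?S. V \<subseteq> B \<longrightarrow> B = V"
    by (rule bexE)
  then have V: "subring V R" "A \<subseteq> V" "b \<notin> V"
    by auto
  have max: "B = V" if "subring B R" "V \<subseteq> B" "b \<notin> B" for B
    using that V(2) maximal[rule_format, of B] by auto
  have Vc: "V \<subseteq> carrier R"
    using subringE(1)[OF V(1)] .
  have ext: "b \<in> simple_extension V z" if z: "z \<in> carrier R" "z \<notin> V" for z
  proof (rule ccontr)
    assume "b \<notin> simple_extension V z"
    then have "simple_extension V z = V"
      using max[OF simple_extension_is_subring[OF V(1) z(1)] simple_extension_incl[OF Vc z(1)]] by simp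
    then show False
      using simple_extension_mem[OF V(1) z(1)] z by simp
  qed
  have invb: "inv b \<in> V" "inv b \<in> carrier R" "b \<otimes> inv b = \<one>"
    using V b self_mult_inv inv_closed by auto
  \<comment> \<open>\<open>inv b\<close> is in the Jacobson radical of \<open>V\<close>. If
    \<open>?u\<close> had no inverse in \<open>V\<close>, then \<open>b\<close> would be a
    polynomial in \<open>inv ?u\<close>, hence \<open>b u^n\<close> in \<open>V\<close> for some
    \<open>n\<close>; as \<open>b u = b - c\<close>, the exponent can be lowered to 0.\<close>
  have unit: "inv (\<one> \<ominus> inv b \<otimes> c) \<in> V" "\<one> \<ominus> inv b \<otimes> c \<noteq> \<zero>" if c: "c \<in> V" for c
  proof -
    let ?u = "\<one> \<ominus> inv b \<otimes> c"
    have cc: "c \<in> carrier R" using c Vc by auto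
    have u: "?u \<in> V" "?u \<in> carrier R"
      using subringE(3,5-7)[OF V(1)] c invb cc by (auto simp: a_minus_def)
    have bu: "b \<otimes> ?u = b \<ominus> c"
    proof -
      have "b \<otimes> ?u = b \<ominus> (b \<otimes> inv b) \<otimes> c"
        using b cc invb(2) by algebra
      then show ?thesis using invb cc by simp
    qed
    show nz: "?u \<noteq> \<zero>"
    proof
      assume "?u = \<zero>"
      then have "b \<ominus> c = \<zero>" using bu b by simp
      then have "b = c" using b cc by simp
      then show False using c V by simp
    qed
    show "inv ?u \<in> V"
    proof (rule ccontr)
      assume n: "inv ?u \<notin> V"
      have "x \<in> simple_extension V (inv ?u) \<Longrightarrow> \<exists>n::nat. x \<otimes> ?u [^] n \<in> V" for x
      proof (induction rule: simple_extension.induct)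
        case zero
        then show ?case using subringE(2)[OF V(1)] u by (auto intro!: exI[of _ 0])
      next
        case (lin x d)
        then obtain n where n: "x \<otimes> ?u [^] (n::nat) \<in> V" by blast
        have xc: "x \<in> carrier R" "d \<in> carrier R"
          using simple_extension_in_carrier[OF Vc inv_closed[OF u(2) nz]] lin Vc by auto
        have "(x \<otimes> inv ?u \<oplus> d) \<otimes> ?u [^] Suc n = x \<otimes> (inv ?u \<otimes> ?u) \<otimes> ?u [^] n \<oplus> d \<otimes> ?u [^] Suc n"
          using xc u(2) inv_closed[OF u(2) nz] nat_pow_closed[OF u(2), of n]
          unfolding nat_pow_Suc by algebra
        then have "(x \<otimes> inv ?u \<oplus> d) \<otimes> ?u [^] Suc n = x \<otimes> ?u [^] n \<oplus> d \<otimes> ?u [^] Suc n"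
          using inv_mult_self[OF u(2) nz] xc by simp
        then show ?case
          using n lin(2) subringE(6,7)[OF V(1)] nat_pow_in_subring[OF V(1) u(1)] by metis
      qed
      then obtain n where n: "b \<otimes> ?u [^] (n::nat) \<in> V"
        using ext[OF inv_closed[OF u(2) nz] n] by blast
      then have "b \<in> V"
      proof (induction n)
        case 0
        then show ?case using b by simp
      next
        case (Suc n)
        have "b \<otimes> ?u [^] Suc n = ?u [^] n \<otimes> (b \<otimes> ?u)"
          using b u by (simp add: m_ac)
        also have "\<dots> = b \<otimes> ?u [^] n \<ominus> c \<otimes> ?u [^] n"
          unfolding bu using b cc nat_pow_closed[OF u(2), of n] by algebra
        finally have "b \<otimes> ?u [^] n = b \<otimes> ?u [^] Suc n \<oplus> c \<otimes> ?u [^] n"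
          using b cc nat_pow_closed[OF u(2), of n] by algebra
        then have "b \<otimes> ?u [^] n \<in> V"
          using Suc.prems c subringE(6,7)[OF V(1)] nat_pow_in_subring[OF V(1) u(1)] by metis
        then show ?case by (rule Suc.IH)
      qed
      then show False using V by simp
    qed
  qed
  \<comment> \<open>The representation in \<open>inv z\<close> has constant term \<open>d\<close>,
    and \<open>1 - d/b\<close> is a unit, so \<open>1\<close> equals a multiple of
    \<open>inv z \<otimes> Q\<close>. Multiplying the leading term \<open>c z^(n+1)\<close> by this
    expression of \<open>1\<close> brings its degree down to \<open>n\<close>.\<close>
  have step: "b \<in> polys_upto V z n"
    if z: "z \<in> carrier R" "z \<noteq> \<zero>" and mn: "m \<le> n"
      and bz: "b \<in> polys_upto V z (Suc n)" and bz': "b \<in> polys_upto V (inv z) (Suc m)" for z m n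
  proof -
    obtain d Q where d: "d \<in> V" "Q \<in> polys_upto V (inv z) m" "b = d \<oplus> inv z \<otimes> Q"
      using polys_upto_bottom[OF V(1) inv_closed[OF z] bz'] by blast
    obtain q c where q: "q \<in> polys_upto V z n" "c \<in> V" "b = q \<oplus> c \<otimes> z [^] Suc n"
      using bz by auto
    let ?u = "\<one> \<ominus> inv b \<otimes> d"
    have cl: "d \<in> carrier R" "Q \<in> carrier R" "q \<in> carrier R" "c \<in> carrier R" "inv z \<in> carrier R"
      using d(1,2) q(1,2) Vc polys_upto_carrier[OF V(1) z(1), of n]
        polys_upto_carrier[OF V(1) inv_closed[OF z], of m] inv_closed[OF z] by auto
    have u: "?u \<in> carrier R" "?u \<noteq> \<zero>" "inv ?u \<in> carrier R" "inv ?u \<in> V"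
      using unit[OF d(1)] Vc cl invb by auto
    have "?u = inv b \<otimes> (b \<ominus> d)"
      using inv_mult_self[OF b(1,2)] b cl invb(2) by (simp add: a_minus_def r_distr r_minus)
    also have "b \<ominus> d = inv z \<otimes> Q"
    proof -
      have "inv z \<otimes> Q \<in> carrier R" using cl by simp
      then show ?thesis using d(3) cl(1) by algebra
    qed
    finally have "\<one> = inv ?u \<otimes> (inv b \<otimes> (inv z \<otimes> Q))"
      using inv_mult_self[OF u(1,2)] by simp
    then have "c \<otimes> z [^] Suc n = c \<otimes> z [^] Suc n \<otimes> (inv ?u \<otimes> (inv b \<otimes> (inv z \<otimes> Q)))"
      using cl(4) z by simp
    also have "\<dots> = (c \<otimes> (inv ?u \<otimes> inv b)) \<otimes> (z [^] n \<otimes> ((z \<otimes> inv z) \<otimes> Q))"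
      using cl u(3) z invb(2) by (simp add: m_ac)
    also have "\<dots> = (c \<otimes> (inv ?u \<otimes> inv b)) \<otimes> (z [^] n \<otimes> Q)"
      using self_mult_inv[OF z] cl by simp
    finally have "b = q \<oplus> (c \<otimes> (inv ?u \<otimes> inv b)) \<otimes> (z [^] n \<otimes> Q)"
      using q(3) by simp
    then show ?thesis
      using polys_upto_add[OF V(1) z(1) q(1)]
        polys_upto_smult[OF V(1) z(1) polys_upto_inv[OF V(1) z mn d(2)]]
        subringE(6)[OF V(1)] q(2) u(4) invb(1) by metis
  qed
  have "inv z \<in> V" if z: "z \<in> carrier R" "z \<notin> V" for z
  proof (rule ccontr)
    assume nz: "inv z \<notin> V"
    have z0: "z \<noteq> \<zero>" using z subringE(2)[OF V(1)] by auto
    let ?P = "\<lambda>z n. b \<in> polys_upto V z n"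
    have ex: "\<exists>n. ?P z n" "\<exists>n. ?P (inv z) n"
      using simple_extension_polys_upto[OF V(1)] ext z nz inv_closed[OF z(1) z0] by auto
    \<comment> \<open>Both minimal degrees are positive because \<open>b\<close> is not in
      \<open>V\<close>. The one that is not the smaller contradicts \<open>step\<close>, which can
      be applied to \<open>z\<close> or to \<open>inv z\<close>.\<close>
    define n m where "n = (LEAST n. ?P z n)" and "m = (LEAST n. ?P (inv z) n)"
    have P: "?P z n" "?P (inv z) m"
      unfolding n_def m_def using ex LeastI_ex by metis+
    have min: "\<not> ?P z k" if "k < n" for k
      using that not_less_Least unfolding n_def by metis
    have min': "\<not> ?P (inv z) k" if "k < m" for k
      using that not_less_Least unfolding m_def by metis
    obtain n' m' where n': "n = Suc n'" and m': "m = Suc m'"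
      using P V(3) by (metis not0_implies_Suc polys_upto.simps(1))
    show False
    proof (cases "m' \<le> n'")
      case True
      then show False
        using step[OF z(1) z0 True] P min[of n'] n' m' by simp
    next
      case False
      then show False
        using step[OF inv_closed[OF z(1) z0] inv_nonzero[OF z(1) z0], of n' m'] P min'[of m'] n' m'
          inv_inv_field[OF z(1) z0] by simp
    qed
  qed
  then have "valuation_ring V"
    using V(1) by (auto simp: valuation_ring_def)
  then show thesis
    using that V by blast
qed


text \<open>By \<open>valuation_ring_avoiding\<close>, this is the integral closure of the ring generated by \<open>Y\<close>.\<close>

definition val_closure :: "'a set \<Rightarrow> 'a set" where
  "val_closure Y = {x \<in> carrier R. \<forall>V. valuation_ring V \<longrightarrow> Y \<subseteq> V \<longrightarrow> x \<in> V}"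

lemma val_closureI:
  assumes "x \<in> carrier R" "\<And>V. valuation_ring V \<Longrightarrow> Y \<subseteq> V \<Longrightarrow> x \<in> V"
  shows "x \<in> val_closure Y"
  using assms by (auto simp: val_closure_def)

lemma val_closureD:
  assumes "x \<in> val_closure Y" "valuation_ring V" "Y \<subseteq> V"
  shows "x \<in> V"
  using assms by (auto simp: val_closure_def)

lemma val_closure_carrier: "val_closure Y \<subseteq> carrier R"
  by (auto simp: val_closure_def)

lemma val_closure_incl: "Y \<subseteq> carrier R \<Longrightarrow> Y \<subseteq> val_closure Y"
  by (auto simp: val_closure_def)

lemma val_closure_mono: "Y \<subseteq> Z \<Longrightarrow> val_closure Y \<subseteq> val_closure Z"
  by (auto simp: val_closure_def)

lemma val_closure_subring: "subring (val_closure Y) R"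
proof (rule subringI)
  show "\<one> \<in> val_closure Y"
    by (auto simp: val_closure_def dest!: valuation_ringD(1)[THEN subringE(3)])
  fix x assume x: "x \<in> val_closure Y"
  then show "\<ominus> x \<in> val_closure Y"
    by (auto simp: val_closure_def dest: valuation_ringD(1)[THEN subringE(5)])
  fix y assume "y \<in> val_closure Y"
  with x show "x \<otimes> y \<in> val_closure Y" "x \<oplus> y \<in> val_closure Y"
    by (auto simp: val_closure_def dest: valuation_ringD(1)[THEN subringE(6)]
        valuation_ringD(1)[THEN subringE(7)])
qed (rule val_closure_carrier)

lemma val_closure_idem: "Z \<subseteq> val_closure Y \<Longrightarrow> val_closure Z \<subseteq> val_closure Y"
  by (auto simp: val_closure_def subset_iff)

text \<open>Valuation rings are integrally closed: a root \<open>x\<close> outside \<open>V\<close>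
  would satisfy \<open>x = x^(n+1) x^-n\<close> with both factors in \<open>V\<close>.\<close>

lemma val_closure_root:
  assumes "x \<in> carrier R" "x [^] Suc n \<in> val_closure Y"
  shows "x \<in> val_closure Y"
proof (rule val_closureI[OF assms(1)])
  fix V assume V: "valuation_ring V" "Y \<subseteq> V"
  have xn: "x [^] Suc n \<in> V"
    using val_closureD[OF assms(2) V] .
  show "x \<in> V"
  proof (rule ccontr)
    assume nx: "x \<notin> V"
    then have "x \<noteq> \<zero>"
      using subringE(2)[OF valuation_ringD(1)[OF V(1)]] by auto
    then have "x [^] Suc n \<otimes> inv x [^] n = x"
      using pow_mult_inv_pow[OF assms(1), of n "Suc n"] assms(1) by simp
    moreover have "inv x [^] n \<in> V"
      using nat_pow_in_subring valuation_ringD[OF V(1)] assms(1) nx by blast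
    ultimately show False
      using nx xn subringE(6)[OF valuation_ringD(1)[OF V(1)]] by metis
  qed
qed

text \<open>The right-hand side is integrality in disguise: an expression of \<open>x\<close> as a
  polynomial in \<open>inv x\<close>, multiplied by a power of \<open>x\<close>, is a monic
  equation. This form is finitary, which the results below exploit. The forward direction is
  \<open>valuation_ring_avoiding\<close> with \<open>b = x\<close>.\<close>

lemma val_closure_iff:
  assumes "Y \<subseteq> carrier R" "x \<in> carrier R" "x \<noteq> \<zero>"
  shows "x \<in> val_closure Y \<longleftrightarrow> x \<in> generate_ring R (insert (inv x) Y)"
proof
  let ?A = "generate_ring R (insert (inv x) Y)"
  have sub: "insert (inv x) Y \<subseteq> carrier R"
    using assms inv_closed by auto
  have A: "subring ?A R" "Y \<subseteq> ?A" "inv x \<in> ?A"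
    using generate_ring_is_subring[OF sub] by (auto intro: generate_ring.incl)
  show "x \<in> ?A" if x: "x \<in> val_closure Y"
  proof (rule ccontr)
    assume "x \<notin> ?A"
    then obtain V where "valuation_ring V" "?A \<subseteq> V" "x \<notin> V"
      using valuation_ring_avoiding[OF A(1) assms(2,3) A(3)] by blast
    then show False
      using val_closureD[OF x] A(2) by blast
  qed
  show "x \<in> val_closure Y" if x: "x \<in> ?A"
  proof (rule val_closureI[OF assms(2)])
    fix V assume V: "valuation_ring V" "Y \<subseteq> V"
    show "x \<in> V"
    proof (rule ccontr)
      assume nx: "x \<notin> V"
      then have "?A \<subseteq> V"
        using generate_ring_min_subring1[OF sub valuation_ringD(1)[OF V(1)]]
          valuation_ringD(2)[OF V(1) assms(2) nx] V(2) by simp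
      then show False
        using x nx by auto
    qed
  qed
qed

lemma generate_ring_finite:
  "x \<in> generate_ring R Y \<Longrightarrow> \<exists>Z\<subseteq>Y. finite Z \<and> x \<in> generate_ring R Z"
proof (induction rule: generate_ring.induct)
  case one
  then show ?case using generate_ring.one[of R "{}"] by (intro exI[of _ "{}"]) auto
next
  case (incl h)
  then show ?case using generate_ring.incl[of h "{h}"] by (intro exI[of _ "{h}"]) auto
next
  case (a_inv h)
  then show ?case by (auto intro: generate_ring.a_inv)
next
  case (eng_add h1 h2)
  then obtain Z1 Z2 where Z: "Z1 \<subseteq> Y" "finite Z1" "h1 \<in> generate_ring R Z1"
    "Z2 \<subseteq> Y" "finite Z2" "h2 \<in> generate_ring R Z2"
    by auto
  have mono: "h \<in> generate_ring R (Z1 \<union> Z2)" if "h \<in> generate_ring R Z" "Z \<subseteq> Z1 \<union> Z2" for h Z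
    using that by (induction rule: generate_ring.induct) (auto intro: generate_ring.intros)
  show ?case
    using Z(1,2,4,5) generate_ring.eng_add[OF mono[OF Z(3)] mono[OF Z(6)]]
    by (intro exI[of _ "Z1 \<union> Z2"]) auto
next
  case (eng_mult h1 h2)
  then obtain Z1 Z2 where Z: "Z1 \<subseteq> Y" "finite Z1" "h1 \<in> generate_ring R Z1"
    "Z2 \<subseteq> Y" "finite Z2" "h2 \<in> generate_ring R Z2"
    by auto
  have mono: "h \<in> generate_ring R (Z1 \<union> Z2)" if "h \<in> generate_ring R Z" "Z \<subseteq> Z1 \<union> Z2" for h Z
    using that by (induction rule: generate_ring.induct) (auto intro: generate_ring.intros)
  show ?case
    using Z(1,2,4,5) generate_ring.eng_mult[OF mono[OF Z(3)] mono[OF Z(6)]]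
    by (intro exI[of _ "Z1 \<union> Z2"]) auto
qed

text \<open>An expression in a generated ring involves finitely many generators. This carries the
  transfinite chain over limit stages: the closure of the union of a chain of sets is the union of
  their closures.\<close>

lemma val_closure_finite:
  assumes "Y \<subseteq> carrier R" "x \<in> val_closure Y"
  obtains Z where "finite Z" "Z \<subseteq> Y" "x \<in> val_closure Z"
proof (cases "x = \<zero>")
  case True
  then show ?thesis
    using that[of "{}"] subringE(2)[OF val_closure_subring] by simp
next
  case False
  have x: "x \<in> carrier R"
    using assms val_closure_carrier by auto
  obtain Z where Z: "Z \<subseteq> insert (inv x) Y" "finite Z" "x \<in> generate_ring R Z"
    using generate_ring_finite val_closure_iff[OF assms(1) x False] assms(2) by blast
  let ?Z = "Z \<inter> Y"
  have "insert (inv x) ?Z \<subseteq> carrier R" "Z \<subseteq> insert (inv x) ?Z"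
    using Z assms(1) inv_closed[OF x False] by auto
  then have "x \<in> generate_ring R (insert (inv x) ?Z)"
    using mono_generate_ring Z(3) by blast
  then have "x \<in> val_closure ?Z"
    using val_closure_iff[of ?Z x] x False assms(1) by auto
  then show ?thesis
    using that[of ?Z] Z(2) by simp
qed

text \<open>Each of the finitely many occurrences of \<open>z\<close> in an expression of
  \<open>x\<close> is cancelled by a factor \<open>inv z\<close>, which bounds the poles of
  \<open>x\<close> uniformly over all valuation rings in question. The generator
  \<open>inv x\<close> does no harm: where it is not in \<open>V\<close>, \<open>x\<close> itself
  is.\<close>

lemma val_closure_pole_bounded:
  assumes Y: "Y \<subseteq> carrier R" and z: "z \<in> carrier R" "z \<noteq> \<zero>"
    and x: "x \<in> val_closure (insert z Y)"
  shows "\<exists>n::nat. x \<otimes> inv z [^] n \<in> val_closure (insert (inv z) Y)"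
proof (cases "x = \<zero>")
  case True
  then show ?thesis
    using subringE(2)[OF val_closure_subring] inv_closed[OF z] by simp
next
  case False
  let ?t = "inv z"
  have t: "?t \<in> carrier R"
    using inv_closed[OF z] .
  have xc: "x \<in> carrier R"
    using x val_closure_carrier by auto
  let ?D = "generate_ring R (insert (inv x) (insert ?t Y))"
  have sub: "insert (inv x) (insert ?t Y) \<subseteq> carrier R"
    using Y t inv_closed[OF xc False] by auto
  have D: "subring ?D R" "insert (inv x) (insert ?t Y) \<subseteq> ?D"
    using generate_ring_is_subring[OF sub] by (auto intro: generate_ring.incl)
  have tD: "?t [^] n \<in> ?D" for n :: nat
    using nat_pow_in_subring[OF D(1)] D(2) by auto
  have bounded: "y \<in> carrier R \<and> (\<exists>n::nat. y \<otimes> ?t [^] n \<in> ?D)"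
    if "y \<in> generate_ring R (insert (inv x) (insert z Y))" for y
    using that
  proof (induction rule: generate_ring.induct)
    case one
    then show ?case
      using tD[of 0] by (auto intro!: exI[of _ 0])
  next
    case (incl h)
    then consider "h = z" | "h \<in> insert (inv x) (insert ?t Y)"
      by auto
    then show ?case
    proof cases
      case 1
      then have "h \<otimes> ?t [^] (1::nat) = \<one>"
        using t self_mult_inv[OF z] by simp
      then show ?thesis
        using 1 z subringE(3)[OF D(1)] by metis
    next
      case 2
      then have "h \<in> ?D" "h \<in> carrier R"
        using D(2) sub by auto
      then show ?thesis
        by (auto intro!: exI[of _ 0])
    qed
  next
    case (a_inv h)
    then show ?case
      using t subringE(5)[OF D(1)] by (metis a_inv_closed l_minus nat_pow_closed)
  next
    case (eng_add h1 h2)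
    then obtain n1 n2 :: nat where n: "h1 \<otimes> ?t [^] n1 \<in> ?D" "h2 \<otimes> ?t [^] n2 \<in> ?D"
      by blast
    have h: "h1 \<in> carrier R" "h2 \<in> carrier R"
      using eng_add by auto
    have "(h1 \<oplus> h2) \<otimes> ?t [^] (n1 + n2) = (h1 \<otimes> ?t [^] n1) \<otimes> ?t [^] n2 \<oplus> (h2 \<otimes> ?t [^] n2) \<otimes> ?t [^] n1"
      using h t by (simp add: nat_pow_mult[symmetric] l_distr m_ac)
    then show ?case
      using n tD subringE(6,7)[OF D(1)] h by (metis a_closed)
  next
    case (eng_mult h1 h2)
    then obtain n1 n2 :: nat where n: "h1 \<otimes> ?t [^] n1 \<in> ?D" "h2 \<otimes> ?t [^] n2 \<in> ?D"
      by blast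
    have h: "h1 \<in> carrier R" "h2 \<in> carrier R"
      using eng_mult by auto
    have "(h1 \<otimes> h2) \<otimes> ?t [^] (n1 + n2) = (h1 \<otimes> ?t [^] n1) \<otimes> (h2 \<otimes> ?t [^] n2)"
      using h t by (simp add: nat_pow_mult[symmetric] m_ac)
    then show ?case
      using n subringE(6)[OF D(1)] h by (metis m_closed)
  qed
  have "x \<in> generate_ring R (insert (inv x) (insert z Y))"
    using val_closure_iff[of "insert z Y" x] x Y z xc False by auto
  then obtain n :: nat where n: "x \<otimes> ?t [^] n \<in> ?D"
    using bounded by blast
  have "x \<otimes> ?t [^] n \<in> val_closure (insert ?t Y)"
  proof (rule val_closureI)
    show "x \<otimes> ?t [^] n \<in> carrier R"
      using xc t by simp
    fix V assume V: "valuation_ring V" "insert ?t Y \<subseteq> V"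
    have Vr: "subring V R"
      using valuation_ringD(1)[OF V(1)] .
    show "x \<otimes> ?t [^] n \<in> V"
    proof (cases "x \<in> V")
      case True
      then show ?thesis
        using nat_pow_in_subring[OF Vr, of ?t n] V(2) subringE(6)[OF Vr] by auto
    next
      case False
      then have "?D \<subseteq> V"
        using generate_ring_min_subring1[OF sub Vr] V(2) valuation_ringD(2)[OF V(1) xc] by auto
      then show ?thesis
        using n by auto
    qed
  qed
  then show ?thesis by blast
qed

text \<open>For \<open>x\<close> integral over \<open>K\<close> and \<open>w = inv x\<close> one has
  \<open>x = q(w)\<close> with \<open>q\<close> over \<open>K\<close>, so \<open>w\<close> is a root
  of \<open>X q(X) - 1\<close> and hence algebraic.\<close>

lemma val_closure_subfield:
  assumes K: "subfield K R" and rac: "\<And>x. x \<in> carrier R \<Longrightarrow> algebraic K x \<Longrightarrow> x \<in> K"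
  shows "val_closure K = K"
proof
  show "K \<subseteq> val_closure K"
    using val_closure_incl subfieldE(3)[OF K] .
  show "val_closure K \<subseteq> K"
  proof
    fix x assume x: "x \<in> val_closure K"
    show "x \<in> K"
    proof (cases "x = \<zero>")
      case True
      then show ?thesis using subringE(2)[OF subfieldE(1)[OF K]] by simp
    next
      case False
      have xc: "x \<in> carrier R"
        using x val_closure_carrier by auto
      let ?w = "inv x"
      have w: "?w \<in> carrier R" "?w \<noteq> \<zero>"
        using inv_closed inv_nonzero xc False by auto
      have Kr: "subring K R" and Kc: "K \<subseteq> carrier R"
        using subfieldE(1,3)[OF K] .
      have "insert ?w K \<subseteq> simple_extension K ?w" "insert ?w K \<subseteq> carrier R"
        using simple_extension_mem[OF Kr w(1)] simple_extension_incl[OF Kc w(1)] w Kc by auto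
      then have "x \<in> simple_extension K ?w"
        using generate_ring_min_subring1 simple_extension_is_subring[OF Kr w(1)]
          val_closure_iff[OF Kc xc False] x by blast
      then obtain q where q: "q \<in> carrier (K[X])" "x = eval q ?w"
        using simple_extension_as_eval_img[OF Kc w(1)] by blast
      have qK: "set q \<subseteq> K" "set q \<subseteq> carrier R"
        using q Kc polynomial_incl univ_poly_carrier by blast+
      have "q \<noteq> []"
        using q False by auto
      \<comment> \<open>Coefficient lists start with the leading coefficient, so appending
        \<open>\<ominus> \<one>\<close> multiplies by \<open>X\<close> and subtracts 1; since
        \<open>q\<close> is nonempty, its leading coefficient is kept.\<close>
      then have "polynomial K (q @ [\<ominus> \<one>])"
        using q qK subringE(3,5)[OF Kr] unfolding univ_poly_carrier[symmetric] polynomial_def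
        by (auto simp: hd_append)
      moreover have "eval (q @ [\<ominus> \<one>]) ?w = \<zero>"
        using eval_append_aux[OF qK(2) _ w(1), of "\<ominus> \<one>"] q(2) self_mult_inv[OF xc False] by (simp add: r_neg)
      ultimately have "algebraic K ?w"
        using algebraicI[of "q @ [\<ominus> \<one>]" K ?w] unfolding univ_poly_carrier over_def by auto
      then have "?w \<in> K"
        using rac w(1) by blast
      then show ?thesis
        using subfield_m_inv(1)[OF K, of ?w] w inv_inv_field[OF xc False] by simp
    qed
  qed
qed

end


subsection \<open>Relations over rational functions\<close>

context field
begin

lemma eval_as_finsum:
  assumes "set q \<subseteq> carrier R" "x \<in> carrier R"
  shows "eval q x = (\<Oplus>j\<in>{..<length q}. q ! (length q - Suc j) \<otimes> x [^] j)"
  using assms(1)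
proof (induction q)
  case (Cons a q)
  let ?f = "\<lambda>j. (a # q) ! (length (a # q) - Suc j) \<otimes> x [^] j"
  have nth: "q ! j \<in> carrier R" if "j < length q" for j
    using that Cons.prems nth_mem by auto
  have f: "?f j = q ! (length q - Suc j) \<otimes> x [^] j" if "j \<in> {..<length q}" for j
    using that by (auto simp: nth_Cons')
  have g: "(\<lambda>j. q ! (length q - Suc j) \<otimes> x [^] j) \<in> {..<length q} \<rightarrow> carrier R"
    using nth assms(2) by auto
  have "finsum R ?f {..<length q} = eval q x"
    using Cons finsum_cong'[OF refl g f] by simp
  moreover have "finsum R ?f {..<Suc (length q)} = ?f (length q) \<oplus> finsum R ?f {..<length q}"
    unfolding lessThan_Suc
    by (rule finsum_insert) (use g f Cons.prems assms(2) in \<open>auto simp: Pi_iff\<close>)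
  ultimately show ?case
    by simp
qed simp

lemma transcendental_finsum_eq_zero:
  fixes n :: nat
  assumes K: "subring K R" and x: "x \<in> carrier R" "transcendental K x"
    and c: "\<And>j. j < n \<Longrightarrow> c j \<in> K" and sum: "(\<Oplus>j\<in>{..<n}. c j \<otimes> x [^] j) = \<zero>"
  shows "j < n \<Longrightarrow> c j = \<zero>"
proof -
  assume j: "j < n"
  let ?q = "map (\<lambda>i. c (n - Suc i)) [0..<n]"
  have qK: "set ?q \<subseteq> K"
    using c by auto
  have nth: "?q ! (n - Suc i) = c i" if "i < n" for i
    using that by simp
  have qc: "set ?q \<subseteq> carrier R"
    using qK subringE(1)[OF K] by blast
  have "(\<Oplus>i\<in>{..<length ?q}. ?q ! (length ?q - Suc i) \<otimes> x [^] i) = (\<Oplus>i\<in>{..<n}. c i \<otimes> x [^] i)"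
    by (rule finsum_cong') (use nth c subringE(1)[OF K] x in auto)
  then have "eval ?q x = \<zero>"
    using eval_as_finsum[OF qc x(1)] sum by simp
  then have "eval (normalize ?q) x = \<zero>"
    using eval_normalize[OF qc x(1)] by simp
  moreover have "normalize ?q \<in> carrier (K[X])"
    using normalize_gives_polynomial[OF qK] unfolding univ_poly_carrier .
  ultimately have nil: "normalize ?q = []"
    using eval_transcendental x(2) unfolding over_def by blast
  have "normalize q = [] \<Longrightarrow> set q \<subseteq> {\<zero>}" for q :: "'a list"
    by (induction q) (auto split: if_splits)
  then have "set ?q \<subseteq> {\<zero>}"
    using nil by blast
  moreover have "c j \<in> set ?q"
    using nth[OF j] nth_mem[of "n - Suc j" ?q] j by simp
  ultimately show "c j = \<zero>"
    by auto
qed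

lemma nonzero_list_relation:
  assumes E: "subring E R" and q: "set q \<subseteq> E" "\<not> set q \<subseteq> {\<zero>}" and x: "x \<in> carrier R" "eval q x = \<zero>"
  shows "\<exists>e. (\<forall>j<length q. e j \<in> E) \<and> (\<exists>j<length q. e j \<noteq> \<zero>) \<and>
    (\<Oplus>j\<in>{..<length q}. e j \<otimes> x [^] j) = \<zero>"
proof (rule exI[of _ "\<lambda>j. q ! (length q - Suc j)"], intro conjI)
  let ?e = "\<lambda>j. q ! (length q - Suc j)"
  show "\<forall>j<length q. ?e j \<in> E"
    using q(1) nth_mem by auto
  obtain i where i: "i < length q" "q ! i \<noteq> \<zero>"
    using q(2) by (metis in_set_conv_nth singletonI subsetI)
  then have "length q - Suc i < length q" "?e (length q - Suc i) \<noteq> \<zero>"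
    by (auto simp: Suc_diff_Suc)
  then show "\<exists>j<length q. ?e j \<noteq> \<zero>"
    by blast
  show "(\<Oplus>j\<in>{..<length q}. ?e j \<otimes> x [^] j) = \<zero>"
    using eval_as_finsum[of q x] q(1) x subringE(1)[OF E] by auto
qed

lemma algebraic_relation:
  assumes E: "subring E R" and x: "x \<in> carrier R" "algebraic E x"
  shows "\<exists>(n::nat) e. (\<forall>j<n. e j \<in> E) \<and> (\<exists>j<n. e j \<noteq> \<zero>) \<and> (\<Oplus>j\<in>{..<n}. e j \<otimes> x [^] j) = \<zero>"
proof -
  obtain q where q: "q \<in> carrier (E[X])" "q \<noteq> []" "eval q x = \<zero>"
    using algebraicE[OF E x(1)] x(2) unfolding over_def by blast
  then have "set q \<subseteq> E" "lead_coeff q \<noteq> \<zero>"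
    unfolding univ_poly_carrier[symmetric] polynomial_def by auto
  then have "set q \<subseteq> E" "\<not> set q \<subseteq> {\<zero>}"
    using q(2) hd_in_set by blast+
  then show ?thesis
    using nonzero_list_relation[OF E _ _ x(1) q(3)] by blast
qed

text \<open>In dimension \<open>d\<close>, any \<open>d + 1\<close> powers are dependent. What
  counts is that \<open>n\<close> does not depend on \<open>x\<close>: one exponent then serves for
  all steps of the chain that belong to the same \<open>z\<close>.\<close>

lemma bounded_relation:
  assumes E: "subfield E R" and dim: "finite_dimension E (carrier R)"
  obtains n :: nat where "\<And>x. x \<in> carrier R \<Longrightarrow>
    \<exists>e. (\<forall>j<n. e j \<in> E) \<and> (\<exists>j<n. e j \<noteq> \<zero>) \<and> (\<Oplus>j\<in>{..<n}. e j \<otimes> x [^] j) = \<zero>"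
proof -
  obtain n where n: "dimension n E (carrier R)"
    using dim by auto
  have "\<exists>e. (\<forall>j<Suc n. e j \<in> E) \<and> (\<exists>j<Suc n. e j \<noteq> \<zero>) \<and> (\<Oplus>j\<in>{..<Suc n}. e j \<otimes> x [^] j) = \<zero>"
    if x: "x \<in> carrier R" for x
  proof -
    let ?Us = "exp_base x (Suc n)"
    have Us: "set ?Us \<subseteq> carrier R" "length ?Us = Suc n"
      using x by (auto simp: exp_base_def)
    have "dependent E ?Us"
      using independent_length_le_dimension[OF E n, of ?Us] Us by auto
    then obtain Ks where Ks: "length Ks = Suc n" "combine Ks ?Us = \<zero>" "set Ks \<subseteq> E" "set Ks \<noteq> {\<zero>}"
      using dependent_imp_non_trivial_combine[OF E Us(1)] Us(2) by metis
    have "set Ks \<subseteq> carrier R"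
      using Ks(3) subfieldE(3)[OF E] by auto
    then have "eval Ks x = \<zero>"
      using combine_eq_eval[of Ks x] Ks(1,2) by simp
    moreover have "\<not> set Ks \<subseteq> {\<zero>}"
      using Ks(1,4) by (metis length_0_conv nat.distinct(1) set_empty subset_singletonD)
    ultimately show ?thesis
      using nonzero_list_relation[OF subfieldE(1)[OF E] Ks(3) _ x] Ks(1) by metis
  qed
  then show thesis
    using that by blast
qed

section \<open>Clearing denominators and powers of \<open>t\<close>\<close>

lemma polys_upto_simple_extension:
  assumes "subring K R" "t \<in> carrier R"
  shows "polys_upto K t d \<subseteq> simple_extension K t"
proof (induction d)
  case 0
  then show ?case
    using simple_extension_incl[OF subringE(1)] assms by simp
next
  case (Suc d)
  have S: "subring (simple_extension K t) R" "K \<subseteq> simple_extension K t" "t \<in> simple_extension K t"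
    using simple_extension_is_subring simple_extension_incl[OF subringE(1)] simple_extension_mem assms
    by auto
  have "t [^] Suc d \<in> simple_extension K t"
    by (rule nat_pow_in_subring) (use S in auto)
  then show ?case
    using Suc S(2) subringE(6,7)[OF S(1)] unfolding polys_upto.simps by fast
qed

text \<open>A relation over \<open>K[t]\<close> that stays nontrivial modulo \<open>t\<close>.
  Nonzero \<open>c j\<close> are units in every valuation ring containing \<open>K\<close>, so they
  govern the relation where \<open>t\<close> is small.\<close>

definition primitive_dependency :: "'a set \<Rightarrow> 'a \<Rightarrow> nat \<Rightarrow> 'a \<Rightarrow> bool" where
  "primitive_dependency K t n b \<longleftrightarrow>
    (\<exists>c h. (\<forall>j<n. c j \<in> K \<and> h j \<in> simple_extension K t) \<and> (\<exists>j<n. c j \<noteq> \<zero>) \<and>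
      (\<Oplus>j\<in>{..<n}. (c j \<oplus> t \<otimes> h j) \<otimes> b [^] j) = \<zero>)"

text \<open>A relation with coefficients in \<open>K[t]\<close> can be divided by \<open>t\<close> until not all of its
  constant coefficients vanish.\<close>

lemma primitive_relation:
  fixes n :: nat
  assumes K: "subring K R" and t: "t \<in> carrier R" "t \<noteq> \<zero>" and b: "b \<in> carrier R"
  shows "\<lbrakk>\<And>j. j < n \<Longrightarrow> f j \<in> polys_upto K t d; \<exists>j<n. f j \<noteq> \<zero>; (\<Oplus>j\<in>{..<n}. f j \<otimes> b [^] j) = \<zero>\<rbrakk> \<Longrightarrow>
    primitive_dependency K t n b"
  unfolding primitive_dependency_def
proof (induction d arbitrary: f)
  case 0
  have "(\<Oplus>j\<in>{..<n}. (f j \<oplus> t \<otimes> \<zero>) \<otimes> b [^] j) = (\<Oplus>j\<in>{..<n}. f j \<otimes> b [^] j)"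
    by (rule finsum_cong') (use 0(1) subringE(1)[OF K] t b in \<open>auto simp: Pi_iff subset_iff\<close>)
  then show ?case
    using 0 by (intro exI[of _ f] exI[of _ "\<lambda>_. \<zero>"]) auto
next
  case (Suc d)
  have "\<forall>j. \<exists>c q. j < n \<longrightarrow> c \<in> K \<and> q \<in> polys_upto K t d \<and> f j = c \<oplus> t \<otimes> q"
    using polys_upto_bottom[OF K t(1) Suc.prems(1)] by blast
  then obtain c h where ch: "\<And>j. j < n \<Longrightarrow> c j \<in> K" "\<And>j. j < n \<Longrightarrow> h j \<in> polys_upto K t d"
    "\<And>j. j < n \<Longrightarrow> f j = c j \<oplus> t \<otimes> h j"
    by metis
  have cl: "c j \<in> carrier R" "h j \<in> carrier R" if "j < n" for j
    using ch[OF that] subringE(1)[OF K] polys_upto_carrier[OF K t(1), of d] by auto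
  show ?case
  proof (cases "\<exists>j<n. c j \<noteq> \<zero>")
    case True
    have "(\<Oplus>j\<in>{..<n}. (c j \<oplus> t \<otimes> h j) \<otimes> b [^] j) = (\<Oplus>j\<in>{..<n}. f j \<otimes> b [^] j)"
      by (rule finsum_cong') (use ch cl t b in auto)
    then show ?thesis
      using True ch(1,2) polys_upto_simple_extension[OF K t(1), of d] Suc.prems(3)
      by (intro exI[of _ c] exI[of _ h]) auto
  next
    case False
    then have f: "f j = t \<otimes> h j" if "j < n" for j
      using ch(3)[OF that] cl[OF that] t that by simp
    have "(\<Oplus>j\<in>{..<n}. f j \<otimes> b [^] j) = (\<Oplus>j\<in>{..<n}. t \<otimes> (h j \<otimes> b [^] j))"
      by (rule finsum_cong') (use f cl t b in \<open>auto simp: m_assoc\<close>)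
    also have "\<dots> = t \<otimes> (\<Oplus>j\<in>{..<n}. h j \<otimes> b [^] j)"
      by (rule finsum_rdistr[symmetric]) (use cl t b in auto)
    finally have "t \<otimes> (\<Oplus>j\<in>{..<n}. h j \<otimes> b [^] j) = \<zero>"
      using Suc.prems(3) by simp
    moreover have "(\<Oplus>j\<in>{..<n}. h j \<otimes> b [^] j) \<in> carrier R"
      by (rule finsum_closed) (use cl b in auto)
    ultimately have "(\<Oplus>j\<in>{..<n}. h j \<otimes> b [^] j) = \<zero>"
      using t integral_iff by blast
    moreover have "\<exists>j<n. h j \<noteq> \<zero>"
      using Suc.prems(2) f t by fastforce
    ultimately show ?thesis
      using Suc.IH[of h] ch(2) by blast
  qed
qed

text \<open>Stated with a multiplier instead of a quotient, the description by fractions passes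
  through all constructors; for an inverse, the numerator \<open>h \<otimes> g\<close> becomes the
  multiplier.\<close>

lemma generate_field_fraction:
  assumes K: "subring K R" and t: "t \<in> carrier R" and e: "e \<in> generate_field R (insert t K)"
  shows "e \<in> carrier R \<and> (\<exists>g\<in>simple_extension K t. g \<noteq> \<zero> \<and> e \<otimes> g \<in> simple_extension K t)"
proof -
  let ?P = "simple_extension K t"
  have P: "subring ?P R" "insert t K \<subseteq> ?P"
    using simple_extension_is_subring[OF K t] simple_extension_incl[OF subringE(1)[OF K] t]
      simple_extension_mem[OF K t] by auto
  note Pc = subringE(1)[OF P(1)]
  show ?thesis
    using e
  proof (induction rule: generate_field.induct)
    case one
    then show ?case
      using subringE(3)[OF P(1)] one_not_zero by (auto intro!: bexI[of _ \<one>])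
  next
    case (incl h)
    then have "h \<in> ?P" "h \<in> carrier R"
      using P(2) Pc by auto
    then show ?case
      using subringE(3)[OF P(1)] one_not_zero by (auto intro!: bexI[of _ \<one>])
  next
    case (a_inv h)
    then obtain g where "g \<in> ?P" "g \<noteq> \<zero>" "h \<otimes> g \<in> ?P" "h \<in> carrier R"
      by auto
    then show ?case
      using subringE(5)[OF P(1), of "h \<otimes> g"] Pc by (auto simp: l_minus subset_iff intro!: bexI[of _ g])
  next
    case (m_inv h)
    then obtain g where g: "g \<in> ?P" "g \<noteq> \<zero>" "h \<otimes> g \<in> ?P" "h \<in> carrier R"
      by auto
    have gc: "g \<in> carrier R" using g Pc by auto
    have h: "inv h \<in> carrier R"
      using inv_closed g(4) m_inv(2) .
    have "inv h \<otimes> (h \<otimes> g) = g"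
      using inv_mult_self[OF g(4) m_inv(2)] g(4) gc h by (simp add: m_assoc[symmetric])
    moreover have "h \<otimes> g \<noteq> \<zero>"
      using integral_iff g gc m_inv(2) by simp
    ultimately show ?case
      using h g by (auto intro!: bexI[of _ "h \<otimes> g"])
  next
    case (eng_add h1 h2)
    then obtain g1 g2 where g: "g1 \<in> ?P" "g1 \<noteq> \<zero>" "h1 \<otimes> g1 \<in> ?P" "h1 \<in> carrier R"
      "g2 \<in> ?P" "g2 \<noteq> \<zero>" "h2 \<otimes> g2 \<in> ?P" "h2 \<in> carrier R"
      by auto
    have gc: "g1 \<in> carrier R" "g2 \<in> carrier R" using g Pc by auto
    have "(h1 \<oplus> h2) \<otimes> (g1 \<otimes> g2) = (h1 \<otimes> g1) \<otimes> g2 \<oplus> (h2 \<otimes> g2) \<otimes> g1"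
      using g gc by algebra
    then have "(h1 \<oplus> h2) \<otimes> (g1 \<otimes> g2) \<in> ?P"
      using g subringE(6,7)[OF P(1)] by simp
    moreover have "g1 \<otimes> g2 \<in> ?P" "g1 \<otimes> g2 \<noteq> \<zero>"
      using g subringE(6)[OF P(1)] integral_iff gc by auto
    ultimately show ?case
      using g by blast
  next
    case (eng_mult h1 h2)
    then obtain g1 g2 where g: "g1 \<in> ?P" "g1 \<noteq> \<zero>" "h1 \<otimes> g1 \<in> ?P" "h1 \<in> carrier R"
      "g2 \<in> ?P" "g2 \<noteq> \<zero>" "h2 \<otimes> g2 \<in> ?P" "h2 \<in> carrier R"
      by auto
    have gc: "g1 \<in> carrier R" "g2 \<in> carrier R" using g Pc by auto
    have "(h1 \<otimes> h2) \<otimes> (g1 \<otimes> g2) = (h1 \<otimes> g1) \<otimes> (h2 \<otimes> g2)"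
      using g gc by algebra
    then have "(h1 \<otimes> h2) \<otimes> (g1 \<otimes> g2) \<in> ?P"
      using g subringE(6)[OF P(1)] by simp
    moreover have "g1 \<otimes> g2 \<in> ?P" "g1 \<otimes> g2 \<noteq> \<zero>"
      using g subringE(6)[OF P(1)] integral_iff gc by auto
    ultimately show ?case
      using g by blast
  qed
qed

lemma common_denominator:
  fixes n :: nat
  assumes K: "subring K R" and t: "t \<in> carrier R"
  shows "(\<And>j. j < n \<Longrightarrow> e j \<in> generate_field R (insert t K)) \<Longrightarrow>
    \<exists>g d. g \<in> simple_extension K t \<and> g \<noteq> \<zero> \<and> (\<forall>j<n. e j \<otimes> g \<in> polys_upto K t d)"
proof (induction n)
  case 0
  have "\<one> \<in> simple_extension K t"
    using subringE(3)[OF simple_extension_is_subring[OF K t]] .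
  then show ?case
    using one_not_zero by auto
next
  case (Suc n)
  let ?P = "simple_extension K t"
  have P: "subring ?P R" "K \<subseteq> ?P"
    using simple_extension_is_subring[OF K t] simple_extension_incl[OF subringE(1)[OF K] t] by auto
  note Pc = subringE(1)[OF P(1)]
  obtain g d where g: "g \<in> ?P" "g \<noteq> \<zero>" "\<And>j. j < n \<Longrightarrow> e j \<otimes> g \<in> polys_upto K t d"
    using Suc by (metis less_SucI)
  obtain g' where g': "g' \<in> ?P" "g' \<noteq> \<zero>" "e n \<otimes> g' \<in> ?P"
    using generate_field_fraction[OF K t Suc.prems[of n]] by auto
  have ec: "e j \<in> carrier R" if "j < Suc n" for j
    using generate_field_fraction[OF K t Suc.prems[OF that]] by blast
  have gc: "g \<in> carrier R" "g' \<in> carrier R"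
    using g g' Pc by auto
  have inP: "e j \<otimes> (g \<otimes> g') \<in> ?P" if j: "j < Suc n" for j
  proof (cases "j = n")
    case True
    have "e n \<otimes> (g \<otimes> g') = (e n \<otimes> g') \<otimes> g"
      using ec gc by (simp add: m_ac)
    then show ?thesis
      using True subringE(6)[OF P(1) g'(3) g(1)] by simp
  next
    case False
    then have "e j \<otimes> g \<in> ?P"
      using g(3)[of j] polys_upto_simple_extension[OF K t, of d] j by auto
    then show ?thesis
      using subringE(6)[OF P(1) _ g'(1), of "e j \<otimes> g"] ec[OF j] gc by (simp add: m_assoc)
  qed
  then have "\<forall>j. \<exists>d. j < Suc n \<longrightarrow> e j \<otimes> (g \<otimes> g') \<in> polys_upto K t d"
    using simple_extension_polys_upto[OF K t] by blast
  then obtain D where D: "\<And>j. j < Suc n \<Longrightarrow> e j \<otimes> (g \<otimes> g') \<in> polys_upto K t (D j)"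
    by metis
  have "e j \<otimes> (g \<otimes> g') \<in> polys_upto K t (Max (D ` {..<Suc n}))" if j: "j < Suc n" for j
  proof -
    have "D j \<le> Max (D ` {..<Suc n})"
      using j by (intro Max_ge) auto
    then show ?thesis
      using D[OF j] polys_upto_mono[OF K t] by blast
  qed
  moreover have "g \<otimes> g' \<in> ?P" "g \<otimes> g' \<noteq> \<zero>"
    using subringE(6)[OF P(1)] g g' gc integral_iff by auto
  ultimately show ?case
    by blast
qed

lemma primitive_relation_over_rationals:
  fixes n :: nat
  assumes K: "subring K R" and t: "t \<in> carrier R" "t \<noteq> \<zero>" and b: "b \<in> carrier R"
    and e: "\<And>j. j < n \<Longrightarrow> e j \<in> generate_field R (insert t K)" "\<exists>j<n. e j \<noteq> \<zero>"
      "(\<Oplus>j\<in>{..<n}. e j \<otimes> b [^] j) = \<zero>"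
  shows "primitive_dependency K t n b"
proof -
  obtain g d where g: "g \<in> simple_extension K t" "g \<noteq> \<zero>"
    "\<And>j. j < n \<Longrightarrow> e j \<otimes> g \<in> polys_upto K t d"
    using common_denominator[OF K t(1), where n = n and e = e] e(1) by blast
  have gc: "g \<in> carrier R"
    using g(1) simple_extension_in_carrier[OF subringE(1)[OF K] t(1)] by auto
  have ec: "e j \<in> carrier R" if "j < n" for j
    using generate_field_fraction[OF K t(1) e(1)[OF that]] by blast
  have "(\<Oplus>j\<in>{..<n}. (e j \<otimes> g) \<otimes> b [^] j) = (\<Oplus>j\<in>{..<n}. g \<otimes> (e j \<otimes> b [^] j))"
    by (rule finsum_cong') (use ec gc b in \<open>auto simp: m_ac\<close>)
  also have "\<dots> = g \<otimes> (\<Oplus>j\<in>{..<n}. e j \<otimes> b [^] j)"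
    by (rule finsum_rdistr[symmetric]) (use ec gc b in auto)
  finally have "(\<Oplus>j\<in>{..<n}. (e j \<otimes> g) \<otimes> b [^] j) = \<zero>"
    using e(3) gc by simp
  moreover have "\<exists>j<n. e j \<otimes> g \<noteq> \<zero>"
    using e(2) ec g(2) gc integral_iff by blast
  ultimately show ?thesis
    using primitive_relation[OF K t b, of n "\<lambda>j. e j \<otimes> g" d] g(3) by blast
qed

text \<open>Steinitz exchange for one element. Take a relation for \<open>t\<close> over
  \<open>K(s)\<close>, primitive with respect to \<open>s\<close>, and collect it as
  \<open>u + s w = 0\<close>, where \<open>u\<close> is the sum of the \<open>c_j t^j\<close>.
  Primitivity and transcendence of \<open>t\<close> make \<open>u\<close> nonzero, so this is a
  nontrivial polynomial equation for \<open>s\<close> over \<open>K(t)\<close>. The case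
  \<open>s = 0\<close> is apart because primitivity is reached by dividing by
  \<open>s\<close>.\<close>

lemma algebraic_exchange:
  assumes K: "subring K R" and s: "s \<in> carrier R" and t: "t \<in> carrier R" "transcendental K t"
    and alg: "algebraic (generate_field R (insert s K)) t"
  shows "algebraic (generate_field R (insert t K)) s"
proof (cases "s = \<zero>")
  case True
  have "subring (generate_field R (insert t K)) R"
    using subfieldE(1)[OF generate_field_is_subfield] t subringE(1)[OF K] by simp
  then show ?thesis
    using zero_is_algebraic True unfolding over_def by simp
next
  case False
  let ?E = "generate_field R (insert t K)"
  have E: "subring ?E R" "insert t K \<subseteq> ?E"
    using subfieldE(1)[OF generate_field_is_subfield] t subringE(1)[OF K]
    by (auto intro: generate_field.incl)
  have Ks: "subring (generate_field R (insert s K)) R"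
    using subfieldE(1)[OF generate_field_is_subfield] s subringE(1)[OF K] by simp
  obtain n :: nat and e where e: "\<And>j. j < n \<Longrightarrow> e j \<in> generate_field R (insert s K)" "\<exists>j<n. e j \<noteq> \<zero>"
    "(\<Oplus>j\<in>{..<n}. e j \<otimes> t [^] j) = \<zero>"
    using algebraic_relation[OF Ks t(1) alg] by blast
  obtain c h where ch: "\<And>j. j < n \<Longrightarrow> c j \<in> K" "\<And>j. j < n \<Longrightarrow> h j \<in> simple_extension K s"
    "\<exists>j<n. c j \<noteq> \<zero>" "(\<Oplus>j\<in>{..<n}. (c j \<oplus> s \<otimes> h j) \<otimes> t [^] j) = \<zero>"
    using primitive_relation_over_rationals[OF K s False t(1) e]
    unfolding primitive_dependency_def by blast
  define u where "u = (\<Oplus>j\<in>{..<n}. c j \<otimes> t [^] j)"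
  define w where "w = (\<Oplus>j\<in>{..<n}. h j \<otimes> t [^] j)"
  have S: "subring (simple_extension ?E s) R" "?E \<subseteq> simple_extension ?E s"
    using simple_extension_is_subring[OF E(1) s] simple_extension_incl[OF subringE(1)[OF E(1)] s] by auto
  have u: "u \<in> ?E"
    unfolding u_def using ch(1) E nat_pow_in_subring[OF E(1), of t]
    by (intro finsum_in_subring[OF E(1)]) (auto intro!: subringE(6)[OF E(1)])
  have "u \<noteq> \<zero>"
    using transcendental_finsum_eq_zero[OF K t, where c = c and n = n] ch(1,3) unfolding u_def by blast
  have "h j \<in> simple_extension ?E s" if "j < n" for j
    using ch(2)[OF that] mono_simple_extension[of K ?E s] E(2) by auto
  then have w: "w \<in> simple_extension ?E s"
    unfolding w_def using S(2) E nat_pow_in_subring[OF E(1), of t]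
    by (intro finsum_in_subring[OF S(1)]) (auto intro!: subringE(6)[OF S(1)])
  have cl: "c j \<in> carrier R" "h j \<in> carrier R" if "j < n" for j
    using ch(1,2)[OF that] subringE(1)[OF K] simple_extension_in_carrier[OF _ s] by blast+
  have "\<zero> = (\<Oplus>j\<in>{..<n}. c j \<otimes> t [^] j \<oplus> s \<otimes> (h j \<otimes> t [^] j))"
    unfolding ch(4)[symmetric]
    by (rule finsum_cong') (use cl s t in \<open>auto simp: l_distr m_assoc\<close>)
  also have "\<dots> = u \<oplus> (\<Oplus>j\<in>{..<n}. s \<otimes> (h j \<otimes> t [^] j))"
    unfolding u_def by (rule finsum_addf) (use cl s t in auto)
  also have "(\<Oplus>j\<in>{..<n}. s \<otimes> (h j \<otimes> t [^] j)) = s \<otimes> w"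
    unfolding w_def by (rule finsum_rdistr[symmetric]) (use cl s t in auto)
  finally have rel: "u \<oplus> s \<otimes> w = \<zero>"
    by simp
  obtain q where q: "q \<in> carrier (?E[X])" "w = eval q s"
    using w simple_extension_as_eval_img[OF subringE(1)[OF E(1)] s] by blast
  have qE: "set q \<subseteq> ?E" "set q \<subseteq> carrier R"
    using q subringE(1)[OF E(1)] polynomial_incl univ_poly_carrier by blast+
  have uc: "u \<in> carrier R" "w \<in> carrier R"
    using u w subringE(1)[OF E(1)] subringE(1)[OF S(1)] by auto
  \<comment> \<open>The list \<open>q @ [u]\<close> is \<open>X q(X) + u\<close>; it is a valid
    nonzero polynomial even for empty \<open>q\<close> because \<open>u\<close> is nonzero.\<close>
  have "polynomial ?E (q @ [u])"
    using q qE u \<open>u \<noteq> \<zero>\<close> unfolding univ_poly_carrier[symmetric] polynomial_def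
    by (auto simp: hd_append)
  moreover have "eval (q @ [u]) s = \<zero>"
    using eval_append_aux[OF qE(2) uc(1) s] q(2)[symmetric] rel uc s by (simp add: m_comm a_comm)
  ultimately show ?thesis
    using algebraicI[of "q @ [u]" ?E s] unfolding univ_poly_carrier over_def by auto
qed

text \<open>The chain uses \<open>t = inv z\<close> for many different \<open>z\<close>, so the
  finiteness known for one transcendence basis must be moved to any transcendental \<open>t\<close>.
  In the tower from \<open>K(t)\<close> over \<open>?L = K(t)(s)\<close> to
  \<open>?M = ?L(T)\<close>, the first floor is finite by exchange, the second because
  \<open>T\<close> is finite and algebraic over \<open>K(s)\<close>.\<close>

lemma finite_dimension_over_transcendental:
  assumes K: "subfield K R" and T: "finite T" "T \<subseteq> carrier R" "generate_field R (K \<union> T) = carrier R"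
    and s: "s \<in> carrier R" "\<And>x. x \<in> carrier R \<Longrightarrow> algebraic (generate_field R (insert s K)) x"
    and t: "t \<in> carrier R" "transcendental K t"
  shows "finite_dimension (generate_field R (insert t K)) (carrier R)"
proof -
  let ?E = "generate_field R (insert t K)"
  have Kr: "subring K R" and Kc: "K \<subseteq> carrier R"
    using subfieldE(1,3)[OF K] .
  have E: "subfield ?E R" "insert t K \<subseteq> ?E"
    using generate_field_is_subfield t Kc by (auto intro: generate_field.incl)
  have alg: "algebraic ?E s"
    using algebraic_exchange[OF Kr s(1) t s(2)[OF t(1)]] .
  let ?L = "finite_extension ?E [s]"
  have sE: "\<And>x. x \<in> set [s] \<Longrightarrow> (algebraic over ?E) x" "set [s] \<subseteq> carrier R"
    using alg s by (auto simp: over_def)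
  have L: "subfield ?L R" "finite_dimension ?E ?L" "?E \<subseteq> ?L" "s \<in> ?L"
    using finite_extension_is_subfield[OF E(1) sE(2,1)] finite_extension_finite_dimension(1)[OF E(1) sE(2,1)]
      finite_extension_incl[OF subfieldE(3)[OF E(1)] sE(2)]
      finite_extension_mem[OF subfieldE(1)[OF E(1)] sE(2)] by auto
  have "generate_field R (insert s K) \<subseteq> ?L"
    by (rule generate_field_min_subfield1) (use L E(2) s Kc in auto)
  then have algL: "(algebraic over ?L) x" if "x \<in> carrier R" for x
    using algebraic_mono s(2)[OF that] unfolding over_def by blast
  obtain xs where xs: "set xs = T"
    using finite_list[OF T(1)] by blast
  have xsL: "set xs \<subseteq> carrier R" "\<And>x. x \<in> set xs \<Longrightarrow> (algebraic over ?L) x"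
    using xs T algL by auto
  let ?M = "finite_extension ?L xs"
  have M: "subfield ?M R" "finite_dimension ?L ?M" "?L \<subseteq> ?M" "T \<subseteq> ?M"
    using finite_extension_is_subfield[OF L(1) xsL] finite_extension_finite_dimension(1)[OF L(1) xsL]
      finite_extension_incl[OF subfieldE(3)[OF L(1)] xsL(1)]
      finite_extension_mem[OF subfieldE(1)[OF L(1)] xsL(1)] xs by auto
  have "generate_field R (K \<union> T) \<subseteq> ?M"
    by (rule generate_field_min_subfield1) (use M L E(2) Kc T in auto)
  then have "?M = carrier R"
    using T(3) subfieldE(3)[OF M(1)] by auto
  then show ?thesis
    using telescopic_base_dim(1)[OF E(1) L(1,2)] M(2) by simp
qed

end


subsection \<open>The Frobenius map and discreteness\<close>

lemma (in cring) binomial_theorem: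
  assumes "x \<in> carrier R" "y \<in> carrier R"
  shows "(x \<oplus> y) [^] (n::nat) = (\<Oplus>k\<in>{..n}. add_pow R (n choose k) (x [^] k \<otimes> y [^] (n - k)))"
proof (induction n)
  case 0
  then show ?case by simp
next
  case (Suc n)
  define f where "f k = add_pow R (n choose k) (x [^] k \<otimes> y [^] (n - k))" for k
  define g where "g k = add_pow R (n choose k) (x [^] k \<otimes> y [^] (Suc n - k))" for k
  define h where "h k = add_pow R (Suc n choose k) (x [^] k \<otimes> y [^] (Suc n - k))" for k
  have cl: "f k \<in> carrier R" "g k \<in> carrier R" "h k \<in> carrier R" for k
    using assms by (auto simp: f_def g_def h_def)
  have fx: "f k \<otimes> x = add_pow R (n choose k) (x [^] Suc k \<otimes> y [^] (n - k))" for k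
    unfolding f_def using assms by (simp add: add_pow_ldistr add_pow_rdistr m_ac)
  have fy: "f k \<otimes> y = g k" if "k \<le> n" for k
    unfolding f_def g_def using assms that by (simp add: add_pow_ldistr add_pow_rdistr m_ac Suc_diff_le)
  have hS: "h (Suc k) = f k \<otimes> x \<oplus> g (Suc k)" for k
    unfolding fx h_def g_def using assms by (simp add: add.nat_pow_mult)
  have "(x \<oplus> y) [^] Suc n = (\<Oplus>k\<in>{..n}. f k) \<otimes> (x \<oplus> y)"
    using Suc by (simp add: f_def)
  also have "\<dots> = (\<Oplus>k\<in>{..n}. f k) \<otimes> x \<oplus> (\<Oplus>k\<in>{..n}. f k) \<otimes> y"
    using assms cl by (simp add: r_distr)
  also have "(\<Oplus>k\<in>{..n}. f k) \<otimes> x = (\<Oplus>k\<in>{..n}. f k \<otimes> x)"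
    by (rule finsum_ldistr) (use assms cl in auto)
  also have "(\<Oplus>k\<in>{..n}. f k) \<otimes> y = (\<Oplus>k\<in>{..n}. f k \<otimes> y)"
    by (rule finsum_ldistr) (use assms cl in auto)
  also have "\<dots> = (\<Oplus>k\<in>{..n}. g k)"
    by (rule finsum_cong') (use fy cl in auto)
  also have "\<dots> = (\<Oplus>k\<in>{..Suc n}. g k)"
  proof -
    have "g (Suc n) = \<zero>"
      by (simp add: g_def binomial_eq_0)
    then show ?thesis
      using finsum_Suc[of g n] cl by simp
  qed
  also have "\<dots> = (\<Oplus>k\<in>{..n}. g (Suc k)) \<oplus> g 0"
    by (rule finsum_Suc2) (use cl in auto)
  finally have "(x \<oplus> y) [^] Suc n = (\<Oplus>k\<in>{..n}. f k \<otimes> x \<oplus> g (Suc k)) \<oplus> g 0"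
    using cl assms by (simp add: finsum_addf a_assoc)
  also have "\<dots> = (\<Oplus>k\<in>{..n}. h (Suc k)) \<oplus> h 0"
    unfolding hS by (simp add: h_def g_def)
  also have "\<dots> = (\<Oplus>k\<in>{..Suc n}. h k)"
    by (rule finsum_Suc2[symmetric]) (use cl in auto)
  finally show ?case
    by (simp add: h_def)
qed

lemma (in cring) add_pow_char:
  assumes "add_pow R p \<one> = \<zero>" "p dvd (n::nat)" "x \<in> carrier R"
  shows "add_pow R (n::nat) x = \<zero>"
proof -
  obtain m where n: "n = p * m"
    using assms(2) by auto
  have "add_pow R p x = add_pow R p \<one> \<otimes> x"
    using assms(3) by (simp add: add_pow_ldistr)
  then have "add_pow R p x = \<zero>"
    using assms(1,3) by simp
  then have "add_pow R m (add_pow R p x) = \<zero>"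
    by simp
  then show ?thesis
    using add.nat_pow_pow[OF assms(3)] n by simp
qed

lemma (in cring) frobenius_add:
  assumes p: "Factorial_Ring.prime p" "add_pow R p \<one> = \<zero>" and x: "x \<in> carrier R" "y \<in> carrier R"
  shows "(x \<oplus> y) [^] (p::nat) = x [^] p \<oplus> y [^] p"
proof -
  define f where "f k = add_pow R (p choose k) (x [^] k \<otimes> y [^] (p - k))" for k
  have cl: "f k \<in> carrier R" for k
    using x by (auto simp: f_def)
  obtain m where m: "p = Suc (Suc m)"
    using prime_ge_2_nat[OF p(1)] by (metis add_2_eq_Suc le_Suc_ex)
  have "f (Suc k) = \<zero>" if "k \<le> m" for k
  proof -
    have "p dvd p choose Suc k"
      using that m p(1) by (intro dvd_choose_prime) auto
    then show ?thesis
      unfolding f_def using add_pow_char[OF p(2)] x by simp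
  qed
  then have "(\<Oplus>k\<in>{..m}. f (Suc k)) = \<zero>"
    by (intro add.finprod_one_eqI) auto
  then have "(\<Oplus>k\<in>{..p}. f k) = f p \<oplus> f 0"
    unfolding m using cl finsum_Suc[of f "Suc m"] finsum_Suc2[of f m] by simp
  moreover have "f p = x [^] p" "f 0 = y [^] p"
    using x by (auto simp: f_def)
  ultimately show ?thesis
    using binomial_theorem[OF x, of p] by (simp add: f_def)
qed

section \<open>Discreteness of pole orders\<close>

context field
begin

text \<open>Suppose \<open>b\<close> has a pole at \<open>V\<close>, and let \<open>J\<close> be the
  ideal \<open>inv b \<otimes> V\<close>, which is proper. Since \<open>b^q t\<close> is in
  \<open>V\<close>, every \<open>t b^j\<close> with \<open>j < n\<close> lies in \<open>J\<close>.
  Divide the primitive relation by \<open>b^i\<close>, where \<open>i\<close> is maximal with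
  \<open>c i\<close> nonzero: all terms except \<open>c i\<close> land in \<open>J\<close>, and then
  so does the unit \<open>c i\<close>. The uniform length \<open>n\<close> in \<open>rel\<close>
  takes the place of the bound of ramification indices by \<open>[F : K(t)]\<close>.\<close>

lemma val_closure_discrete:
  assumes K: "subfield K R" "K \<subseteq> Y" and Y: "Y \<subseteq> carrier R" and z: "z \<in> carrier R" "z \<noteq> \<zero>"
    and rel: "\<And>b. b \<in> carrier R \<Longrightarrow> primitive_dependency K (inv z) n b"
    and b: "b \<in> val_closure (insert z Y)" "b [^] q \<otimes> inv z \<in> val_closure (insert (inv z) Y)"
    and q: "n \<le> (q::nat)"
  shows "b \<in> val_closure Y"
proof (rule val_closureI)
  show bc: "b \<in> carrier R"
    using b val_closure_carrier by auto
  let ?t = "inv z"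
  have t: "?t \<in> carrier R"
    using inv_closed[OF z] .
  fix V assume V: "valuation_ring V" "Y \<subseteq> V"
  have Vr: "subring V R"
    using valuation_ringD(1)[OF V(1)] .
  note Vc = subringE(1)[OF Vr]
  show "b \<in> V"
  proof (rule ccontr)
    assume nb: "b \<notin> V"
    \<comment> \<open>A pole of \<open>b\<close> forces one of \<open>z\<close>, as \<open>b\<close>
      is in all valuation rings containing \<open>z\<close> and \<open>Y\<close>. This puts
      \<open>inv z\<close> into \<open>V\<close> and makes the second assumption on \<open>b\<close>
      available.\<close>
    then have "z \<notin> V"
      using val_closureD[OF b(1) V(1)] V(2) by auto
    then have tV: "?t \<in> V"
      using valuation_ringD(2)[OF V(1) z(1)] by simp
    then have bq: "b [^] q \<otimes> ?t \<in> V"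
      using val_closureD[OF b(2) V(1)] V(2) by auto
    let ?w = "inv b"
    have b0: "b \<noteq> \<zero>"
      using nb subringE(2)[OF Vr] by auto
    have w: "?w \<in> V" "?w \<in> carrier R"
      using valuation_ringD(2)[OF V(1) bc nb] inv_closed[OF bc b0] by auto
    define J where "J = {?w \<otimes> x |x. x \<in> V}"
    have J0: "\<zero> \<in> J"
      unfolding J_def using subringE(2)[OF Vr] w(2) by (auto intro!: exI[of _ \<zero>])
    have Jc: "J \<subseteq> carrier R"
      unfolding J_def using w Vc by auto
    have Jadd: "x \<oplus> y \<in> J" if xy: "x \<in> J" "y \<in> J" for x y
    proof -
      obtain x' y' where x': "x = ?w \<otimes> x'" "x' \<in> V" and y': "y = ?w \<otimes> y'" "y' \<in> V"
        using xy unfolding J_def by auto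
      have "x \<oplus> y = ?w \<otimes> (x' \<oplus> y')"
        unfolding x' y' using x' y' Vc w by (auto simp: r_distr subset_iff)
      then show ?thesis
        unfolding J_def using subringE(7)[OF Vr x'(2) y'(2)] by blast
    qed
    have Jmult: "x \<otimes> y \<in> J" if xy: "x \<in> J" "y \<in> V" for x y
    proof -
      obtain x' where x': "x = ?w \<otimes> x'" "x' \<in> V"
        using xy unfolding J_def by auto
      have "x \<otimes> y = ?w \<otimes> (x' \<otimes> y)"
        unfolding x' using x' xy Vc w by (auto simp: m_assoc subset_iff)
      then show ?thesis
        unfolding J_def using subringE(6)[OF Vr x'(2) xy(2)] by blast
    qed
    have Jsum: "finsum R f I \<in> J" if "finite I" "\<And>i. i \<in> I \<Longrightarrow> f i \<in> J" for f and I :: "nat set"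
      using that
    proof (induction I rule: finite_induct)
      case (insert i I)
      then show ?case
        using Jadd Jc by (subst finsum_insert) auto
    qed (simp add: J0)
    have one: "\<one> \<notin> J"
    proof
      assume "\<one> \<in> J"
      then obtain x where x: "\<one> = ?w \<otimes> x" "x \<in> V"
        unfolding J_def by auto
      have "b = b \<otimes> (?w \<otimes> x)"
        using x(1)[symmetric] bc by simp
      also have "\<dots> = x"
        using self_mult_inv[OF bc b0] x(2) Vc bc w by (auto simp: m_assoc[symmetric] subset_iff)
      finally show False
        using nb x(2) by simp
    qed
    have wJ: "?w [^] Suc m \<in> J" for m :: nat
      unfolding J_def using nat_pow_Suc2[OF w(2)] nat_pow_in_subring[OF Vr w(1)] by blast
    have KV: "K \<subseteq> V"
      using K(2) V(2) by auto
    have hV: "simple_extension K ?t \<subseteq> V"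
      using simple_extension_subring_incl[OF Vr KV tV] .
    obtain c h where ch: "\<And>j. j < n \<Longrightarrow> c j \<in> K" "\<And>j. j < n \<Longrightarrow> h j \<in> simple_extension K ?t"
      "\<exists>j<n. c j \<noteq> \<zero>" "(\<Oplus>j\<in>{..<n}. (c j \<oplus> ?t \<otimes> h j) \<otimes> b [^] j) = \<zero>"
      using rel[OF bc] unfolding primitive_dependency_def by blast
    define i where "i = Max {j. j < n \<and> c j \<noteq> \<zero>}"
    have "i \<in> {j. j < n \<and> c j \<noteq> \<zero>}"
      unfolding i_def using ch(3) by (intro Max_in) auto
    then have i: "i < n" "c i \<noteq> \<zero>"
      by auto
    have above: "c j = \<zero>" if "i < j" "j < n" for j
      using Max_ge[of "{j. j < n \<and> c j \<noteq> \<zero>}" j] that unfolding i_def by fastforce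
    have cV: "c j \<in> V" "c j \<in> carrier R" "h j \<in> V" "h j \<in> carrier R" if "j < n" for j
      using ch(1,2)[OF that] KV hV Vc by auto
    have wi: "?w [^] i \<in> V" "?w [^] i \<in> carrier R"
      using nat_pow_in_subring[OF Vr w(1)] Vc by auto
    \<comment> \<open>Here \<open>n \<le> q\<close> enters: \<open>q - j\<close> is at least 1, so a
      factor \<open>inv b\<close> remains.\<close>
    have tail: "?t \<otimes> b [^] j \<in> J" if j: "j < n" for j
    proof -
      obtain m where m: "q - j = Suc m"
        using j q by (metis Suc_diff_Suc diff_Suc_Suc less_le_trans)
      have "b [^] j = b [^] q \<otimes> ?w [^] (q - j)"
        using pow_mult_inv_pow[OF bc b0, of "q - j" q] j q by simp
      then have "?t \<otimes> b [^] j = ?w [^] Suc m \<otimes> (b [^] q \<otimes> ?t)"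
        unfolding m using t bc w by (simp add: m_ac)
      then show ?thesis
        using Jmult[OF wJ bq] by simp
    qed
    have tail': "(?t \<otimes> h j \<otimes> b [^] j) \<otimes> ?w [^] i \<in> J" if j: "j < n" for j
    proof -
      have "(?t \<otimes> h j \<otimes> b [^] j) \<otimes> ?w [^] i = (?t \<otimes> b [^] j) \<otimes> (h j \<otimes> ?w [^] i)"
        using t bc w cV(4)[OF j] by (simp add: m_ac)
      then show ?thesis
        using Jmult[OF tail[OF j] subringE(6)[OF Vr cV(3)[OF j] wi(1)]] by simp
    qed
    let ?g = "\<lambda>j. (c j \<oplus> ?t \<otimes> h j) \<otimes> b [^] j \<otimes> ?w [^] i"
    have g: "?g j = c j \<otimes> (b [^] j \<otimes> ?w [^] i) \<oplus> (?t \<otimes> h j \<otimes> b [^] j) \<otimes> ?w [^] i" if j: "j < n" for j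
      using cV[OF j] t bc wi by (simp add: l_distr m_assoc)
    have gJ: "?g j \<in> J" if j: "j < n" "j \<noteq> i" for j
    proof -
      have "c j \<otimes> (b [^] j \<otimes> ?w [^] i) \<in> J"
      proof (cases "j < i")
        case True
        then obtain m where m: "i - j = Suc m"
          by (metis Suc_diff_Suc)
        have "b [^] j \<otimes> ?w [^] i = (b [^] j \<otimes> ?w [^] j) \<otimes> ?w [^] (i - j)"
          using True bc w by (simp add: m_assoc nat_pow_mult)
        also have "b [^] j \<otimes> ?w [^] j = \<one>"
          using pow_mult_inv_pow[OF bc b0, of j j] by simp
        finally have "b [^] j \<otimes> ?w [^] i = ?w [^] Suc m"
          using w m by simp
        then show ?thesis
          using Jmult[OF wJ cV(1)[OF j(1)], of m] cV(2)[OF j(1)] w by (simp add: m_comm del: nat_pow_Suc)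
      next
        case False
        then show ?thesis
          using above j J0 bc w by simp
      qed
      then show ?thesis
        unfolding g[OF j(1)] using Jadd tail'[OF j(1)] by blast
    qed
    have gc: "?g \<in> {..<n} \<rightarrow> carrier R"
      using cV t bc wi by auto
    have "\<zero> = (\<Oplus>j\<in>{..<n}. ?g j)"
    proof -
      have "(\<Oplus>j\<in>{..<n}. ?g j) = (\<Oplus>j\<in>{..<n}. (c j \<oplus> ?t \<otimes> h j) \<otimes> b [^] j) \<otimes> ?w [^] i"
        by (rule finsum_ldistr[symmetric]) (use cV t bc wi in auto)
      then show ?thesis
        using ch(4) wi by simp
    qed
    also have "\<dots> = (\<Oplus>j\<in>insert i ({..<n} - {i}). ?g j)"
      using i(1) by (simp add: insert_absorb)
    also have "\<dots> = ?g i \<oplus> (\<Oplus>j\<in>{..<n} - {i}. ?g j)"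
      by (rule finsum_insert) (use gc i in \<open>auto simp: Pi_iff\<close>)
    also have "?g i = c i \<oplus> (?t \<otimes> h i \<otimes> b [^] i) \<otimes> ?w [^] i"
      unfolding g[OF i(1)] using pow_mult_inv_pow[OF bc b0, of i i] cV[OF i(1)] by simp
    finally have eq: "\<zero> = c i \<oplus> (?t \<otimes> h i \<otimes> b [^] i) \<otimes> ?w [^] i \<oplus> (\<Oplus>j\<in>{..<n} - {i}. ?g j)" .
    let ?y = "(?t \<otimes> h i \<otimes> b [^] i) \<otimes> ?w [^] i \<oplus> (\<Oplus>j\<in>{..<n} - {i}. ?g j)"
    have y: "?y \<in> J"
      using Jadd tail'[OF i(1)] Jsum[of "{..<n} - {i}" ?g] gJ by simp
    have "c i \<oplus> ?y = \<zero>"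
      using eq cV(2)[OF i(1)] tail'[OF i(1)] Jc Jsum[of "{..<n} - {i}" ?g] gJ
      by (subst a_assoc[symmetric]) auto
    moreover have yc: "?y \<in> carrier R"
      using y Jc by (rule rev_subsetD)
    ultimately have "?y \<oplus> c i = \<zero>"
      using a_comm[OF yc cV(2)[OF i(1)]] by simp
    then have "\<ominus> c i = ?y"
      using minus_equality yc cV(2)[OF i(1)] by blast
    moreover have ci: "inv (c i) \<in> V" "inv (c i) \<in> carrier R"
      using subfield_m_inv(1)[OF K(1), of "c i"] ch(1)[OF i(1)] i(2) KV Vc by auto
    ultimately have "(\<ominus> c i) \<otimes> (\<ominus> (inv (c i))) \<in> J"
      using Jmult[OF y subringE(5)[OF Vr ci(1)]] by argo
    moreover have "(\<ominus> c i) \<otimes> (\<ominus> (inv (c i))) = \<one>"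
      using self_mult_inv[OF cV(2)[OF i(1)] i(2)] cV(2)[OF i(1)] ci by (simp add: l_minus r_minus)
    ultimately show False
      using one by simp
  qed
qed

end


subsection \<open>Frobenius bases\<close>

lemma finite_has_greatest:
  assumes "trans r" "total r" "finite A" "A \<noteq> {}"
  shows "\<exists>m\<in>A. \<forall>a\<in>A. a = m \<or> (a, m) \<in> r"
  using assms(3,4)
proof (induction A rule: finite_ne_induct)
  case (insert x A)
  then obtain m where m: "m \<in> A" "\<forall>a\<in>A. a = m \<or> (a, m) \<in> r"
    by auto
  show ?case
  proof (cases "(m, x) \<in> r")
    case True
    then show ?thesis
      using m transD[OF assms(1) _ True] by auto
  next
    case False
    then have "x = m \<or> (x, m) \<in> r"
      using assms(2) by (auto simp: total_on_def)
    then show ?thesis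
      using m by auto
  qed
qed simp

lemma (in domain) nat_pow_eq_zero:
  assumes "x \<in> carrier R" "x [^] (n::nat) = \<zero>"
  shows "x = \<zero>"
  using assms(2)
proof (induction n)
  case (Suc n)
  then have "x [^] n = \<zero> \<or> x = \<zero>"
    using assms(1) by (simp add: integral_iff)
  then show ?case
    using Suc.IH by argo
qed simp

locale perfect_subfield = field R for R (structure) +
  fixes K :: "'a set" and p :: nat
  assumes subfield_K: "subfield K R"
    and prime_p: "Factorial_Ring.prime p"
    and char_p: "add_pow R p \<one> = \<zero>"
    and perfect: "a \<in> K \<Longrightarrow> \<exists>b\<in>K. b [^] p = a"
begin

section \<open>Frobenius on a field with a perfect subfield\<close>

lemma K_subring: "subring K R"
  using subfieldE(1)[OF subfield_K] .

lemma K_carrier: "K \<subseteq> carrier R"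
  using subfieldE(3)[OF subfield_K] .

lemma p_pos: "p > 0"
  using prime_gt_0_nat[OF prime_p] .

lemma frob_add: "x \<in> carrier R \<Longrightarrow> y \<in> carrier R \<Longrightarrow> (x \<oplus> y) [^] p = x [^] p \<oplus> y [^] p"
  using frobenius_add[OF prime_p char_p] .

lemma frob_pow_add:
  "x \<in> carrier R \<Longrightarrow> y \<in> carrier R \<Longrightarrow> (x \<oplus> y) [^] (p ^ k) = x [^] (p ^ k) \<oplus> y [^] (p ^ k)"
proof (induction k)
  case (Suc k)
  have "(x \<oplus> y) [^] (p ^ Suc k) = ((x \<oplus> y) [^] (p ^ k)) [^] p"
    using Suc.prems by (simp add: nat_pow_pow mult.commute)
  also have "\<dots> = (x [^] (p ^ k)) [^] p \<oplus> (y [^] (p ^ k)) [^] p"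
    using Suc frob_add by simp
  finally show ?case
    using Suc.prems by (simp add: nat_pow_pow mult.commute)
qed simp

lemma zero_pow_p: "\<zero> [^] (p ^ k) = \<zero>"
  using p_pos by (simp add: nat_pow_zero)

lemma frob_pow_finsum:
  assumes "finite A" "f \<in> A \<rightarrow> carrier R"
  shows "(\<Oplus>a\<in>A. f a) [^] (p ^ k) = (\<Oplus>a\<in>A. f a [^] (p ^ k))"
  using assms
proof (induction A rule: finite_induct)
  case (insert a A)
  then show ?case
    using frob_pow_add by (simp add: Pi_iff)
qed (simp add: zero_pow_p)

lemma frob_minus: "x \<in> carrier R \<Longrightarrow> (\<ominus> x) [^] p = \<ominus> (x [^] p)"
  using frob_add[of "\<ominus> x" x] minus_equality[of "(\<ominus> x) [^] p" "x [^] p"] zero_pow_p[of 1] by (simp add: l_neg)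

lemma frob_inj:
  assumes "x \<in> carrier R" "y \<in> carrier R" "x [^] p = y [^] p"
  shows "x = y"
proof -
  have "(x \<oplus> \<ominus> y) [^] p = \<zero>"
    using assms frob_add frob_minus by (simp add: r_neg)
  then have "x \<oplus> \<ominus> y = \<zero>"
    using nat_pow_eq_zero[of "x \<oplus> \<ominus> y" p] assms(1,2) by (metis a_closed a_inv_closed)
  then show ?thesis
    using minus_equality[of x "\<ominus> y"] assms(1,2) minus_minus[of y] by (simp only: a_inv_closed)
qed

text \<open>A lift of a \<open>K\<close>-basis of \<open>R/R\<^sup>p\<close> that, together with \<open>K\<close>, generates \<open>R\<close> as a
  \<open>K[\<phi>]\<close>-module.\<close>

definition frobenius_basis :: "'a set \<Rightarrow> bool" where
  "frobenius_basis B \<longleftrightarrow> B \<subseteq> carrier R \<and>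
     (\<forall>A u y. finite A \<and> A \<subseteq> B \<and> u \<in> A \<rightarrow> K \<and> y \<in> carrier R \<and> (\<Oplus>b\<in>A. u b \<otimes> b) = y [^] p \<longrightarrow>
       (\<forall>b\<in>A. u b = \<zero>)) \<and>
     (\<forall>G. K \<subseteq> G \<and> B \<subseteq> G \<and> (\<forall>x\<in>G. \<forall>y\<in>G. x \<oplus> y \<in> G) \<and> (\<forall>c\<in>K. \<forall>x\<in>G. c \<otimes> x \<in> G) \<and>
       (\<forall>x\<in>G. x [^] p \<in> G) \<longrightarrow> carrier R \<subseteq> G)"

lemma frobenius_basisI:
  assumes "B \<subseteq> carrier R"
    and "\<And>A u y b. \<lbrakk>finite A; A \<subseteq> B; u \<in> A \<rightarrow> K; y \<in> carrier R; (\<Oplus>b\<in>A. u b \<otimes> b) = y [^] p; b \<in> A\<rbrakk> \<Longrightarrow>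
      u b = \<zero>"
    and "\<And>G. \<lbrakk>K \<subseteq> G; B \<subseteq> G; \<And>x y. x \<in> G \<Longrightarrow> y \<in> G \<Longrightarrow> x \<oplus> y \<in> G;
      \<And>c x. c \<in> K \<Longrightarrow> x \<in> G \<Longrightarrow> c \<otimes> x \<in> G; \<And>x. x \<in> G \<Longrightarrow> x [^] p \<in> G\<rbrakk> \<Longrightarrow> carrier R \<subseteq> G"
  shows "frobenius_basis B"
  unfolding frobenius_basis_def
proof (intro conjI allI impI ballI)
  show "B \<subseteq> carrier R"
    by (rule assms(1))
  show "u b = \<zero>"
    if "finite A \<and> A \<subseteq> B \<and> u \<in> A \<rightarrow> K \<and> y \<in> carrier R \<and> (\<Oplus>b\<in>A. u b \<otimes> b) = y [^] p" "b \<in> A" for A u y b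
    using assms(2)[of A u y b] that by simp
  show "carrier R \<subseteq> G"
    if "K \<subseteq> G \<and> B \<subseteq> G \<and> (\<forall>x\<in>G. \<forall>y\<in>G. x \<oplus> y \<in> G) \<and> (\<forall>c\<in>K. \<forall>x\<in>G. c \<otimes> x \<in> G) \<and>
      (\<forall>x\<in>G. x [^] p \<in> G)" for G
    using assms(3)[of G] that by simp
qed

lemma frobenius_basisD:
  assumes "frobenius_basis B"
  shows "B \<subseteq> carrier R"
    and "\<lbrakk>finite A; A \<subseteq> B; u \<in> A \<rightarrow> K; y \<in> carrier R; (\<Oplus>b\<in>A. u b \<otimes> b) = y [^] p; b \<in> A\<rbrakk> \<Longrightarrow> u b = \<zero>"
    and "\<lbrakk>K \<subseteq> G; B \<subseteq> G; \<And>x y. x \<in> G \<Longrightarrow> y \<in> G \<Longrightarrow> x \<oplus> y \<in> G;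
      \<And>c x. c \<in> K \<Longrightarrow> x \<in> G \<Longrightarrow> c \<otimes> x \<in> G; \<And>x. x \<in> G \<Longrightarrow> x [^] p \<in> G\<rbrakk> \<Longrightarrow> carrier R \<subseteq> G"
proof -
  note B = assms[unfolded frobenius_basis_def]
  show "B \<subseteq> carrier R"
    using B by (rule conjunct1)
  show "u b = \<zero>"
    if "finite A" "A \<subseteq> B" "u \<in> A \<rightarrow> K" "y \<in> carrier R" "(\<Oplus>b\<in>A. u b \<otimes> b) = y [^] p" "b \<in> A"
    using B[THEN conjunct2, THEN conjunct1, rule_format, of A u y b] that by simp
  show "carrier R \<subseteq> G"
    if "K \<subseteq> G" "B \<subseteq> G" "\<And>x y. x \<in> G \<Longrightarrow> y \<in> G \<Longrightarrow> x \<oplus> y \<in> G"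
      "\<And>c x. c \<in> K \<Longrightarrow> x \<in> G \<Longrightarrow> c \<otimes> x \<in> G" "\<And>x. x \<in> G \<Longrightarrow> x [^] p \<in> G"
    using B[THEN conjunct2, THEN conjunct2, THEN spec[of _ G]] that by simp
qed

text \<open>A greedy basis of \<open>R\<close> modulo the \<open>p\<close>-th powers: \<open>x\<close> is rejected when modulo \<open>R\<^sup>p\<close> it is a
  combination of predecessors. If the order refines the filtration \<open>W\<close>, the remainder \<open>y\<^sup>p\<close> lies in
  the filtration step of \<open>x\<close>, hence \<open>y\<close> in an earlier one, so that the induction continues with \<open>y\<close>.\<close>

lemma ex_frobenius_basis_of_filtration:
  fixes W :: "'i \<Rightarrow> 'a set"
  assumes prec: "wf prec" "trans prec" "total prec"
    and W: "\<And>i. i \<in> I \<Longrightarrow> W i \<subseteq> carrier R" "\<And>i. i \<in> I \<Longrightarrow> \<zero> \<in> W i"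
      "\<And>i x y. i \<in> I \<Longrightarrow> x \<in> W i \<Longrightarrow> y \<in> W i \<Longrightarrow> x \<oplus> y \<in> W i"
      "\<And>i c x. i \<in> I \<Longrightarrow> c \<in> K \<Longrightarrow> x \<in> W i \<Longrightarrow> c \<otimes> x \<in> W i"
    and mono: "\<And>i j. i \<in> I \<Longrightarrow> j \<in> I \<Longrightarrow> (i, j) \<in> prec \<Longrightarrow> W i \<subseteq> W j"
    and exhaust: "\<And>x. x \<in> carrier R \<Longrightarrow> \<exists>i\<in>I. x \<in> W i"
    and root: "\<And>i x. i \<in> I \<Longrightarrow> x \<in> carrier R \<Longrightarrow> x [^] p \<in> W i \<Longrightarrow>
      x \<in> K \<or> (\<exists>j\<in>I. (j, i) \<in> prec \<and> x \<in> W j)"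
  shows "\<exists>B. frobenius_basis B"
proof -
  have "\<forall>x\<in>carrier R. \<exists>i. i \<in> I \<and> x \<in> W i \<and> (\<forall>j\<in>I. (j, i) \<in> prec \<longrightarrow> x \<notin> W j)"
  proof
    fix x assume "x \<in> carrier R"
    then obtain i where "i \<in> {i \<in> I. x \<in> W i}"
      using exhaust by auto
    then obtain i where "i \<in> {i \<in> I. x \<in> W i}" "\<And>j. (j, i) \<in> prec \<Longrightarrow> j \<notin> {i \<in> I. x \<in> W i}"
      by (rule wfE_min[OF prec(1)]) blast
    then show "\<exists>i. i \<in> I \<and> x \<in> W i \<and> (\<forall>j\<in>I. (j, i) \<in> prec \<longrightarrow> x \<notin> W j)"
      by auto
  qed
  from bchoice[OF this] obtain idx where idx: "\<And>x. x \<in> carrier R \<Longrightarrow> idx x \<in> I"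
    "\<And>x. x \<in> carrier R \<Longrightarrow> x \<in> W (idx x)"
    "\<And>x j. x \<in> carrier R \<Longrightarrow> j \<in> I \<Longrightarrow> (j, idx x) \<in> prec \<Longrightarrow> x \<notin> W j"
    by auto
  obtain r :: "'a rel" where "well_order_on UNIV r"
    using well_order_on by blast
  define lt where "lt = r - Id"
  have lt: "wf lt" "trans lt" "total lt"
    using \<open>well_order_on UNIV r\<close> unfolding lt_def well_order_on_def linear_order_on_def partial_order_on_def
      preorder_on_def by (auto intro: trans_diff_Id simp: total_on_def)
  \<comment> \<open>The filtration decides first, an arbitrary well-order breaks ties; one
    filtration step may add many dimensions, so its elements need an order among themselves.\<close>
  define ord where "ord = inv_image (prec <*lex*> lt) (\<lambda>x. (idx x, x))"
  have ord: "wf ord" "trans ord" "total ord"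
    using prec lt unfolding ord_def
    by (auto intro!: trans_inv_image trans_lex_prod simp: total_on_def)
  have ord_irrefl: "(x, x) \<notin> ord" for x
    using ord(1) by (simp add: wf_irrefl)
  have ord_W: "x \<in> W (idx y)" if "(x, y) \<in> ord" "x \<in> carrier R" "y \<in> carrier R" for x y
  proof -
    have "idx x = idx y \<or> (idx x, idx y) \<in> prec"
      using that(1) by (auto simp: ord_def)
    then show ?thesis
      using idx(2)[OF that(2)] mono[OF idx(1)[OF that(2)] idx(1)[OF that(3)]] by auto
  qed
  have ord_less: "(x, y) \<in> ord" if "x \<in> carrier R" "j \<in> I" "x \<in> W j" "(j, idx y) \<in> prec" for x y j
  proof -
    have "idx x = j \<or> (idx x, j) \<in> prec"
      using idx(3)[OF that(1,2)] that(3) prec(3) by (auto simp: total_on_def)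
    then have "(idx x, idx y) \<in> prec"
      using that(4) transD[OF prec(2)] by auto
    then show ?thesis
      by (simp add: ord_def)
  qed
  define comb where "comb x \<longleftrightarrow> (\<exists>A u y. finite A \<and> A \<subseteq> carrier R \<and> (\<forall>c\<in>A. (c, x) \<in> ord) \<and> u \<in> A \<rightarrow> K \<and>
    y \<in> carrier R \<and> x = (\<Oplus>c\<in>A. u c \<otimes> c) \<oplus> y [^] p)" for x
  define B where "B = {x \<in> carrier R. \<not> comb x}"
  have finsum_closed_in: "(\<Oplus>c\<in>A. u c \<otimes> c) \<in> G"
    if "finite A" "A \<subseteq> carrier R" "A \<subseteq> G" "u \<in> A \<rightarrow> K" and G: "\<zero> \<in> G" "\<And>x y. x \<in> G \<Longrightarrow> y \<in> G \<Longrightarrow> x \<oplus> y \<in> G"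
      "\<And>c x. c \<in> K \<Longrightarrow> x \<in> G \<Longrightarrow> c \<otimes> x \<in> G" for A u G
    using that(1-4)
  proof (induction A rule: finite_induct)
    case (insert c A)
    then have "(\<lambda>c. u c \<otimes> c) \<in> A \<rightarrow> carrier R" "u c \<otimes> c \<in> carrier R"
      using K_carrier by (auto simp: Pi_iff subset_iff)
    then show ?case
      using insert G(2,3) by (subst finsum_insert) auto
  qed (simp add: G(1))
  show ?thesis
  proof (intro exI[of _ B] frobenius_basisI)
    show "B \<subseteq> carrier R"
      by (auto simp: B_def)
  next
    fix A u y b
    assume A: "finite A" "A \<subseteq> B" and u: "u \<in> A \<rightarrow> K" and y: "y \<in> carrier R"
      and sum: "(\<Oplus>b\<in>A. u b \<otimes> b) = y [^] p" and b: "b \<in> A"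
    have Ac: "A \<subseteq> carrier R"
      using A by (auto simp: B_def)
    have uc: "u a \<in> carrier R" if "a \<in> A" for a
      using that u K_carrier by auto
    show "u b = \<zero>"
    proof (rule ccontr)
      assume ub: "u b \<noteq> \<zero>"
      define A' where "A' = {a \<in> A. u a \<noteq> \<zero>}"
      have A': "finite A'" "A' \<noteq> {}" "A' \<subseteq> A"
        using A(1) b ub by (auto simp: A'_def)
      \<comment> \<open>A relation among accepted elements is solved for its greatest member with
        nonzero coefficient, which would then have been rejected.\<close>
      then obtain m where m: "m \<in> A'" "\<forall>a\<in>A'. a = m \<or> (a, m) \<in> ord"
        using finite_has_greatest[OF ord(2,3)] by blast
      have mA: "m \<in> A" "u m \<noteq> \<zero>" "m \<in> carrier R"
        using m(1) Ac by (auto simp: A'_def)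
      define v where "v = inv (u m)"
      have v: "v \<in> K" "v \<in> carrier R" "v \<otimes> u m = \<one>"
        using subfield_m_inv(1)[OF subfield_K, of "u m"] u mA K_carrier inv_mult_self[OF uc[OF mA(1)] mA(2)]
        by (auto simp: v_def)
      \<comment> \<open>The scalar \<open>v\<close> is itself a p-th power, \<open>K\<close> being
        perfect, so \<open>v y^p\<close> is still one.\<close>
      obtain v' where v': "v' \<in> K" "v' [^] p = v"
        using perfect[OF v(1)] by blast
      define S where "S = (\<Oplus>a\<in>A' - {m}. u a \<otimes> a)"
      have S: "S \<in> carrier R"
        unfolding S_def by (rule finsum_closed) (use uc Ac A'(3) in auto)
      have "y [^] p = (\<Oplus>a\<in>A'. u a \<otimes> a)"
        unfolding sum[symmetric]
        by (rule add.finprod_mono_neutral_cong_right) (use A uc Ac in \<open>auto simp: A'_def\<close>)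
      also have "\<dots> = (\<Oplus>a\<in>insert m (A' - {m}). u a \<otimes> a)"
        using m(1) by (simp add: insert_absorb)
      also have "\<dots> = u m \<otimes> m \<oplus> S"
        unfolding S_def by (rule finsum_insert) (use A' uc Ac mA in auto)
      finally have eq: "y [^] p = u m \<otimes> m \<oplus> S" .
      have "m = (v \<otimes> u m) \<otimes> m"
        using v mA by simp
      also have "\<dots> = v \<otimes> (y [^] p \<ominus> S)"
      proof -
        have "u m \<otimes> m = y [^] p \<ominus> S"
          unfolding eq using S uc[OF mA(1)] mA(3) by algebra
        then show ?thesis
          using v(2) uc[OF mA(1)] mA(3) by (simp add: m_assoc)
      qed
      also have "\<dots> = (\<ominus> v) \<otimes> S \<oplus> (v' \<otimes> y) [^] p"
      proof -
        have "(v' \<otimes> y) [^] p = v \<otimes> y [^] p"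
          using v' y K_carrier by (auto simp: nat_pow_distrib)
        then show ?thesis
          using v(2) S nat_pow_closed[OF y, of p] by simp algebra
      qed
      also have "(\<ominus> v) \<otimes> S = (\<Oplus>a\<in>A' - {m}. (\<ominus> v) \<otimes> (u a \<otimes> a))"
        unfolding S_def by (rule finsum_rdistr) (use A' uc Ac v in auto)
      also have "\<dots> = (\<Oplus>a\<in>A' - {m}. ((\<ominus> v) \<otimes> u a) \<otimes> a)"
        by (rule finsum_cong') (use A' uc Ac v in \<open>auto simp: m_assoc subset_iff\<close>)
      finally have "m = (\<Oplus>a\<in>A' - {m}. ((\<ominus> v) \<otimes> u a) \<otimes> a) \<oplus> (v' \<otimes> y) [^] p" .
      moreover have "(\<lambda>a. (\<ominus> v) \<otimes> u a) \<in> A' - {m} \<rightarrow> K"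
        using Pi_mem[OF u] A'(3) v(1) subringE(5,6)[OF K_subring] by (simp add: Pi_iff subset_iff)
      moreover have "v' \<otimes> y \<in> carrier R" "A' - {m} \<subseteq> carrier R" "\<forall>a\<in>A' - {m}. (a, m) \<in> ord"
        using v' y K_carrier A' Ac m(2) by auto
      ultimately have "comb m"
        using A'(1) unfolding comb_def
        by (intro exI[of _ "A' - {m}"] exI[of _ "\<lambda>a. (\<ominus> v) \<otimes> u a"] exI[of _ "v' \<otimes> y"] conjI) simp_all
      then show False
        using mA(1) A(2) by (auto simp: B_def)
    qed
  next
    fix G
    assume G: "K \<subseteq> G" "B \<subseteq> G" "\<And>x y. x \<in> G \<Longrightarrow> y \<in> G \<Longrightarrow> x \<oplus> y \<in> G"
      "\<And>c x. c \<in> K \<Longrightarrow> x \<in> G \<Longrightarrow> c \<otimes> x \<in> G" "\<And>x. x \<in> G \<Longrightarrow> x [^] p \<in> G"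
    have G0: "\<zero> \<in> G"
      using G(1) subringE(2)[OF K_subring] by auto
    have "x \<in> carrier R \<longrightarrow> x \<in> G" for x
    proof (induction x rule: wf_induct_rule[OF ord(1)])
      case (1 x)
      show ?case
      proof (intro impI)
        assume x: "x \<in> carrier R"
        show "x \<in> G"
        proof (cases "comb x")
          case False
          then show ?thesis using x G(2) by (auto simp: B_def)
        next
          case True
          then obtain A u y where A: "finite A" "A \<subseteq> carrier R" "\<forall>c\<in>A. (c, x) \<in> ord" "u \<in> A \<rightarrow> K"
            and y: "y \<in> carrier R" and eq: "x = (\<Oplus>c\<in>A. u c \<otimes> c) \<oplus> y [^] p"
            unfolding comb_def by blast
          define s where "s = (\<Oplus>c\<in>A. u c \<otimes> c)"
          have s: "s \<in> carrier R"
            unfolding s_def by (rule finsum_closed) (use A K_carrier in \<open>auto simp: Pi_iff subset_iff\<close>)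
          have sG: "s \<in> G"
            unfolding s_def using A 1 by (intro finsum_closed_in G0 G(3,4)) auto
          note I = idx(1)[OF x]
          have sW: "s \<in> W (idx x)"
            unfolding s_def using A x by (intro finsum_closed_in W(2-4)[OF I]) (auto intro: ord_W)
          have "y [^] p = x \<oplus> (\<ominus> \<one>) \<otimes> s"
            unfolding eq s_def[symmetric] using s nat_pow_closed[OF y, of p] by algebra
          moreover have "(\<ominus> \<one>) \<otimes> s \<in> W (idx x)"
            using W(4)[OF I _ sW] subringE(3,5)[OF K_subring] by blast
          ultimately have "y [^] p \<in> W (idx x)"
            using W(3)[OF I idx(2)[OF x]] by simp
          \<comment> \<open>For \<open>y\<close> in \<open>K\<close> the descent ends, since
            \<open>K\<close> is contained in \<open>G\<close>; otherwise \<open>y\<close> precedes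
            \<open>x\<close>, whatever the tie-breaking order says.\<close>
          then consider "y \<in> K" | j where "j \<in> I" "(j, idx x) \<in> prec" "y \<in> W j"
            using root[OF I y] by blast
          then have "y \<in> G"
            using G(1) 1 ord_less[OF y] y by cases auto
          then show ?thesis
            using eq sG G(3,5) unfolding s_def by auto
        qed
      qed
    qed
    then show "carrier R \<subseteq> G"
      by auto
  qed
qed


text \<open>The chain is indexed by pairs \<open>(z, k)\<close> in lexicographic order, where
  \<open>k\<close> measures the permitted pole order on a logarithmic scale. The root property rests
  on three facts about closures: integral closedness, which lowers \<open>k\<close>; discreteness,
  which applies at \<open>k = 0\<close>; and finite character, which leads from the closure of
  \<open>Y z\<close> to an earlier \<open>z\<close>.\<close>

lemma ex_frobenius_basis:
  assumes rac: "\<And>x. x \<in> carrier R \<Longrightarrow> algebraic K x \<Longrightarrow> x \<in> K"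
    and T: "finite T" "T \<subseteq> carrier R" "generate_field R (K \<union> T) = carrier R"
    and s: "s \<in> carrier R" "\<And>x. x \<in> carrier R \<Longrightarrow> algebraic (generate_field R (insert s K)) x"
  shows "\<exists>B. frobenius_basis B"
proof -
  have "\<exists>n. \<forall>b\<in>carrier R. primitive_dependency K (inv z) n b"
    if z: "z \<in> carrier R" "z \<notin> K" for z
  proof -
    have z0: "z \<noteq> \<zero>"
      using z(2) subringE(2)[OF K_subring] by auto
    have t: "inv z \<in> carrier R" "inv z \<noteq> \<zero>"
      using inv_closed inv_nonzero z(1) z0 by auto
    have "inv z \<notin> K"
      using subfield_m_inv(1)[OF subfield_K, of "inv z"] t inv_inv_field[OF z(1) z0] z(2) by auto
    then have tr: "transcendental K (inv z)"
      using rac[OF t(1)] by (auto simp: over_def)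
    let ?E = "generate_field R (insert (inv z) K)"
    have E: "subfield ?E R"
      using generate_field_is_subfield t(1) K_carrier by simp
    obtain n :: nat where n: "\<And>x. x \<in> carrier R \<Longrightarrow>
      \<exists>e. (\<forall>j<n. e j \<in> ?E) \<and> (\<exists>j<n. e j \<noteq> \<zero>) \<and> (\<Oplus>j\<in>{..<n}. e j \<otimes> x [^] j) = \<zero>"
      using bounded_relation[OF E finite_dimension_over_transcendental[OF subfield_K T s t(1) tr]] by auto
    have "primitive_dependency K (inv z) n b"
      if b: "b \<in> carrier R" for b
    proof -
      obtain e where "\<forall>j<n. e j \<in> ?E" "\<exists>j<n. e j \<noteq> \<zero>" "(\<Oplus>j\<in>{..<n}. e j \<otimes> b [^] j) = \<zero>"
        using n[OF b] by auto
      then show ?thesis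
        using primitive_relation_over_rationals[OF K_subring t b, of n e] by auto
    qed
    then show ?thesis by (intro exI[of _ n] ballI)
  qed
  then have "\<forall>z\<in>carrier R - K. \<exists>n. \<forall>b\<in>carrier R. primitive_dependency K (inv z) n b"
    by auto
  from bchoice[OF this] obtain N where
    N: "\<And>z b. z \<in> carrier R \<Longrightarrow> z \<notin> K \<Longrightarrow> b \<in> carrier R \<Longrightarrow> primitive_dependency K (inv z) (N z) b"
    by auto
  obtain r :: "'a rel" where r: "well_order_on UNIV r"
    using well_order_on by blast
  define lt where "lt = r - Id"
  have lt: "wf lt" "trans lt" "total lt"
    using r unfolding lt_def well_order_on_def linear_order_on_def partial_order_on_def
      preorder_on_def by (auto intro: trans_diff_Id simp: total_on_def)
  define prec where "prec = lt <*lex*> less_than"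
  have prec: "wf prec" "trans prec" "total prec"
    using lt unfolding prec_def by (auto intro!: trans_lex_prod simp: total_on_def)
  define Y where "Y z = K \<union> {y \<in> carrier R. (y, z) \<in> lt}" for z
  \<comment> \<open>If \<open>z\<close> is already in the closure of its predecessors, nothing is to
    be inserted; this branch also takes \<open>z = 0\<close>, for which \<open>inv z\<close> has no
    meaning, and all of \<open>K\<close>. Otherwise the exponent is \<open>p ^ N z\<close>, where
    \<open>N z\<close> is the relation length at \<open>inv z\<close>: a convenient power of
    \<open>p\<close> that is at least \<open>N z\<close>.\<close>
  define W where "W i = (case i of (z, k) \<Rightarrow> if z \<in> val_closure (Y z) then val_closure (Y z)
    else {x \<in> val_closure (insert z (Y z)).
      x [^] (p ^ N z) \<otimes> inv z [^] (p ^ k) \<in> val_closure (insert (inv z) (Y z))})" for i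
  have Y: "Y z \<subseteq> carrier R" "K \<subseteq> Y z" for z
    using K_carrier by (auto simp: Y_def)
  have Wlt: "val_closure (Y z) \<subseteq> W (z, k)" if z: "z \<in> carrier R" for z k
  proof (cases "z \<in> val_closure (Y z)")
    case True
    then show ?thesis by (simp add: W_def)
  next
    case False
    then have "z \<noteq> \<zero>"
      using subringE(2)[OF val_closure_subring] by auto
    then have "inv z \<in> val_closure (insert (inv z) (Y z))"
      using val_closure_incl[of "insert (inv z) (Y z)"] inv_closed[OF z] Y by auto
    moreover have "x \<in> val_closure (insert (inv z) (Y z))" "x \<in> val_closure (insert z (Y z))"
      if "x \<in> val_closure (Y z)" for x
      using that val_closure_mono[of "Y z"] by blast+
    ultimately show ?thesis
      using False subringE(6)[OF val_closure_subring] nat_pow_in_subring[OF val_closure_subring]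
      by (auto simp: W_def)
  qed
  have Wle: "W (z, k) \<subseteq> val_closure (insert z (Y z))" for z k
    using val_closure_mono[of "Y z" "insert z (Y z)"] by (auto simp: W_def)
  have Wc: "W i \<subseteq> carrier R" for i
    using val_closure_carrier by (cases i) (auto simp: W_def)
  have not_K: "z \<notin> K" "z \<noteq> \<zero>" if "z \<notin> val_closure (Y z)" for z
    using that val_closure_incl[OF Y(1)] Y(2) subringE(2)[OF val_closure_subring] by auto
  have ladder: "\<exists>k. x \<in> W (z, k)" if z: "z \<in> carrier R" and x: "x \<in> val_closure (insert z (Y z))" for x z
  proof (cases "z \<in> val_closure (Y z)")
    case True
    then have "val_closure (insert z (Y z)) \<subseteq> val_closure (Y z)"
      using val_closure_incl[OF Y(1)] by (intro val_closure_idem) auto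
    then show ?thesis
      using x Wlt[OF z] by auto
  next
    case False
    note z0 = not_K(2)[OF False]
    have t: "inv z \<in> carrier R"
      using inv_closed[OF z z0] .
    have xc: "x \<in> carrier R"
      using x val_closure_carrier by auto
    let ?C = "val_closure (insert (inv z) (Y z))"
    have tC: "inv z \<in> ?C"
      using val_closure_incl[of "insert (inv z) (Y z)"] t Y by auto
    obtain n :: nat where n: "x \<otimes> inv z [^] n \<in> ?C"
      using val_closure_pole_bounded[OF Y(1) z z0 x] by auto
    let ?q = "p ^ N z"
    \<comment> \<open>If \<open>x t^n\<close> is in \<open>?C\<close>, so is
      \<open>x^q t^(nq)\<close>, and any \<open>k\<close> with \<open>p^k \<ge> n q\<close> will do;
      \<open>k = n q\<close> qualifies since \<open>k \<le> p^k\<close>.\<close>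
    let ?k = "n * ?q"
    have "?k \<le> p ^ ?k"
      using power_gt_expt[of p ?k] prime_gt_1_nat[OF prime_p] by simp
    then have eq: "p ^ ?k = n * ?q + (p ^ ?k - ?k)"
      by simp
    have "x [^] ?q \<otimes> inv z [^] (p ^ ?k) = (x \<otimes> inv z [^] n) [^] ?q \<otimes> inv z [^] (p ^ ?k - ?k)"
      by (subst eq) (use xc t in \<open>simp add: nat_pow_distrib nat_pow_pow nat_pow_mult[symmetric] m_assoc\<close>)
    also have "\<dots> \<in> ?C"
      using subringE(6)[OF val_closure_subring] nat_pow_in_subring[OF val_closure_subring] n tC by simp
    finally have "x \<in> W (z, ?k)"
      using x False by (simp add: W_def)
    then show ?thesis ..
  qed
  have earlier: "x \<in> K \<or> (\<exists>j\<in>carrier R \<times> UNIV. (j, (z, k)) \<in> prec \<and> x \<in> W j)"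
    if x: "x \<in> val_closure (Y z)" for x z and k :: nat
  proof -
    obtain Z where Z: "finite Z" "Z \<subseteq> Y z" "x \<in> val_closure Z"
      using val_closure_finite[OF Y(1) x] .
    show ?thesis
    proof (cases "Z \<subseteq> K")
      case True
      then show ?thesis
        using Z(3) val_closure_mono[OF True] val_closure_subfield[OF subfield_K rac] by auto
    next
      case False
      \<comment> \<open>Of the finitely many generators used, the greatest outside \<open>K\<close>
        has all others among its predecessors or in \<open>K\<close>. So \<open>x\<close> is in the
        closure of \<open>insert m (Y m)\<close> with \<open>m\<close> before \<open>z\<close>, also
        when \<open>z\<close> is a limit in the order.\<close>
      then obtain m where m: "m \<in> Z - K" "\<forall>y\<in>Z - K. y = m \<or> (y, m) \<in> lt"
        using finite_has_greatest[OF lt(2,3), of "Z - K"] Z(1) by auto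
      then have mz: "m \<in> carrier R" "(m, z) \<in> lt"
        using Z(2) by (auto simp: Y_def)
      have "Z \<subseteq> insert m (Y m)"
        using m(2) Z(2) K_carrier by (auto simp: Y_def)
      then have "x \<in> val_closure (insert m (Y m))"
        using Z(3) val_closure_mono by auto
      then obtain k' where "x \<in> W (m, k')"
        using ladder[OF mz(1)] by auto
      then show ?thesis
        using mz by (intro disjI2 bexI[of _ "(m, k')"]) (auto simp: prec_def)
    qed
  qed
  show ?thesis
  proof (rule ex_frobenius_basis_of_filtration[of prec "carrier R \<times> UNIV" W])
    fix i assume "i \<in> carrier R \<times> (UNIV :: nat set)"
    then obtain z k where i: "i = (z, k)" and z: "z \<in> carrier R"
      by auto
    let ?C = "val_closure (insert (inv z) (Y z))"
    have CK: "K \<subseteq> ?C" "K \<subseteq> val_closure (Y z)" "K \<subseteq> val_closure (insert z (Y z))" if "z \<noteq> \<zero>"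
      using val_closure_incl[of "insert (inv z) (Y z)"] val_closure_incl[of "Y z"]
        val_closure_incl[of "insert z (Y z)"] Y inv_closed[OF z that] z by blast+
    show "W i \<subseteq> carrier R"
      by (rule Wc)
    show "\<zero> \<in> W i"
      using Wlt[OF z, of k] subringE(2)[OF val_closure_subring] i by auto
    show "x \<oplus> y \<in> W i" if xy: "x \<in> W i" "y \<in> W i" for x y
    proof (cases "z \<in> val_closure (Y z)")
      case True
      then show ?thesis
        using xy subringE(7)[OF val_closure_subring] by (simp add: W_def i)
    next
      case False
      have xc: "x \<in> carrier R" "y \<in> carrier R" "inv z \<in> carrier R"
        using xy Wc[of i] inv_closed[OF z not_K(2)[OF False]] by auto
      then have "(x \<oplus> y) [^] (p ^ N z) \<otimes> inv z [^] (p ^ k) =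
          x [^] (p ^ N z) \<otimes> inv z [^] (p ^ k) \<oplus> y [^] (p ^ N z) \<otimes> inv z [^] (p ^ k)"
        by (simp add: frob_pow_add l_distr)
      then show ?thesis
        using False xy subringE(7)[OF val_closure_subring] by (simp add: W_def i)
    qed
    show "c \<otimes> x \<in> W i" if cx: "c \<in> K" "x \<in> W i" for c x
    proof (cases "z \<in> val_closure (Y z)")
      case True
      then have "c \<in> val_closure (Y z)"
        using val_closure_incl[OF Y(1)] Y(2) cx(1) by auto
      then show ?thesis
        using True cx subringE(6)[OF val_closure_subring] by (simp add: W_def i)
    next
      case False
      note z0 = not_K(2)[OF False]
      have xc: "x \<in> carrier R" "c \<in> carrier R" "inv z \<in> carrier R"
        using cx Wc[of i] K_carrier inv_closed[OF z z0] by auto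
      then have "(c \<otimes> x) [^] (p ^ N z) \<otimes> inv z [^] (p ^ k) =
          c [^] (p ^ N z) \<otimes> (x [^] (p ^ N z) \<otimes> inv z [^] (p ^ k))"
        by (simp add: nat_pow_distrib m_assoc)
      moreover have "c [^] (p ^ N z) \<in> ?C" "c \<in> val_closure (insert z (Y z))"
        using nat_pow_in_subring[OF val_closure_subring] CK[OF z0] cx(1) by auto
      ultimately show ?thesis
        using False cx(2) subringE(6)[OF val_closure_subring] by (simp add: W_def i)
    qed
    show "x \<in> K \<or> (\<exists>j\<in>carrier R \<times> UNIV. (j, i) \<in> prec \<and> x \<in> W j)"
      if x: "x \<in> carrier R" "x [^] p \<in> W i" for x
    proof -
      obtain p' where p': "p = Suc p'"
        using p_pos gr0_implies_Suc by blast
      have root: "x \<in> val_closure Z" if "x [^] p \<in> val_closure Z" "x \<in> carrier R" for x Z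
        using val_closure_root[of x p' Z] that p' by simp
      show ?thesis
      proof (cases "z \<in> val_closure (Y z)")
        case True
        then have "x \<in> val_closure (Y z)"
          using x root by (simp add: W_def i)
        then show ?thesis
          unfolding i by (rule earlier)
      next
        case False
        note z' = not_K[OF False]
        have t: "inv z \<in> carrier R"
          using inv_closed[OF z z'(2)] .
        have xp: "x [^] p \<in> val_closure (insert z (Y z))"
          "(x [^] p) [^] (p ^ N z) \<otimes> inv z [^] (p ^ k) \<in> ?C"
          using x(2) False by (auto simp: W_def i)
        show ?thesis
        proof (cases k)
          case 0
          \<comment> \<open>At the bottom, discreteness puts \<open>x^p\<close> into the closure of
            \<open>Y z\<close>; integral closedness passes this on to \<open>x\<close>, and
            \<open>earlier\<close> leaves the block of \<open>z\<close>.\<close>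
          have "N z \<le> p ^ N z"
            using power_gt_expt[of p "N z"] prime_gt_1_nat[OF prime_p] by simp
          moreover have "(x [^] p) [^] (p ^ N z) \<otimes> inv z \<in> ?C"
            using xp(2) 0 t by simp
          ultimately have "x [^] p \<in> val_closure (Y z)"
            using val_closure_discrete[OF subfield_K Y(2,1) z z'(2) N[OF z z'(1)] xp(1)] by blast
          then show ?thesis
            unfolding i using root x(1) earlier by auto
        next
          case (Suc k')
          \<comment> \<open>The condition on \<open>x^p\<close> at \<open>k' + 1\<close> concerns
            the p-th power of the element tested for \<open>x\<close> at \<open>k'\<close>, and
            closures contain p-th roots.\<close>
          have "(x [^] (p ^ N z) \<otimes> inv z [^] (p ^ k')) [^] p = (x [^] p) [^] (p ^ N z) \<otimes> inv z [^] (p ^ k)"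
            using x(1) t Suc by (simp add: nat_pow_distrib nat_pow_pow mult.commute)
          then have "x [^] (p ^ N z) \<otimes> inv z [^] (p ^ k') \<in> ?C"
            using root xp(2) x(1) t by simp
          then have "x \<in> W (z, k')"
            using False root[OF xp(1) x(1)] by (simp add: W_def)
          then show ?thesis
            using z Suc by (intro disjI2 bexI[of _ "(z, k')"]) (auto simp: prec_def i)
        qed
      qed
    qed
  next
    fix i j assume i: "i \<in> carrier R \<times> (UNIV :: nat set)" and j: "j \<in> carrier R \<times> (UNIV :: nat set)"
      and ij: "(i, j) \<in> prec"
    obtain z k z' k' where eq: "i = (z, k)" "j = (z', k')" and zc: "z \<in> carrier R" "z' \<in> carrier R"
      using i j by auto
    consider "(z, z') \<in> lt" | "z = z'" "k < k'"
      using ij by (auto simp: prec_def eq)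
    then show "W i \<subseteq> W j"
    proof cases
      case 1
      then have "insert z (Y z) \<subseteq> Y z'"
        using zc transD[OF lt(2)] by (auto simp: Y_def)
      then show ?thesis
        using Wle[of z k] val_closure_mono Wlt[OF zc(2), of k'] unfolding eq by blast
    next
      case 2
      show ?thesis
      proof (cases "z \<in> val_closure (Y z)")
        case True
        then show ?thesis by (simp add: eq 2 W_def)
      next
        case False
        note z0 = not_K(2)[OF False]
        have t: "inv z \<in> carrier R"
          using inv_closed[OF zc(1) z0] .
        have tC: "inv z \<in> val_closure (insert (inv z) (Y z))"
          using val_closure_incl[of "insert (inv z) (Y z)"] t Y by auto
        have "p ^ k \<le> p ^ k'"
          using 2 p_pos by (intro power_increasing) auto
        then have "x [^] (p ^ N z) \<otimes> inv z [^] (p ^ k') =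
            (x [^] (p ^ N z) \<otimes> inv z [^] (p ^ k)) \<otimes> inv z [^] (p ^ k' - p ^ k)" if "x \<in> carrier R" for x
          using that t by (simp add: m_assoc nat_pow_mult)
        then have "x [^] (p ^ N z) \<otimes> inv z [^] (p ^ k') \<in> val_closure (insert (inv z) (Y z))"
          if "x \<in> carrier R" "x [^] (p ^ N z) \<otimes> inv z [^] (p ^ k) \<in> val_closure (insert (inv z) (Y z))" for x
          using that subringE(6)[OF val_closure_subring] nat_pow_in_subring[OF val_closure_subring tC] by simp
        then show ?thesis
          using val_closure_carrier False unfolding eq 2(1)[symmetric] W_def by auto
      qed
    qed
  next
    fix x assume x: "x \<in> carrier R"
    then have "x \<in> val_closure (insert x (Y x))"
      using val_closure_incl[of "insert x (Y x)"] Y by auto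
    then show "\<exists>i\<in>carrier R \<times> UNIV. x \<in> W i"
      using ladder[OF x] x by auto
  qed (use prec in simp_all)
qed

end


subsection \<open>The ring of additive polynomials\<close>

text \<open>The Cauchy-product reordering on which both associativity of the ring and compatibility
  of its action rest.\<close>

lemma (in abelian_monoid) finsum_triangle:
  assumes "\<And>i j. f i j \<in> carrier G"
  shows "(\<Oplus>k\<in>{..n::nat}. \<Oplus>j\<in>{..k}. f j (k - j)) = (\<Oplus>j\<in>{..n}. \<Oplus>i\<in>{..n - j}. f j i)"
proof (induction n)
  case 0
  then show ?case using assms by simp
next
  case (Suc n)
  have "(\<Oplus>i\<in>{..Suc n - j}. f j i) = f j (Suc n - j) \<oplus> (\<Oplus>i\<in>{..n - j}. f j i)" if "j \<le> n" for j
    using that assms by (simp add: Suc_diff_le)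
  then have "(\<Oplus>j\<in>{..n}. \<Oplus>i\<in>{..Suc n - j}. f j i)
      = (\<Oplus>j\<in>{..n}. f j (Suc n - j) \<oplus> (\<Oplus>i\<in>{..n - j}. f j i))"
    using assms by (intro finsum_cong') auto
  also have "\<dots> = (\<Oplus>j\<in>{..n}. f j (Suc n - j)) \<oplus> (\<Oplus>j\<in>{..n}. \<Oplus>i\<in>{..n - j}. f j i)"
    using assms by (intro finsum_addf) auto
  finally show ?case
    using Suc assms by (simp add: finsum_Suc a_assoc)
qed

context perfect_subfield
begin

abbreviation "APR \<equiv> additive_poly_ring (R\<lparr>carrier := K\<rparr>) p"

text \<open>Scalar multiplication of \<open>frobenius_module R p\<close>, freed from the record so
  that it can be computed in \<open>R\<close>.\<close>

definition act :: "(nat \<Rightarrow> 'a) \<Rightarrow> 'a \<Rightarrow> 'a" where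
  "act f x = (\<Oplus>i\<in>{i. f i \<noteq> \<zero>}. f i \<otimes> x [^] (p ^ i))"

lemma APR_carrier: "f \<in> carrier APR \<longleftrightarrow> (\<forall>i. f i \<in> K) \<and> (\<exists>n. \<forall>m>n. f m = \<zero>)"
  by (auto simp: additive_poly_ring_def up_def bound_def)

lemma APR_carrierI:
  assumes "\<And>i. f i \<in> K" "\<And>m. m > n \<Longrightarrow> f m = \<zero>"
  shows "f \<in> carrier APR"
  using assms unfolding APR_carrier by blast

lemma APR_carrierD:
  assumes "f \<in> carrier APR"
  shows "f i \<in> K" "f i \<in> carrier R"
  using assms K_carrier unfolding APR_carrier by auto

lemma APR_bound:
  assumes "f \<in> carrier APR"
  obtains n where "\<And>m. m > n \<Longrightarrow> f m = \<zero>"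
  using assms unfolding APR_carrier by auto

lemma finsum_K:
  assumes "f \<in> A \<rightarrow> K"
  shows "finsum (R\<lparr>carrier := K\<rparr>) f A = finsum R f A"
proof -
  interpret K: ring "R\<lparr>carrier := K\<rparr>"
    using subring_is_ring[OF K_subring] .
  show ?thesis
  proof (cases "finite A")
    case True
    then show ?thesis
      using assms
    proof (induction A rule: finite_induct)
      case empty
      then show ?case
        using K.finsum_empty[of f] by simp
    next
      case (insert a A)
      then have "f \<in> A \<rightarrow> carrier R" "f a \<in> carrier R"
        using K_carrier by (auto simp: Pi_iff)
      then show ?case
        using insert K.finsum_insert[of A a f] by (simp add: Pi_iff)
    qed
  qed (simp add: K.finsum_infinite finsum_infinite)
qed

lemma K_closed:
  "a \<in> K \<Longrightarrow> b \<in> K \<Longrightarrow> a \<oplus> b \<in> K" "a \<in> K \<Longrightarrow> b \<in> K \<Longrightarrow> a \<otimes> b \<in> K" "\<zero> \<in> K" "\<one> \<in> K"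
  "a \<in> K \<Longrightarrow> \<ominus> a \<in> K" "a \<in> K \<Longrightarrow> a [^] (k::nat) \<in> K"
  using subringE[OF K_subring] nat_pow_in_subring[OF K_subring] by auto

lemma APR_simps:
  "\<one>\<^bsub>APR\<^esub> = (\<lambda>n. if n = 0 then \<one> else \<zero>)" "\<zero>\<^bsub>APR\<^esub> = (\<lambda>n. \<zero>)"
  "f \<oplus>\<^bsub>APR\<^esub> g = (\<lambda>n. f n \<oplus> g n)"
  by (simp_all add: additive_poly_ring_def cong: if_cong)

lemma APR_mult:
  assumes "f \<in> carrier APR" "g \<in> carrier APR"
  shows "(f \<otimes>\<^bsub>APR\<^esub> g) n = (\<Oplus>i\<in>{..n}. f i \<otimes> g (n - i) [^] (p ^ i))"
proof -
  have "(\<lambda>i. f i \<otimes> g (n - i) [^] (p ^ i)) \<in> {..n} \<rightarrow> K"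
    using APR_carrierD(1) assms by (auto intro!: K_closed)
  then show ?thesis
    using finsum_K by (simp add: additive_poly_ring_def nat_pow_consistent[symmetric])
qed

lemma APR_add_closed: "f \<in> carrier APR \<Longrightarrow> g \<in> carrier APR \<Longrightarrow> f \<oplus>\<^bsub>APR\<^esub> g \<in> carrier APR"
proof -
  assume f: "f \<in> carrier APR" and g: "g \<in> carrier APR"
  obtain m n where "\<And>i. i > m \<Longrightarrow> f i = \<zero>" "\<And>i. i > n \<Longrightarrow> g i = \<zero>"
    using APR_bound[OF f] APR_bound[OF g] by metis
  then show ?thesis
    using APR_carrierD(1)[OF f] APR_carrierD(1)[OF g]
    by (intro APR_carrierI[of _ "m + n"]) (auto simp: APR_simps intro!: K_closed)
qed

lemma APR_mult_bound:
  assumes "f \<in> carrier APR" "g \<in> carrier APR"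
    and "\<And>i. i > m \<Longrightarrow> f i = \<zero>" "\<And>i. i > n \<Longrightarrow> g i = \<zero>" "k > m + n"
  shows "(f \<otimes>\<^bsub>APR\<^esub> g) k = \<zero>"
  unfolding APR_mult[OF assms(1,2)]
proof (rule add.finprod_one_eqI)
  fix i assume "i \<in> {..k}"
  then consider "i > m" | "k - i > n"
    using assms(5) by force
  then show "f i \<otimes> g (k - i) [^] (p ^ i) = \<zero>"
    using assms(3,4) APR_carrierD(2)[OF assms(1)] APR_carrierD(2)[OF assms(2)]
    by cases (auto simp: zero_pow_p)
qed

lemma APR_mult_closed:
  assumes f: "f \<in> carrier APR" and g: "g \<in> carrier APR"
  shows "f \<otimes>\<^bsub>APR\<^esub> g \<in> carrier APR"
proof -
  obtain m where m: "\<And>i. i > m \<Longrightarrow> f i = \<zero>"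
    using APR_bound[OF f] by auto
  obtain n where n: "\<And>i. i > n \<Longrightarrow> g i = \<zero>"
    using APR_bound[OF g] by auto
  show ?thesis
  proof (rule APR_carrierI[of _ "m + n"])
    show "(f \<otimes>\<^bsub>APR\<^esub> g) k \<in> K" for k
      unfolding APR_mult[OF f g] using APR_carrierD(1)[OF f] APR_carrierD(1)[OF g]
      by (intro finsum_in_subring[OF K_subring]) (auto intro!: K_closed)
    show "(f \<otimes>\<^bsub>APR\<^esub> g) k = \<zero>" if "k > m + n" for k
      using APR_mult_bound[OF f g m n that] .
  qed
qed

lemma APR_one_closed: "\<one>\<^bsub>APR\<^esub> \<in> carrier APR"
  by (intro APR_carrierI[of _ 0]) (auto simp: APR_simps intro: K_closed)

lemma APR_zero_closed: "\<zero>\<^bsub>APR\<^esub> \<in> carrier APR"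
  by (intro APR_carrierI[of _ 0]) (auto simp: APR_simps intro: K_closed)

lemma APR_mult_assoc:
  assumes f: "f \<in> carrier APR" and g: "g \<in> carrier APR" and h: "h \<in> carrier APR"
  shows "(f \<otimes>\<^bsub>APR\<^esub> g) \<otimes>\<^bsub>APR\<^esub> h = f \<otimes>\<^bsub>APR\<^esub> (g \<otimes>\<^bsub>APR\<^esub> h)"
proof
  fix n
  note c = APR_carrierD(2)[OF f] APR_carrierD(2)[OF g] APR_carrierD(2)[OF h]
  \<comment> \<open>The coefficient of the product of the monomials \<open>f_j \<phi>^j\<close>,
    \<open>g_i \<phi>^i\<close> and \<open>h_(n-j-i) \<phi>^(n-j-i)\<close>. The twist by
    \<open>p^j\<close> distributes over the inner sum because Frobenius powers are additive.\<close>
  let ?F = "\<lambda>j i. f j \<otimes> g i [^] (p ^ j) \<otimes> h (n - (j + i)) [^] (p ^ (j + i))"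
  have "((f \<otimes>\<^bsub>APR\<^esub> g) \<otimes>\<^bsub>APR\<^esub> h) n
      = (\<Oplus>k\<in>{..n}. (\<Oplus>j\<in>{..k}. f j \<otimes> g (k - j) [^] (p ^ j)) \<otimes> h (n - k) [^] (p ^ k))"
    using APR_mult[OF APR_mult_closed[OF f g] h] APR_mult[OF f g] by simp
  also have "\<dots> = (\<Oplus>k\<in>{..n}. \<Oplus>j\<in>{..k}. f j \<otimes> g (k - j) [^] (p ^ j) \<otimes> h (n - k) [^] (p ^ k))"
    by (intro finsum_cong' finsum_ldistr) (use c in auto)
  also have "\<dots> = (\<Oplus>k\<in>{..n}. \<Oplus>j\<in>{..k}. ?F j (k - j))"
    by (intro finsum_cong') (use c in auto)
  also have "\<dots> = (\<Oplus>j\<in>{..n}. \<Oplus>i\<in>{..n - j}. ?F j i)"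
    by (rule finsum_triangle) (use c in auto)
  also have "\<dots> = (\<Oplus>j\<in>{..n}. f j \<otimes> (g \<otimes>\<^bsub>APR\<^esub> h) (n - j) [^] (p ^ j))"
  proof (intro finsum_cong')
    fix j assume "j \<in> {..n}"
    have "(g \<otimes>\<^bsub>APR\<^esub> h) (n - j) [^] (p ^ j)
        = (\<Oplus>i\<in>{..n - j}. (g i \<otimes> h (n - j - i) [^] (p ^ i)) [^] (p ^ j))"
      unfolding APR_mult[OF g h] by (rule frob_pow_finsum) (use c in auto)
    then have "f j \<otimes> (g \<otimes>\<^bsub>APR\<^esub> h) (n - j) [^] (p ^ j)
        = (\<Oplus>i\<in>{..n - j}. f j \<otimes> (g i \<otimes> h (n - j - i) [^] (p ^ i)) [^] (p ^ j))"
      using finsum_rdistr[of "{..n - j}" "f j" "\<lambda>i. (g i \<otimes> h (n - j - i) [^] (p ^ i)) [^] (p ^ j)"] c by auto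
    also have "\<dots> = (\<Oplus>i\<in>{..n - j}. ?F j i)"
      by (intro finsum_cong')
        (use c in \<open>auto simp: nat_pow_distrib nat_pow_pow m_assoc power_add mult.commute\<close>)
    finally show "(\<Oplus>i\<in>{..n - j}. ?F j i) = f j \<otimes> (g \<otimes>\<^bsub>APR\<^esub> h) (n - j) [^] (p ^ j)"
      by simp
  qed (use c APR_carrierD(2)[OF APR_mult_closed[OF g h]] in auto)
  also have "\<dots> = (f \<otimes>\<^bsub>APR\<^esub> (g \<otimes>\<^bsub>APR\<^esub> h)) n"
    using APR_mult[OF f APR_mult_closed[OF g h]] by simp
  finally show "((f \<otimes>\<^bsub>APR\<^esub> g) \<otimes>\<^bsub>APR\<^esub> h) n = (f \<otimes>\<^bsub>APR\<^esub> (g \<otimes>\<^bsub>APR\<^esub> h)) n" .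
qed

lemma APR_one_mult:
  assumes f: "f \<in> carrier APR"
  shows "\<one>\<^bsub>APR\<^esub> \<otimes>\<^bsub>APR\<^esub> f = f" "f \<otimes>\<^bsub>APR\<^esub> \<one>\<^bsub>APR\<^esub> = f"
proof -
  note c = APR_carrierD(2)[OF f]
  show "\<one>\<^bsub>APR\<^esub> \<otimes>\<^bsub>APR\<^esub> f = f"
  proof
    fix n
    have "(\<one>\<^bsub>APR\<^esub> \<otimes>\<^bsub>APR\<^esub> f) n = (\<Oplus>i\<in>{..n}. if 0 = i then f (n - i) else \<zero>)"
      unfolding APR_mult[OF APR_one_closed f]
      by (intro finsum_cong') (use c in \<open>auto simp: APR_simps\<close>)
    then show "(\<one>\<^bsub>APR\<^esub> \<otimes>\<^bsub>APR\<^esub> f) n = f n"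
      using add.finprod_singleton[of 0 "{..n}" "\<lambda>i. f (n - i)"] c by simp
  qed
  show "f \<otimes>\<^bsub>APR\<^esub> \<one>\<^bsub>APR\<^esub> = f"
  proof
    fix n
    have "(f \<otimes>\<^bsub>APR\<^esub> \<one>\<^bsub>APR\<^esub>) n = (\<Oplus>i\<in>{..n}. if n = i then f i else \<zero>)"
      unfolding APR_mult[OF f APR_one_closed]
      by (intro finsum_cong') (use c in \<open>auto simp: APR_simps zero_pow_p\<close>)
    then show "(f \<otimes>\<^bsub>APR\<^esub> \<one>\<^bsub>APR\<^esub>) n = f n"
      using add.finprod_singleton[of n "{..n}" f] c by simp
  qed
qed

lemma APR_ring: "ring APR"
proof (rule ringI)
  show "abelian_group APR"
  proof (rule abelian_groupI)
    fix f assume f: "f \<in> carrier APR"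
    obtain n where n: "\<And>i. i > n \<Longrightarrow> f i = \<zero>"
      using APR_bound[OF f] by auto
    have "(\<lambda>i. \<ominus> f i) \<in> carrier APR"
      by (rule APR_carrierI[of _ n]) (use n APR_carrierD(1)[OF f] K_closed(5) in auto)
    moreover have "(\<lambda>i. \<ominus> f i) \<oplus>\<^bsub>APR\<^esub> f = \<zero>\<^bsub>APR\<^esub>"
      using APR_carrierD(2)[OF f] by (auto simp: APR_simps l_neg)
    ultimately show "\<exists>g\<in>carrier APR. g \<oplus>\<^bsub>APR\<^esub> f = \<zero>\<^bsub>APR\<^esub>"
      by blast
  qed (use APR_add_closed APR_zero_closed APR_carrierD(2) in \<open>auto simp: APR_simps a_ac\<close>)
  show "monoid APR"
    by (rule monoidI) (use APR_mult_closed APR_one_closed APR_mult_assoc APR_one_mult in auto)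
  fix f g h assume f: "f \<in> carrier APR" and g: "g \<in> carrier APR" and h: "h \<in> carrier APR"
  note c = APR_carrierD(2)[OF f] APR_carrierD(2)[OF g] APR_carrierD(2)[OF h]
  show "(f \<oplus>\<^bsub>APR\<^esub> g) \<otimes>\<^bsub>APR\<^esub> h = f \<otimes>\<^bsub>APR\<^esub> h \<oplus>\<^bsub>APR\<^esub> g \<otimes>\<^bsub>APR\<^esub> h"
  proof
    fix n
    have "((f \<oplus>\<^bsub>APR\<^esub> g) \<otimes>\<^bsub>APR\<^esub> h) n
        = (\<Oplus>i\<in>{..n}. f i \<otimes> h (n - i) [^] (p ^ i) \<oplus> g i \<otimes> h (n - i) [^] (p ^ i))"
      unfolding APR_mult[OF APR_add_closed[OF f g] h]
      by (intro finsum_cong') (use c in \<open>auto simp: APR_simps l_distr\<close>)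
    also have "\<dots> = (f \<otimes>\<^bsub>APR\<^esub> h) n \<oplus> (g \<otimes>\<^bsub>APR\<^esub> h) n"
      unfolding APR_mult[OF f h] APR_mult[OF g h] by (rule finsum_addf) (use c in auto)
    finally show "((f \<oplus>\<^bsub>APR\<^esub> g) \<otimes>\<^bsub>APR\<^esub> h) n = (f \<otimes>\<^bsub>APR\<^esub> h \<oplus>\<^bsub>APR\<^esub> g \<otimes>\<^bsub>APR\<^esub> h) n"
      by (simp add: APR_simps)
  qed
  show "h \<otimes>\<^bsub>APR\<^esub> (f \<oplus>\<^bsub>APR\<^esub> g) = h \<otimes>\<^bsub>APR\<^esub> f \<oplus>\<^bsub>APR\<^esub> h \<otimes>\<^bsub>APR\<^esub> g"
  proof
    fix n
    have "(h \<otimes>\<^bsub>APR\<^esub> (f \<oplus>\<^bsub>APR\<^esub> g)) n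
        = (\<Oplus>i\<in>{..n}. h i \<otimes> f (n - i) [^] (p ^ i) \<oplus> h i \<otimes> g (n - i) [^] (p ^ i))"
      unfolding APR_mult[OF h APR_add_closed[OF f g]]
      by (intro finsum_cong') (use c in \<open>auto simp: APR_simps r_distr frob_pow_add\<close>)
    also have "\<dots> = (h \<otimes>\<^bsub>APR\<^esub> f) n \<oplus> (h \<otimes>\<^bsub>APR\<^esub> g) n"
      unfolding APR_mult[OF h f] APR_mult[OF h g] by (rule finsum_addf) (use c in auto)
    finally show "(h \<otimes>\<^bsub>APR\<^esub> (f \<oplus>\<^bsub>APR\<^esub> g)) n = (h \<otimes>\<^bsub>APR\<^esub> f \<oplus>\<^bsub>APR\<^esub> h \<otimes>\<^bsub>APR\<^esub> g) n"
      by (simp add: APR_simps)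
  qed
qed

section \<open>The action of additive polynomials\<close>

lemma act_eq:
  assumes f: "f \<in> carrier APR" and n: "\<And>i. i > n \<Longrightarrow> f i = \<zero>" and x: "x \<in> carrier R"
  shows "act f x = (\<Oplus>i\<in>{..n}. f i \<otimes> x [^] (p ^ i))"
  unfolding act_def
  by (rule add.finprod_mono_neutral_cong_left)
    (use APR_carrierD(2)[OF f] n x in \<open>auto simp: not_less[symmetric]\<close>)

lemma act_closed:
  assumes f: "f \<in> carrier APR" and x: "x \<in> carrier R"
  shows "act f x \<in> carrier R"
  unfolding act_def using APR_carrierD(2)[OF f] x by (intro finsum_closed) auto

lemma act_K:
  assumes f: "f \<in> carrier APR" and x: "x \<in> K"
  shows "act f x \<in> K"
  unfolding act_def using APR_carrierD(1)[OF f] x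
  by (intro finsum_in_subring[OF K_subring]) (auto intro!: K_closed)

lemma act_add_right:
  assumes f: "f \<in> carrier APR" and x: "x \<in> carrier R" "y \<in> carrier R"
  shows "act f (x \<oplus> y) = act f x \<oplus> act f y"
proof -
  obtain n where n: "\<And>i. i > n \<Longrightarrow> f i = \<zero>"
    using APR_bound[OF f] by auto
  have eq: "act f z = (\<Oplus>i\<in>{..n}. f i \<otimes> z [^] (p ^ i))" if "z \<in> carrier R" for z
    by (rule act_eq[OF f _ that]) (rule n)
  have "act f (x \<oplus> y) = (\<Oplus>i\<in>{..n}. f i \<otimes> x [^] (p ^ i) \<oplus> f i \<otimes> y [^] (p ^ i))"
    unfolding eq[OF a_closed[OF x]]
    by (intro finsum_cong') (use APR_carrierD(2)[OF f] x in \<open>auto simp: frob_pow_add r_distr\<close>)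
  also have "\<dots> = act f x \<oplus> act f y"
    unfolding eq[OF x(1)] eq[OF x(2)]
    by (rule finsum_addf) (use APR_carrierD(2)[OF f] x in auto)
  finally show ?thesis .
qed

lemma act_add_left:
  assumes f: "f \<in> carrier APR" and g: "g \<in> carrier APR" and x: "x \<in> carrier R"
  shows "act (f \<oplus>\<^bsub>APR\<^esub> g) x = act f x \<oplus> act g x"
proof -
  obtain m where m: "\<And>i. i > m \<Longrightarrow> f i = \<zero>"
    using APR_bound[OF f] by auto
  obtain n where n: "\<And>i. i > n \<Longrightarrow> g i = \<zero>"
    using APR_bound[OF g] by auto
  note c = APR_carrierD(2)[OF f] APR_carrierD(2)[OF g]
  have "act (f \<oplus>\<^bsub>APR\<^esub> g) x = (\<Oplus>i\<in>{..m + n}. f i \<otimes> x [^] (p ^ i) \<oplus> g i \<otimes> x [^] (p ^ i))"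
    by (subst act_eq[OF APR_add_closed[OF f g] _ x, of "m + n"])
      (use m n c x in \<open>auto simp: APR_simps l_distr intro!: finsum_cong'\<close>)
  also have "\<dots> = (\<Oplus>i\<in>{..m + n}. f i \<otimes> x [^] (p ^ i)) \<oplus> (\<Oplus>i\<in>{..m + n}. g i \<otimes> x [^] (p ^ i))"
    by (rule finsum_addf) (use c x in auto)
  also have "\<dots> = act f x \<oplus> act g x"
    using act_eq[OF f _ x, of "m + n"] act_eq[OF g _ x, of "m + n"] m n by simp
  finally show ?thesis .
qed

lemma act_one: "x \<in> carrier R \<Longrightarrow> act \<one>\<^bsub>APR\<^esub> x = x"
  using act_eq[OF APR_one_closed, of 0 x] by (simp add: APR_simps)

lemma act_mult:
  assumes f: "f \<in> carrier APR" and g: "g \<in> carrier APR" and x: "x \<in> carrier R"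
  shows "act (f \<otimes>\<^bsub>APR\<^esub> g) x = act f (act g x)"
proof -
  obtain m where m: "\<And>i. i > m \<Longrightarrow> f i = \<zero>"
    using APR_bound[OF f] by auto
  obtain n where n: "\<And>i. i > n \<Longrightarrow> g i = \<zero>"
    using APR_bound[OF g] by auto
  note c = APR_carrierD(2)[OF f] APR_carrierD(2)[OF g]
  let ?F = "\<lambda>j i. f j \<otimes> g i [^] (p ^ j) \<otimes> x [^] (p ^ (j + i))"
  have "act (f \<otimes>\<^bsub>APR\<^esub> g) x = (\<Oplus>k\<in>{..m + n}. (f \<otimes>\<^bsub>APR\<^esub> g) k \<otimes> x [^] (p ^ k))"
    by (rule act_eq[OF APR_mult_closed[OF f g] _ x]) (use APR_mult_bound[OF f g, of m n] m n in blast)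
  also have "\<dots> = (\<Oplus>k\<in>{..m + n}. \<Oplus>j\<in>{..k}. f j \<otimes> g (k - j) [^] (p ^ j) \<otimes> x [^] (p ^ k))"
    unfolding APR_mult[OF f g] by (intro finsum_cong' finsum_ldistr) (use c x in auto)
  also have "\<dots> = (\<Oplus>k\<in>{..m + n}. \<Oplus>j\<in>{..k}. ?F j (k - j))"
    by (intro finsum_cong') (use c x in auto)
  also have "\<dots> = (\<Oplus>j\<in>{..m + n}. \<Oplus>i\<in>{..m + n - j}. ?F j i)"
    by (rule finsum_triangle) (use c x in auto)
  also have "\<dots> = (\<Oplus>j\<in>{..m + n}. f j \<otimes> act g x [^] (p ^ j))"
  proof (intro finsum_cong')
    fix j assume j: "j \<in> {..m + n}"
    show "(\<Oplus>i\<in>{..m + n - j}. ?F j i) = f j \<otimes> act g x [^] (p ^ j)"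
    \<comment> \<open>The inner range is sure to reach the degree bound \<open>n\<close> of
      \<open>g\<close> only if \<open>j \<le> m\<close>; for larger \<open>j\<close> the factor
      \<open>f j\<close> vanishes.\<close>
    proof (cases "j \<le> m")
      case True
      have "act g x = (\<Oplus>i\<in>{..m + n - j}. g i \<otimes> x [^] (p ^ i))"
        by (rule act_eq[OF g _ x]) (use True n in auto)
      then have "act g x [^] (p ^ j) = (\<Oplus>i\<in>{..m + n - j}. (g i \<otimes> x [^] (p ^ i)) [^] (p ^ j))"
        using frob_pow_finsum[of "{..m + n - j}" "\<lambda>i. g i \<otimes> x [^] (p ^ i)" j] c x by auto
      then have "f j \<otimes> act g x [^] (p ^ j)
          = (\<Oplus>i\<in>{..m + n - j}. f j \<otimes> (g i \<otimes> x [^] (p ^ i)) [^] (p ^ j))"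
        using finsum_rdistr[of "{..m + n - j}" "f j" "\<lambda>i. (g i \<otimes> x [^] (p ^ i)) [^] (p ^ j)"] c x by auto
      also have "\<dots> = (\<Oplus>i\<in>{..m + n - j}. ?F j i)"
        by (intro finsum_cong')
          (use c x in \<open>auto simp: nat_pow_distrib nat_pow_pow m_assoc power_add mult.commute\<close>)
      finally show ?thesis by simp
    next
      case False
      then have "f j = \<zero>"
        using m by simp
      then show ?thesis
        using c x act_closed[OF g x] by simp
    qed
  qed (use c x act_closed[OF g x] in auto)
  also have "\<dots> = act f (act g x)"
    by (rule act_eq[OF f _ act_closed[OF g x], symmetric]) (use m in auto)
  finally show ?thesis .
qed

lemma act_finsum:
  assumes f: "f \<in> carrier APR" and "finite A" "g \<in> A \<rightarrow> carrier R"
  shows "act f (\<Oplus>a\<in>A. g a) = (\<Oplus>a\<in>A. act f (g a))"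
  using assms(2,3)
proof (induction A rule: finite_induct)
  case empty
  have "act f \<zero> = act f \<zero> \<oplus> act f \<zero>"
    using act_add_right[OF f, of \<zero> \<zero>] by simp
  then show ?case
    using act_closed[OF f, of \<zero>] by simp
next
  case (insert a A)
  then have g: "g a \<in> carrier R" "g \<in> A \<rightarrow> carrier R"
    by auto
  then have "(\<lambda>a. act f (g a)) \<in> A \<rightarrow> carrier R" "act f (g a) \<in> carrier R"
    using act_closed[OF f] by auto
  then show ?case
    using insert g act_add_right[OF f g(1), of "\<Oplus>a\<in>A. g a"] by simp
qed

end


subsection \<open>The quotient module\<close>

context perfect_subfield
begin

abbreviation "QM \<equiv> quotient_module (frobenius_module R p) K"

abbreviation coset :: "'a \<Rightarrow> 'a set" where
  "coset x \<equiv> K +> x"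

lemma frobenius_module_additive:
  "a_rcosets\<^bsub>frobenius_module R p\<^esub> H = a_rcosets H"
  "H +>\<^bsub>frobenius_module R p\<^esub> x = H +> x"
  "set_add (frobenius_module R p) = set_add R"
  by (simp_all add: frobenius_module_def A_RCOSETS_def' a_r_coset_def' set_add_def' fun_eq_iff)

lemma QM_simps:
  "carrier QM = a_rcosets K" "\<zero>\<^bsub>QM\<^esub> = K" "C \<oplus>\<^bsub>QM\<^esub> D = C <+> D"
  "f \<odot>\<^bsub>QM\<^esub> C = (\<Union>x\<in>C. coset (act f x))"
  by (simp_all add: quotient_module_def frobenius_module_additive)
    (simp add: frobenius_module_def act_def)

lemma abelian_subgroup_K: "abelian_subgroup K R"
  using abelian_subgroupI3[OF _ is_abelian_group] subring.axioms(1)[OF K_subring]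
  by (simp add: additive_subgroup_def)

lemma K_subgroup: "subgroup K (add_monoid R)"
  using subring.axioms(1)[OF K_subring] .

lemma QM_carrierE:
  assumes "C \<in> carrier QM"
  obtains x where "x \<in> carrier R" "C = coset x"
  using assms by (auto simp: QM_simps A_RCOSETS_def' )

lemma coset_closed: "x \<in> carrier R \<Longrightarrow> coset x \<in> carrier QM"
  using a_rcosetsI[OF K_carrier] by (simp add: QM_simps)

lemma coset_add: "x \<in> carrier R \<Longrightarrow> y \<in> carrier R \<Longrightarrow> coset x \<oplus>\<^bsub>QM\<^esub> coset y = coset (x \<oplus> y)"
  using abelian_subgroup.a_rcos_sum[OF abelian_subgroup_K] by (simp add: QM_simps)

lemma coset_K_add:
  assumes "k \<in> K" "x \<in> carrier R"
  shows "coset (k \<oplus> x) = coset x"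
  using a_repr_independence[OF a_rcosI[OF assms(1) K_carrier assms(2)] assms(2) K_subgroup] by simp

lemma coset_zero_iff: "x \<in> carrier R \<Longrightarrow> coset x = \<zero>\<^bsub>QM\<^esub> \<longleftrightarrow> x \<in> K"
  using a_coset_join1[OF _ _ K_subgroup] a_coset_join2[OF _ K_subgroup] by (auto simp: QM_simps)

lemma QM_abelian_group: "abelian_group QM"
proof (rule abelian_groupI)
  have zero: "\<zero>\<^bsub>QM\<^esub> = coset \<zero>"
    using coset_zero_iff[of \<zero>] subringE(2)[OF K_subring] by simp
  show "\<zero>\<^bsub>QM\<^esub> \<in> carrier QM"
    unfolding zero by (simp add: coset_closed)
  fix C assume "C \<in> carrier QM"
  then obtain x where x: "x \<in> carrier R" "C = coset x"
    using QM_carrierE by auto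
  show "\<zero>\<^bsub>QM\<^esub> \<oplus>\<^bsub>QM\<^esub> C = C"
    unfolding zero x(2) using x(1) by (simp add: coset_add)
  have "coset (\<ominus> x) \<oplus>\<^bsub>QM\<^esub> C = \<zero>\<^bsub>QM\<^esub>"
    unfolding zero x(2) using x(1) by (simp add: coset_add l_neg)
  then show "\<exists>D\<in>carrier QM. D \<oplus>\<^bsub>QM\<^esub> C = \<zero>\<^bsub>QM\<^esub>"
    using coset_closed[of "\<ominus> x"] x(1) by auto
  fix D assume "D \<in> carrier QM"
  then obtain y where y: "y \<in> carrier R" "D = coset y"
    using QM_carrierE by auto
  show "C \<oplus>\<^bsub>QM\<^esub> D \<in> carrier QM" "C \<oplus>\<^bsub>QM\<^esub> D = D \<oplus>\<^bsub>QM\<^esub> C"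
    unfolding x(2) y(2) using x(1) y(1) by (simp_all add: coset_add coset_closed a_comm)
  fix E assume "E \<in> carrier QM"
  then obtain z where z: "z \<in> carrier R" "E = coset z"
    using QM_carrierE by auto
  show "C \<oplus>\<^bsub>QM\<^esub> D \<oplus>\<^bsub>QM\<^esub> E = C \<oplus>\<^bsub>QM\<^esub> (D \<oplus>\<^bsub>QM\<^esub> E)"
    unfolding x(2) y(2) z(2) using x(1) y(1) z(1) by (simp add: coset_add a_assoc)
qed

text \<open>The scalar multiplication of the quotient is a union over all representatives. It
  collapses to one coset because \<open>act f\<close> is additive and maps \<open>K\<close> into
  itself.\<close>

lemma coset_smult:
  assumes f: "f \<in> carrier APR" and x: "x \<in> carrier R"
  shows "f \<odot>\<^bsub>QM\<^esub> coset x = coset (act f x)"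
proof -
  have "coset (act f y) = coset (act f x)" if y: "y \<in> coset x" for y
  proof -
    obtain k where k: "k \<in> K" "y = k \<oplus> x"
      using y by (auto simp: a_r_coset_def')
    then have "act f y = act f k \<oplus> act f x"
      using act_add_right[OF f _ x] K_carrier by auto
    then show ?thesis
      using coset_K_add[OF act_K[OF f k(1)] act_closed[OF f x]] by simp
  qed
  moreover have "x \<in> coset x"
    using a_rcosI[OF K_closed(3) K_carrier x] x by simp
  ultimately show ?thesis
    unfolding QM_simps by blast
qed

lemma QM_left_module: "left_module APR QM"
proof (intro left_module.intro left_module_axioms.intro APR_ring QM_abelian_group)
  interpret APR: ring APR
    by (rule APR_ring)
  fix f g C D assume f: "f \<in> carrier APR" and C: "C \<in> carrier QM"
  obtain x where x: "x \<in> carrier R" "C = coset x"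
    using QM_carrierE[OF C] .
  note [simp] = coset_smult act_closed coset_closed coset_add
  show "f \<odot>\<^bsub>QM\<^esub> C \<in> carrier QM"
    using f x by simp
  show "f \<odot>\<^bsub>QM\<^esub> (C \<oplus>\<^bsub>QM\<^esub> D) = f \<odot>\<^bsub>QM\<^esub> C \<oplus>\<^bsub>QM\<^esub> f \<odot>\<^bsub>QM\<^esub> D" if D: "D \<in> carrier QM"
  proof -
    obtain y where "y \<in> carrier R" "D = coset y"
      using QM_carrierE[OF D] .
    then show ?thesis
      using f x by (simp add: act_add_right)
  qed
  assume g: "g \<in> carrier APR"
  show "(f \<oplus>\<^bsub>APR\<^esub> g) \<odot>\<^bsub>QM\<^esub> C = f \<odot>\<^bsub>QM\<^esub> C \<oplus>\<^bsub>QM\<^esub> g \<odot>\<^bsub>QM\<^esub> C"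
    using f g x coset_smult[OF APR.a_closed[OF f g] x(1)] by (simp add: act_add_left)
  show "(f \<otimes>\<^bsub>APR\<^esub> g) \<odot>\<^bsub>QM\<^esub> C = f \<odot>\<^bsub>QM\<^esub> (g \<odot>\<^bsub>QM\<^esub> C)"
    using f g x coset_smult[OF APR.m_closed[OF f g] x(1)] by (simp add: act_mult)
next
  fix C assume "C \<in> carrier QM"
  then obtain x where "x \<in> carrier R" "C = coset x"
    using QM_carrierE by blast
  then show "\<one>\<^bsub>APR\<^esub> \<odot>\<^bsub>QM\<^esub> C = C"
    using coset_smult[OF APR_one_closed] act_one by simp
qed

section \<open>Freeness from a Frobenius basis\<close>

lemma coset_finsum:
  assumes "finite A" "g \<in> A \<rightarrow> carrier R"
  shows "(\<Oplus>\<^bsub>QM\<^esub>a\<in>A. coset (g a)) = coset (\<Oplus>a\<in>A. g a)"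
proof -
  interpret QM: abelian_group QM
    by (rule QM_abelian_group)
  show ?thesis
    using assms
  proof (induction A rule: finite_induct)
    case empty
    then show ?case
      using coset_zero_iff[of \<zero>] K_closed(3) by simp
  next
    case (insert a A)
    then have g: "g a \<in> carrier R" "g \<in> A \<rightarrow> carrier R"
      by auto
    then have "(\<lambda>a. coset (g a)) \<in> A \<rightarrow> carrier QM" "coset (g a) \<in> carrier QM"
      using coset_closed by auto
    then show ?case
      using insert g coset_add by (simp add: QM.finsum_insert)
  qed
qed

text \<open>The constant terms of a relation \<open>s\<close> form a linear relation modulo \<open>p\<close>-th powers, hence vanish;
  then \<open>s\<close> is \<open>\<phi> s'\<close>, with \<open>K\<close> perfect, and \<open>\<phi>\<close> can be cancelled.\<close>

lemma additive_independence:
  assumes basis: "frobenius_basis B"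
    and A: "finite A" "A \<subseteq> B"
  shows "\<lbrakk>\<And>b. b \<in> A \<Longrightarrow> s b \<in> carrier APR; \<And>b i. b \<in> A \<Longrightarrow> i \<ge> n \<Longrightarrow> s b i = \<zero>;
    (\<Oplus>b\<in>A. act (s b) b) \<in> K; b \<in> A\<rbrakk> \<Longrightarrow> s b = \<zero>\<^bsub>APR\<^esub>"
proof (induction n arbitrary: s b)
  case 0
  then show ?case by (auto simp: APR_simps)
next
  case (Suc n)
  note B = frobenius_basisD(1)[OF basis]
  have bc: "b \<in> carrier R" if "b \<in> A" for b
    using that A B by auto
  obtain rt where rt: "\<And>c. c \<in> K \<Longrightarrow> rt c \<in> K" "\<And>c. c \<in> K \<Longrightarrow> rt c [^] p = c"
    using perfect by metis
  have rt0: "rt \<zero> = \<zero>"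
    using nat_pow_eq_zero[of "rt \<zero>" p] rt[of \<zero>] K_closed(3) K_carrier by auto
  \<comment> \<open>Shifting the coefficients down and taking p-th roots gives
    \<open>s b = s b 0 + \<phi> s' b\<close>, and the degree bound drops by one. That
    \<open>rt\<close> fixes 0 keeps the support finite.\<close>
  define s' where "s' b i = rt (s b (Suc i))" for b i
  have s'c: "s' b \<in> carrier APR" if "b \<in> A" for b
    by (rule APR_carrierI[of _ n])
      (use that Suc.prems(2) APR_carrierD(1)[OF Suc.prems(1)[OF that]] rt rt0 in \<open>auto simp: s'_def\<close>)
  have s'n: "s' b i = \<zero>" if "b \<in> A" "i \<ge> n" for b i
    using that Suc.prems(2) rt0 by (simp add: s'_def)
  have s_eq: "act (s b) b = s b 0 \<otimes> b \<oplus> act (s' b) b [^] p" if b: "b \<in> A" for b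
  proof -
    note c = APR_carrierD(2)[OF Suc.prems(1)[OF b]] APR_carrierD(2)[OF s'c[OF b]] bc[OF b]
    have "act (s b) b = (\<Oplus>i\<in>{..Suc n}. s b i \<otimes> b [^] (p ^ i))"
      by (rule act_eq) (use Suc.prems(1,2) b bc in auto)
    also have "\<dots> = (\<Oplus>i\<in>{..n}. s b (Suc i) \<otimes> b [^] (p ^ Suc i)) \<oplus> s b 0 \<otimes> b"
      by (subst finsum_Suc2) (use c in auto)
    also have "(\<Oplus>i\<in>{..n}. s b (Suc i) \<otimes> b [^] (p ^ Suc i)) = (\<Oplus>i\<in>{..n}. (s' b i \<otimes> b [^] (p ^ i)) [^] (p ^ 1))"
    proof (intro finsum_cong')
      fix i
      have "s b (Suc i) = s' b i [^] p"
        using rt(2) APR_carrierD(1)[OF Suc.prems(1)[OF b]] by (simp add: s'_def)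
      then show "s b (Suc i) \<otimes> b [^] (p ^ Suc i) = (s' b i \<otimes> b [^] (p ^ i)) [^] (p ^ 1)"
        using c by (simp add: nat_pow_distrib nat_pow_pow mult.commute)
    qed (use c in auto)
    also have "\<dots> = act (s' b) b [^] (p ^ 1)"
      by (subst act_eq[OF s'c[OF b] _ c(3), of n])
        (use s'n b c in \<open>auto intro!: frob_pow_finsum[where k = 1, simplified, symmetric]\<close>)
    finally show ?thesis
      using c act_closed[OF s'c[OF b] c(3)] by (simp add: a_comm)
  qed
  have cl: "s b 0 \<otimes> b \<in> carrier R" "act (s' b) b \<in> carrier R" if "b \<in> A" for b
    using APR_carrierD(2)[OF Suc.prems(1)[OF that]] act_closed[OF s'c[OF that]] bc[OF that] by auto
  define T where "T = (\<Oplus>b\<in>A. act (s' b) b)"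
  define U where "U = (\<Oplus>b\<in>A. s b 0 \<otimes> b)"
  have TU: "T \<in> carrier R" "U \<in> carrier R"
    unfolding T_def U_def using cl by (auto intro!: finsum_closed)
  have "(\<Oplus>b\<in>A. act (s b) b) = (\<Oplus>b\<in>A. s b 0 \<otimes> b \<oplus> act (s' b) b [^] p)"
    by (rule finsum_cong') (use s_eq cl in auto)
  also have "\<dots> = U \<oplus> (\<Oplus>b\<in>A. act (s' b) b [^] p)"
    unfolding U_def by (rule finsum_addf) (use cl in auto)
  also have "(\<Oplus>b\<in>A. act (s' b) b [^] p) = T [^] p"
    unfolding T_def using frob_pow_finsum[OF A(1), of "\<lambda>b. act (s' b) b" 1] cl by auto
  finally have "U \<oplus> T [^] p \<in> K"
    using Suc.prems(3) by simp
  \<comment> \<open>The value of the relation is only known to lie in \<open>K\<close>, so it is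
    written as a p-th power \<open>c^p\<close>. Then \<open>U\<close> is the p-th power of
    \<open>c - T\<close>, and independence modulo p-th powers applies to the constant terms.\<close>
  then obtain c where c: "c \<in> K" "c [^] p = U \<oplus> T [^] p"
    using perfect by blast
  have cc: "c \<in> carrier R"
    using c(1) K_carrier by auto
  have "(c \<oplus> \<ominus> T) [^] p = c [^] p \<oplus> \<ominus> (T [^] p)"
    using frob_add frob_minus cc TU by simp
  then have cT: "U = (c \<oplus> \<ominus> T) [^] p"
    unfolding c(2) using TU nat_pow_closed[OF TU(1), of p] by (simp add: a_assoc r_neg)
  have s0: "s b 0 = \<zero>" if "b \<in> A" for b
    using frobenius_basisD(2)[OF basis A, of "\<lambda>b. s b 0" "c \<oplus> \<ominus> T" b] cT APR_carrierD(1)[OF Suc.prems(1)] cc TU that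
    by (auto simp: U_def)
  have "U = \<zero>"
    unfolding U_def by (rule add.finprod_one_eqI) (use s0 bc in simp)
  \<comment> \<open>With the constant terms gone, injectivity of Frobenius gives
    \<open>T = c\<close>, so the relation \<open>s'\<close> again has its value in
    \<open>K\<close>.\<close>
  then have "c [^] p = T [^] p"
    using c(2) TU by simp
  then have "T \<in> K"
    using frob_inj[OF cc TU(1)] c(1) by simp
  then have "s' b = \<zero>\<^bsub>APR\<^esub>"
    by (intro Suc.IH[of s' b] s'c s'n Suc.prems(4)) (simp_all add: T_def)
  then have s'0: "s' b i = \<zero>" for i
    by (simp add: APR_simps)
  have "s b i = \<zero>" for i
  proof (cases i)
    case 0
    then show ?thesis using s0[OF Suc.prems(4)] by simp
  next
    case (Suc j)
    then have "s b i = s' b j [^] p"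
      using rt(2) APR_carrierD(1)[OF Suc.prems(1)[OF Suc.prems(4)]] by (simp add: s'_def)
    then show ?thesis
      using s'0 zero_pow_p[of 1] by simp
  qed
  then show ?case
    by (auto simp: APR_simps)
qed

text \<open>A basis consists of cosets, with coefficients attached to cosets, while independence and
  generation are known for elements of \<open>B\<close>; hence the passage through representatives
  on which \<open>coset\<close> is injective.\<close>

lemma free_left_module_QM:
  assumes basis: "frobenius_basis B"
  shows "free_left_module APR QM"
proof -
  note B = frobenius_basisD(1)[OF basis]
  interpret APR: ring APR
    by (rule APR_ring)
  interpret QM: abelian_group QM
    by (rule QM_abelian_group)
  have sum_cosets: "(\<Oplus>\<^bsub>QM\<^esub>b\<in>A. s b \<odot>\<^bsub>QM\<^esub> coset b) = coset (\<Oplus>b\<in>A. act (s b) b)"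
    if "finite A" "A \<subseteq> B" "\<And>b. b \<in> A \<Longrightarrow> s b \<in> carrier APR" for A s
  proof -
    have "(\<Oplus>\<^bsub>QM\<^esub>b\<in>A. s b \<odot>\<^bsub>QM\<^esub> coset b) = (\<Oplus>\<^bsub>QM\<^esub>b\<in>A. coset (act (s b) b))"
      by (rule QM.finsum_cong') (use that B coset_smult act_closed coset_closed in \<open>auto simp: subset_iff\<close>)
    also have "\<dots> = coset (\<Oplus>b\<in>A. act (s b) b)"
      by (rule coset_finsum) (use that B act_closed in auto)
    finally show ?thesis .
  qed
  have independent: "s b = \<zero>\<^bsub>APR\<^esub>"
    if A: "finite A" "A \<subseteq> B" and s: "\<And>b. b \<in> A \<Longrightarrow> s b \<in> carrier APR"
      and sum: "(\<Oplus>b\<in>A. act (s b) b) \<in> K" and b: "b \<in> A" for A s b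
  proof -
    have "\<forall>b\<in>A. \<exists>n. \<forall>i>n. s b i = \<zero>"
      using s unfolding APR_carrier by blast
    from bchoice[OF this] obtain n where n: "\<forall>b\<in>A. \<forall>i>n b. s b i = \<zero>" ..
    \<comment> \<open>\<open>additive_independence\<close> asks for vanishing from its bound on,
      whereas \<open>n b\<close> bounds the degree inclusively; hence \<open>Suc\<close>.\<close>
    have "s b i = \<zero>" if "b \<in> A" "i \<ge> Suc (Max (n ` A))" for b i
    proof -
      have "n b \<le> Max (n ` A)"
        using that A(1) by (intro Max_ge) auto
      then show ?thesis
        using n that by simp
    qed
    then show ?thesis
      by (intro additive_independence[OF basis A, where n = "Suc (Max (n ` A))"] s sum b)
  qed
  \<comment> \<open>The submodule generated by \<open>B\<close> and \<open>K\<close>. Scalars from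
    \<open>K\<close> and \<phi> are special elements of \<open>APR\<close>, so closure under the
    full action yields the closure properties that the generation clause asks for.\<close>
  define G where "G = {x \<in> carrier R. \<exists>A s k. finite A \<and> A \<subseteq> B \<and> (\<forall>b\<in>A. s b \<in> carrier APR) \<and> k \<in> K \<and>
    x = (\<Oplus>b\<in>A. act (s b) b) \<oplus> k}"
  have GI: "x \<in> G" if "finite A" "A \<subseteq> B" "\<And>b. b \<in> A \<Longrightarrow> s b \<in> carrier APR" "k \<in> K"
    "x = (\<Oplus>b\<in>A. act (s b) b) \<oplus> k" for A s k x
  proof -
    have "(\<Oplus>b\<in>A. act (s b) b) \<in> carrier R"
      using that B act_closed by (intro finsum_closed) auto
    then have "x \<in> carrier R"
      using that(4,5) K_carrier by auto
    then show ?thesis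
      using that unfolding G_def by blast
  qed
  have GE: "\<exists>A s k. finite A \<and> A \<subseteq> B \<and> (\<forall>b\<in>A. s b \<in> carrier APR) \<and> k \<in> K \<and>
    x = (\<Oplus>b\<in>A. act (s b) b) \<oplus> k" if "x \<in> G" for x
    using that by (simp add: G_def)
  have G_act: "act f x \<in> G" if f: "f \<in> carrier APR" and x: "x \<in> G" for f x
  proof -
    obtain A s k where A: "finite A" "A \<subseteq> B" "\<And>b. b \<in> A \<Longrightarrow> s b \<in> carrier APR" "k \<in> K"
      and eq: "x = (\<Oplus>b\<in>A. act (s b) b) \<oplus> k"
      using GE[OF x] by blast
    have c: "(\<lambda>b. act (s b) b) \<in> A \<rightarrow> carrier R" "k \<in> carrier R"
      using A B act_closed K_carrier by auto
    have "act f x = (\<Oplus>b\<in>A. act f (act (s b) b)) \<oplus> act f k"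
      unfolding eq using act_add_right[OF f finsum_closed[OF c(1)] c(2)] act_finsum[OF f A(1) c(1)] by simp
    also have "(\<Oplus>b\<in>A. act f (act (s b) b)) = (\<Oplus>b\<in>A. act (f \<otimes>\<^bsub>APR\<^esub> s b) b)"
      by (rule finsum_cong') (use A B f act_mult act_closed APR_mult_closed in \<open>auto simp: subset_iff\<close>)
    finally show ?thesis
      using A APR_mult_closed[OF f] act_K[OF f A(4)] by (intro GI[of A "\<lambda>b. f \<otimes>\<^bsub>APR\<^esub> s b"]) auto
  qed
  have "carrier R \<subseteq> G"
  proof (rule frobenius_basisD(3)[OF basis])
    show "K \<subseteq> G"
    proof
      fix k assume "k \<in> K"
      then show "k \<in> G"
        using K_carrier by (intro GI[of "{}" _ k]) auto
    qed
    show "B \<subseteq> G"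
    proof
      fix b assume "b \<in> B"
      then show "b \<in> G"
        using B act_one K_closed(3) by (intro GI[of "{b}" "\<lambda>_. \<one>\<^bsub>APR\<^esub>" \<zero>]) auto
    qed
    show "x \<oplus> y \<in> G" if xy: "x \<in> G" "y \<in> G" for x y
    proof -
      obtain A s k where A: "finite A" "A \<subseteq> B" "\<And>b. b \<in> A \<Longrightarrow> s b \<in> carrier APR" "k \<in> K"
        and x: "x = (\<Oplus>b\<in>A. act (s b) b) \<oplus> k"
        using GE[OF xy(1)] by blast
      obtain A' s' k' where A': "finite A'" "A' \<subseteq> B" "\<And>b. b \<in> A' \<Longrightarrow> s' b \<in> carrier APR" "k' \<in> K"
        and y: "y = (\<Oplus>b\<in>A'. act (s' b) b) \<oplus> k'"
        using GE[OF xy(2)] by blast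
      define e where "e s A b = (if b \<in> A then s b else \<zero>\<^bsub>APR\<^esub>)"
        for s :: "'a \<Rightarrow> nat \<Rightarrow> 'a" and A :: "'a set" and b
      have act0: "act \<zero>\<^bsub>APR\<^esub> b = \<zero>" for b
        by (simp add: act_def APR_simps)
      have e: "(\<Oplus>b\<in>C. act (s b) b) = (\<Oplus>b\<in>A \<union> A'. act (e s C b) b)"
        if "C \<subseteq> A \<union> A'" "\<And>b. b \<in> C \<Longrightarrow> s b \<in> carrier APR" for C s
        by (rule add.finprod_mono_neutral_cong_left)
          (use that A A' B act0 act_closed in \<open>auto simp: e_def subset_iff\<close>)
      have ec: "e s A b \<in> carrier APR" "e s' A' b \<in> carrier APR" if "b \<in> A \<union> A'" for b
        using A(3) A'(3) by (auto simp: e_def)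
      have bc: "b \<in> carrier R" if "b \<in> A \<union> A'" for b
        using that A(2) A'(2) B by auto
      have "(\<Oplus>b\<in>A \<union> A'. act (e s A b \<oplus>\<^bsub>APR\<^esub> e s' A' b) b)
          = (\<Oplus>b\<in>A \<union> A'. act (e s A b) b \<oplus> act (e s' A' b) b)"
        by (rule finsum_cong') (use ec bc act_add_left act_closed in auto)
      also have "\<dots> = (\<Oplus>b\<in>A. act (s b) b) \<oplus> (\<Oplus>b\<in>A'. act (s' b) b)"
        using e[of A s] e[of A' s'] A(3) A'(3) finsum_addf[of "\<lambda>b. act (e s A b) b" "A \<union> A'" "\<lambda>b. act (e s' A' b) b"]
          ec bc act_closed by auto
      finally have sum: "(\<Oplus>b\<in>A \<union> A'. act (e s A b \<oplus>\<^bsub>APR\<^esub> e s' A' b) b)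
          = (\<Oplus>b\<in>A. act (s b) b) \<oplus> (\<Oplus>b\<in>A'. act (s' b) b)" .
      have c: "(\<Oplus>b\<in>A. act (s b) b) \<in> carrier R" "(\<Oplus>b\<in>A'. act (s' b) b) \<in> carrier R"
        "k \<in> carrier R" "k' \<in> carrier R"
        using A A' B act_closed K_carrier by (auto intro!: finsum_closed)
      show ?thesis
      proof (rule GI[of "A \<union> A'" "\<lambda>b. e s A b \<oplus>\<^bsub>APR\<^esub> e s' A' b" "k \<oplus> k'"])
        show "x \<oplus> y = (\<Oplus>b\<in>A \<union> A'. act (e s A b \<oplus>\<^bsub>APR\<^esub> e s' A' b) b) \<oplus> (k \<oplus> k')"
          unfolding sum x y using c by (simp add: a_ac)
      qed (use A A' ec K_closed(1) APR_add_closed in auto)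
    qed
    show "c \<otimes> x \<in> G" if c: "c \<in> K" and x: "x \<in> G" for c x
    proof -
      let ?f = "\<lambda>n::nat. if n = 0 then c else \<zero>"
      have f: "?f \<in> carrier APR"
        by (rule APR_carrierI[of _ 0]) (use c K_closed(3) in auto)
      have "act ?f x = c \<otimes> x"
        using act_eq[OF f, of 0 x] x c K_carrier by (auto simp: G_def)
      then show ?thesis
        using G_act[OF f x] by simp
    qed
    show "x [^] p \<in> G" if x: "x \<in> G" for x
    proof -
      let ?f = "\<lambda>n::nat. if n = 1 then \<one> else \<zero>"
      have f: "?f \<in> carrier APR"
        by (rule APR_carrierI[of _ 1]) (use K_closed(3,4) in auto)
      have "act ?f x = x [^] p"
        using act_eq[OF f, of 1 x] x by (simp add: G_def)
      then show ?thesis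
        using G_act[OF f x] by simp
    qed
  qed
  have "module_basis APR QM (coset ` B)"
    unfolding module_basis_def
  proof (intro conjI allI impI ballI)
    show "coset ` B \<subseteq> carrier QM"
      using B coset_closed by auto
  next
    fix A' r C
    assume A': "finite A' \<and> A' \<subseteq> coset ` B \<and> r \<in> A' \<rightarrow> carrier APR \<and> (\<Oplus>\<^bsub>QM\<^esub>b\<in>A'. r b \<odot>\<^bsub>QM\<^esub> b) = \<zero>\<^bsub>QM\<^esub>"
      and C: "C \<in> A'"
    obtain A where A: "A \<subseteq> B" "inj_on coset A" "A' = coset ` A"
      using A' subset_image_inj[THEN iffD1, of A' coset B] by auto
    have fin: "finite A"
      using A' A finite_image_iff[of coset A] by simp
    have r: "r (coset b) \<in> carrier APR" if "b \<in> A" for b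
      using that A' A(3) by auto
    have bc: "b \<in> carrier R" if "b \<in> A" for b
      using that A B by auto
    have "\<zero>\<^bsub>QM\<^esub> = (\<Oplus>\<^bsub>QM\<^esub>C\<in>coset ` A. r C \<odot>\<^bsub>QM\<^esub> C)"
      using A' A(3) by simp
    also have "\<dots> = (\<Oplus>\<^bsub>QM\<^esub>b\<in>A. r (coset b) \<odot>\<^bsub>QM\<^esub> coset b)"
      by (rule QM.finsum_reindex) (use A(2) r bc coset_smult act_closed coset_closed in auto)
    also have "\<dots> = coset (\<Oplus>b\<in>A. act (r (coset b)) b)"
      by (rule sum_cosets[OF fin A(1) r])
    finally have "(\<Oplus>b\<in>A. act (r (coset b)) b) \<in> K"
      using coset_zero_iff[of "\<Oplus>b\<in>A. act (r (coset b)) b"] r bc act_closed by (auto intro: finsum_closed)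
    then have "r (coset b) = \<zero>\<^bsub>APR\<^esub>" if "b \<in> A" for b
      using that by (intro independent[OF fin A(1), of "\<lambda>b. r (coset b)"] r)
    then show "r C = \<zero>\<^bsub>APR\<^esub>"
      using C A(3) by auto
  next
    fix C assume "C \<in> carrier QM"
    then obtain x where x: "x \<in> carrier R" "C = coset x"
      using QM_carrierE by blast
    then obtain A s k where A: "finite A" "A \<subseteq> B" "\<And>b. b \<in> A \<Longrightarrow> s b \<in> carrier APR" "k \<in> K"
      and eq: "x = (\<Oplus>b\<in>A. act (s b) b) \<oplus> k"
      using GE[of x] \<open>carrier R \<subseteq> G\<close> by blast
    have bc: "b \<in> carrier R" if "b \<in> A" for b
      using that A B by auto
    \<comment> \<open>Two elements of \<open>B\<close> in one coset would differ by an element of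
      \<open>K\<close>, which is a p-th power as \<open>K\<close> is perfect: a relation modulo p-th
      powers with coefficients 1 and -1. Injectivity is what makes the coefficient function
      \<open>r\<close> on cosets well defined.\<close>
    have inj: "inj_on coset B"
    proof (rule inj_onI, rule ccontr)
      fix b b' assume b: "b \<in> B" "b' \<in> B" "coset b = coset b'" "b \<noteq> b'"
      have c: "b \<in> carrier R" "b' \<in> carrier R"
        using b B by auto
      have "b \<oplus> \<ominus> b' \<in> K"
        using a_coset_join1[OF a_coset_add_inv2[OF b(3) c K_carrier] _ K_subgroup] c by simp
      then obtain d where d: "d \<in> K" "d [^] p = b \<oplus> \<ominus> b'"
        using perfect by blast
      let ?u = "\<lambda>a. if a = b then \<one> else \<ominus> \<one>"
      have "(\<Oplus>a\<in>{b, b'}. ?u a \<otimes> a) = d [^] p"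
        unfolding d(2) using b(4) c by (simp add: l_minus)
      then have "?u b = \<zero>"
        using frobenius_basisD(2)[OF basis, of "{b, b'}" ?u d b] b d(1) K_closed(4,5) K_carrier by auto
      then show False
        by simp
    qed
    define r where "r = s \<circ> the_inv_into B coset"
    have r: "r (coset b) = s b" if "b \<in> A" for b
      using the_inv_into_f_f[OF inj] that A(2) by (auto simp: r_def)
    have "C = coset (\<Oplus>b\<in>A. act (s b) b)"
      unfolding x(2) eq using coset_K_add[OF A(4), of "\<Oplus>b\<in>A. act (s b) b"] A(3,4) bc act_closed K_carrier
      by (subst a_comm) (auto intro!: finsum_closed)
    also have "\<dots> = (\<Oplus>\<^bsub>QM\<^esub>b\<in>A. s b \<odot>\<^bsub>QM\<^esub> coset b)"
      by (rule sum_cosets[OF A(1,2,3), symmetric])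
    also have "\<dots> = (\<Oplus>\<^bsub>QM\<^esub>b\<in>A. r (coset b) \<odot>\<^bsub>QM\<^esub> coset b)"
      by (rule QM.finsum_cong') (use r A(3) bc coset_smult act_closed coset_closed in auto)
    also have "\<dots> = (\<Oplus>\<^bsub>QM\<^esub>D\<in>coset ` A. r D \<odot>\<^bsub>QM\<^esub> D)"
      by (rule QM.finsum_reindex[symmetric])
        (use r A(3) bc coset_smult act_closed coset_closed inj_on_subset[OF inj A(2)] in auto)
    finally show "\<exists>A r. finite A \<and> A \<subseteq> coset ` B \<and> r \<in> A \<rightarrow> carrier APR \<and> C = (\<Oplus>\<^bsub>QM\<^esub>b\<in>A. r b \<odot>\<^bsub>QM\<^esub> b)"
      using A(1,2,3) r by (intro exI[of _ "coset ` A"] exI[of _ r]) auto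
  qed
  then show ?thesis
    using QM_left_module unfolding free_left_module_def by blast
qed

end

text \<open>The characteristic is given for \<open>K\<close>, but \<open>add_pow\<close> does not
  look at the carrier, so it is that of \<open>F\<close>; a proper factorisation would yield zero
  divisors.\<close>

lemma ring_char_subfield:
  assumes "field F" "subfield K F" "ring_char (F\<lparr>carrier := K\<rparr>) = p" "p > 0"
  shows "Factorial_Ring.prime p" "add_pow F p \<one>\<^bsub>F\<^esub> = \<zero>\<^bsub>F\<^esub>"
proof -
  interpret field F by fact
  let ?P = "\<lambda>n::nat. n > 0 \<and> add_pow F n \<one>\<^bsub>F\<^esub> = \<zero>\<^bsub>F\<^esub>"
  have eq: "add_pow (F\<lparr>carrier := K\<rparr>) n x = add_pow F n x" for n :: nat and x
    by (simp add: add_pow_def nat_pow_def)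
  have ex: "\<exists>n. ?P n" and p: "p = (LEAST n. ?P n)"
    using assms(3,4) by (auto simp: ring_char_def eq split: if_splits)
  show zero: "add_pow F p \<one>\<^bsub>F\<^esub> = \<zero>\<^bsub>F\<^esub>"
    using LeastI_ex[OF ex] unfolding p by blast
  have least: "add_pow F n \<one>\<^bsub>F\<^esub> \<noteq> \<zero>\<^bsub>F\<^esub>" if "0 < n" "n < p" for n :: nat
    using not_less_Least[of n ?P] that unfolding p by blast
  show "Factorial_Ring.prime p"
    unfolding prime_nat_iff
  proof (intro conjI allI impI)
    have "p \<noteq> 1"
      using zero one_not_zero by auto
    then show "1 < p"
      using assms(4) by simp
    fix m assume "m dvd p"
    then obtain k where k: "p = m * k"
      by auto
    then have pos: "0 < m" "0 < k"
      using assms(4) by auto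
    have "add_pow F p \<one>\<^bsub>F\<^esub> = add_pow F m \<one>\<^bsub>F\<^esub> \<otimes>\<^bsub>F\<^esub> add_pow F k \<one>\<^bsub>F\<^esub>"
      using add.nat_pow_pow[of "\<one>\<^bsub>F\<^esub>" m k] k by (simp add: add_pow_ldistr mult.commute)
    then have "add_pow F m \<one>\<^bsub>F\<^esub> = \<zero>\<^bsub>F\<^esub> \<or> add_pow F k \<one>\<^bsub>F\<^esub> = \<zero>\<^bsub>F\<^esub>"
      using zero integral[of "add_pow F m \<one>\<^bsub>F\<^esub>" "add_pow F k \<one>\<^bsub>F\<^esub>"] by simp
    then have "p \<le> m \<or> p \<le> k"
      using least pos by (metis not_le)
    then show "m = 1 \<or> m = p"
      using k pos by auto
  qed
qed

theorem theorem11: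
  fixes F :: "('a, 'm) ring_scheme" and K :: "'a set" and p :: nat
  assumes "function_field F K"
    and "has_transcendence_degree F K 1"
    and "perfect_field (F\<lparr>carrier := K\<rparr>)"
    and "ring_char (F\<lparr>carrier := K\<rparr>) = p" and "p > 0"
    and "relatively_algebraically_closed F K"
  shows "free_left_module (additive_poly_ring (F\<lparr>carrier := K\<rparr>) p)
           (quotient_module (frobenius_module F p) K)"
proof -
  interpret field F
    using assms(1) by (simp add: function_field_def)
  have K: "subfield K F"
    using assms(1) by (simp add: function_field_def)
  note char = ring_char_subfield[OF field_axioms K assms(4,5)]
  interpret perfect_subfield F K p
  proof (intro perfect_subfield.intro perfect_subfield_axioms.intro field_axioms K char)
    show "\<exists>b\<in>K. b [^]\<^bsub>F\<^esub> p = a" if "a \<in> K" for a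
      using assms(3,4,5) that by (auto simp: perfect_field_def nat_pow_consistent[symmetric])
  qed
  obtain T where T: "finite T" "T \<subseteq> carrier F" "generate_field F (K \<union> T) = carrier F"
    using assms(1) by (auto simp: function_field_def)
  obtain S where S: "transcendence_basis F K S" "card S = 1"
    using assms(2) by (auto simp: has_transcendence_degree_def)
  obtain s where "S = {s}"
    using card_1_singletonE[OF S(2)] .
  then have s: "s \<in> carrier F" "\<And>x. x \<in> carrier F \<Longrightarrow> algebraic (generate_field F (insert s K)) x"
    using S(1) by (auto simp: transcendence_basis_def)
  have "x \<in> K" if "x \<in> carrier F" "algebraic K x" for x
    using assms(6) that by (simp add: relatively_algebraically_closed_def)
  then obtain B where "frobenius_basis B"
    using ex_frobenius_basis[OF _ T s] by blast
  then show ?thesis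
    by (rule free_left_module_QM)
qed

end
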